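(* Let $V$ be a finite set, $P$ a partial order on $V$, and $w:V\times V\to\mathbb{R}$ a hemimetric weighting function. Then any feasible (fractional) solution of the covering formulation [COV] (respectively of its fractional relaxation) can be transformed in polynomial time into a feasible (fractional) solution of the formulation [FAS] (respectively of its fractional relaxation) whose objective value $\sum_{i\neq j}\delta_{(i,j)}w_{(i,j)}$ is not larger than that of the original solution.
   Context: A partial order $P$ on a finite set $V$ is a reflexive, antisymmetric and transitive binary relation, viewed as a set of ordered pairs; in particular $(x,x)\in P$ for all $x\in V$. The set of incomparable pairs is $\mathrm{inc}(P)=\{(x,y)\in V\times V:(x,y)\notin P,\ (y,x)\notin P\}$. A function $w:V\times V\to\mathbb{R}$, written $w_{(i,j)}$, is hemimetric if for all $i,j,k\in V$: $w_{(i,j)}\ge 0$, $w_{(i,i)}=0$, and $w_{(i,k)}\le w_{(i,j)}+w_{(j,k)}$. A solution is a vector $\delta=(\delta_{(i,j)})$ indexed by ordered pairs $(i,j)$ of distinct elements of $V$. Only the entries on pairs in $\mathrm{inc}(P)$ are free; by convention, for $i\ne j$, $\delta_{(i,j)}=1$ if $(i,j)\in P$ and $\delta_{(i,j)}=0$ if $(j,i)\in P$. The objective value of $\delta$ is $\sum_{i\neq j}\delta_{(i,j)}w_{(i,j)}$. Formulation [FAS]: $\delta_{(i,j)}\in\{0,1\}$ for all distinct $i,j$; $\delta_{(i,j)}+\delta_{(j,i)}=1$ for all distinct $i,j$; and $\delta_{(i,j)}+\delta_{(j,k)}+\delta_{(k,i)}\ge 1$ for all distinct $i,j,k$. Its feasible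 solutions are exactly the linear extensions of $P$. Its fractional relaxation replaces $\{0,1\}$ by $[0,1]$. Covering formulation [COV]: $\delta_{(i,j)}\in\{0,1\}$ for $(i,j)\in\mathrm{inc}(P)$, subject to (C2) $\delta_{(x_1,y_1)}+\delta_{(x_2,y_2)}\ge 1$ for all $x_1,y_1,x_2,y_2\in V$ with $x_1\neq y_1$, $x_2\ne y_2$, $(x_2,y_1)\in P$ and $(x_1,y_2)\in P$; and (C3) $\delta_{(x_1,y_1)}+\delta_{(x_2,y_2)}+\delta_{(x_3,y_3)}\ge 1$ for all $x_1,y_1,x_2,y_2,x_3,y_3\in V$ with $x_i\ne y_i$, $(x_2,y_1)\in P$, $(x_3,y_2)\in P$ and $(x_1,y_3)\in P$. Its fractional relaxation replaces the integrality requirement by $\delta_{(i,j)}\ge 0$. *)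

theory Defs
  imports Complex_Main "HOL-Computational_Algebra.Polynomial"
begin

definition hemimetric_on :: "'a set \<Rightarrow> ('a \<times> 'a \<Rightarrow> real) \<Rightarrow> bool" where
  "hemimetric_on V w \<longleftrightarrow>
     (\<forall>i\<in>V. \<forall>j\<in>V. w (i, j) \<ge> 0) \<and>
     (\<forall>i\<in>V. w (i, i) = 0) \<and>
     (\<forall>i\<in>V. \<forall>j\<in>V. \<forall>k\<in>V. w (i, k) \<le> w (i, j) + w (j, k))"

definition inc :: "'a set \<Rightarrow> 'a rel \<Rightarrow> 'a rel" where
  "inc V P = {(x, y). x \<in> V \<and> y \<in> V \<and> (x, y) \<notin> P \<and> (y, x) \<notin> P}"

text \<open>
  A solution is a function on all ordered pairs; only its values on pairs of distinct elements
  of \<open>V\<close> are ever used. The following predicate is the convention that fixes the entries on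
  the comparable pairs, so that exactly the entries on \<open>inc V P\<close> remain free.
\<close>

definition fixes_comparable :: "'a set \<Rightarrow> 'a rel \<Rightarrow> ('a \<times> 'a \<Rightarrow> real) \<Rightarrow> bool" where
  "fixes_comparable V P \<delta> \<longleftrightarrow>
     (\<forall>i\<in>V. \<forall>j\<in>V. i \<noteq> j \<longrightarrow>
        ((i, j) \<in> P \<longrightarrow> \<delta> (i, j) = 1) \<and> ((j, i) \<in> P \<longrightarrow> \<delta> (i, j) = 0))"

definition objective :: "'a set \<Rightarrow> ('a \<times> 'a \<Rightarrow> real) \<Rightarrow> ('a \<times> 'a \<Rightarrow> real) \<Rightarrow> real" where
  "objective V w \<delta> = (\<Sum>(i, j) | i \<in> V \<and> j \<in> V \<and> i \<noteq> j. \<delta> (i, j) * w (i, j))"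

definition fas_constraints :: "'a set \<Rightarrow> 'a rel \<Rightarrow> ('a \<times> 'a \<Rightarrow> real) \<Rightarrow> bool" where
  "fas_constraints V P \<delta> \<longleftrightarrow>
     fixes_comparable V P \<delta> \<and>
     (\<forall>i\<in>V. \<forall>j\<in>V. i \<noteq> j \<longrightarrow> \<delta> (i, j) + \<delta> (j, i) = 1) \<and>
     (\<forall>i\<in>V. \<forall>j\<in>V. \<forall>k\<in>V. i \<noteq> j \<longrightarrow> j \<noteq> k \<longrightarrow> i \<noteq> k \<longrightarrow>
        \<delta> (i, j) + \<delta> (j, k) + \<delta> (k, i) \<ge> 1)"

definition fas_feasible :: "'a set \<Rightarrow> 'a rel \<Rightarrow> ('a \<times> 'a \<Rightarrow> real) \<Rightarrow> bool" where
  "fas_feasible V P \<delta> \<longleftrightarrow>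
     fas_constraints V P \<delta> \<and> (\<forall>i\<in>V. \<forall>j\<in>V. i \<noteq> j \<longrightarrow> \<delta> (i, j) \<in> {0, 1})"

definition fas_frac_feasible :: "'a set \<Rightarrow> 'a rel \<Rightarrow> ('a \<times> 'a \<Rightarrow> real) \<Rightarrow> bool" where
  "fas_frac_feasible V P \<delta> \<longleftrightarrow>
     fas_constraints V P \<delta> \<and> (\<forall>i\<in>V. \<forall>j\<in>V. i \<noteq> j \<longrightarrow> \<delta> (i, j) \<in> {0..1})"

definition cov_constraints :: "'a set \<Rightarrow> 'a rel \<Rightarrow> ('a \<times> 'a \<Rightarrow> real) \<Rightarrow> bool" where
  "cov_constraints V P \<delta> \<longleftrightarrow>
     fixes_comparable V P \<delta> \<and>
     (\<forall>x1\<in>V. \<forall>y1\<in>V. \<forall>x2\<in>V. \<forall>y2\<in>V.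
        x1 \<noteq> y1 \<longrightarrow> x2 \<noteq> y2 \<longrightarrow> (x2, y1) \<in> P \<longrightarrow> (x1, y2) \<in> P \<longrightarrow>
        \<delta> (x1, y1) + \<delta> (x2, y2) \<ge> 1) \<and>
     (\<forall>x1\<in>V. \<forall>y1\<in>V. \<forall>x2\<in>V. \<forall>y2\<in>V. \<forall>x3\<in>V. \<forall>y3\<in>V.
        x1 \<noteq> y1 \<longrightarrow> x2 \<noteq> y2 \<longrightarrow> x3 \<noteq> y3 \<longrightarrow>
        (x2, y1) \<in> P \<longrightarrow> (x3, y2) \<in> P \<longrightarrow> (x1, y3) \<in> P \<longrightarrow>
        \<delta> (x1, y1) + \<delta> (x2, y2) + \<delta> (x3, y3) \<ge> 1)"

definition cov_feasible :: "'a set \<Rightarrow> 'a rel \<Rightarrow> ('a \<times> 'a \<Rightarrow> real) \<Rightarrow> bool" where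
  "cov_feasible V P \<delta> \<longleftrightarrow>
     cov_constraints V P \<delta> \<and> (\<forall>p\<in>inc V P. \<delta> p \<in> {0, 1})"

definition cov_frac_feasible :: "'a set \<Rightarrow> 'a rel \<Rightarrow> ('a \<times> 'a \<Rightarrow> real) \<Rightarrow> bool" where
  "cov_frac_feasible V P \<delta> \<longleftrightarrow>
     cov_constraints V P \<delta> \<and> (\<forall>p\<in>inc V P. \<delta> p \<ge> 0)"

text \<open>
  Since weights and solutions are real-valued, running time is measured on a real random access
  machine, given here as a small imperative language with two memories, one for natural numbers
  (indices, counters, flags) and one for real numbers. Both are organised as an unbounded supply
  of two-dimensional arrays: the array name is a literal of the program, the two indices are
  computed. Each assignment and each evaluated test costs one time unit; expressions are part of
  the program text, so evaluating one takes a number of elementary operations that is bounded by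
  a constant of the program.

  There are deliberately no unit-cost products of two natural numbers or of two real numbers and
  no rounding from reals to naturals. Reals can only be added, subtracted, compared, and scaled
  by or divided by natural numbers, and naturals can only be added, subtracted and compared. Hence
  on rational inputs the numbers occurring in a run of \<open>T\<close> steps have encoding length polynomial
  in \<open>T\<close> and the input length, and a polynomial number of steps here is polynomial time on a
  Turing machine as well.
\<close>

datatype nexp =
    NConst nat
  | NCell nat nexp nexp
  | NAdd nexp nexp
  | NSub nexp nexp

datatype rexp =
    RNat nexp
  | RCell nat nexp nexp
  | RAdd rexp rexp
  | RSub rexp rexp
  | RScale nexp rexp
  | RQuot rexp nexp

datatype bexp =
    NLess nexp nexp
  | RLess rexp rexp
  | BNot bexp
  | BAnd bexp bexp

datatype com =
    Skip
  | NAssign nat nexp nexp nexp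
  | RAssign nat nexp nexp rexp
  | Seq com com
  | Cond bexp com com
  | While bexp com

type_synonym nmem = "nat \<Rightarrow> nat \<Rightarrow> nat \<Rightarrow> nat"
type_synonym rmem = "nat \<Rightarrow> nat \<Rightarrow> nat \<Rightarrow> real"
type_synonym memory = "nmem \<times> rmem"

fun nval :: "nexp \<Rightarrow> memory \<Rightarrow> nat" where
  "nval (NConst k) s = k"
| "nval (NCell a i j) s = fst s a (nval i s) (nval j s)"
| "nval (NAdd x y) s = nval x s + nval y s"
| "nval (NSub x y) s = nval x s - nval y s"

fun rval :: "rexp \<Rightarrow> memory \<Rightarrow> real" where
  "rval (RNat x) s = real (nval x s)"
| "rval (RCell a i j) s = snd s a (nval i s) (nval j s)"
| "rval (RAdd x y) s = rval x s + rval y s"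
| "rval (RSub x y) s = rval x s - rval y s"
| "rval (RScale k x) s = real (nval k s) * rval x s"
| "rval (RQuot x k) s = rval x s / real (nval k s)"

fun bval :: "bexp \<Rightarrow> memory \<Rightarrow> bool" where
  "bval (NLess x y) s \<longleftrightarrow> nval x s < nval y s"
| "bval (RLess x y) s \<longleftrightarrow> rval x s < rval y s"
| "bval (BNot b) s \<longleftrightarrow> \<not> bval b s"
| "bval (BAnd b1 b2) s \<longleftrightarrow> bval b1 s \<and> bval b2 s"

definition store :: "(nat \<Rightarrow> nat \<Rightarrow> nat \<Rightarrow> 'v) \<Rightarrow> nat \<Rightarrow> nat \<Rightarrow> nat \<Rightarrow> 'v \<Rightarrow> (nat \<Rightarrow> nat \<Rightarrow> nat \<Rightarrow> 'v)" where
  "store m a i j v = m(a := (m a)(i := (m a i)(j := v)))"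

text \<open>\<open>exec c s t s'\<close>: started in \<open>s\<close>, the program \<open>c\<close> halts after \<open>t\<close> time units in \<open>s'\<close>.\<close>

inductive exec :: "com \<Rightarrow> memory \<Rightarrow> nat \<Rightarrow> memory \<Rightarrow> bool" where
  Skip: "exec Skip s 1 s"
| NAssign: "exec (NAssign a i j x) (N, R) 1
     (store N a (nval i (N, R)) (nval j (N, R)) (nval x (N, R)), R)"
| RAssign: "exec (RAssign a i j x) (N, R) 1
     (N, store R a (nval i (N, R)) (nval j (N, R)) (rval x (N, R)))"
| Seq: "exec c1 s t1 s' \<Longrightarrow> exec c2 s' t2 s'' \<Longrightarrow> exec (Seq c1 c2) s (t1 + t2) s''"
| CondTrue: "bval b s \<Longrightarrow> exec c1 s t s' \<Longrightarrow> exec (Cond b c1 c2) s (Suc t) s'"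
| CondFalse: "\<not> bval b s \<Longrightarrow> exec c2 s t s' \<Longrightarrow> exec (Cond b c1 c2) s (Suc t) s'"
| WhileFalse: "\<not> bval b s \<Longrightarrow> exec (While b c) s 1 s"
| WhileTrue: "bval b s \<Longrightarrow> exec c s t1 s' \<Longrightarrow> exec (While b c) s' t2 s'' \<Longrightarrow>
     exec (While b c) s (Suc (t1 + t2)) s''"

text \<open>
  An instance is presented to the machine through an enumeration \<open>e\<close> of \<open>V\<close> by
  \<open>0, \<dots>, card V - 1\<close>: cell \<open>(0, 0)\<close> of natural array \<open>0\<close> holds \<open>card V\<close>, natural array \<open>1\<close> is
  the 0/1 matrix of \<open>P\<close>, real array \<open>0\<close> is the matrix of \<open>w\<close>, and real array \<open>1\<close> holds the
  off-diagonal entries of \<open>\<delta>\<close>. All other cells are \<open>0\<close>. The resulting solution is read off from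
  the off-diagonal entries of real array \<open>1\<close>.
\<close>

definition input_memory ::
  "(nat \<Rightarrow> 'a) \<Rightarrow> 'a set \<Rightarrow> 'a rel \<Rightarrow> ('a \<times> 'a \<Rightarrow> real) \<Rightarrow> ('a \<times> 'a \<Rightarrow> real) \<Rightarrow> memory" where
  "input_memory e V P w \<delta> =
     (\<lambda>a i j.
        if a = 0 \<and> i = 0 \<and> j = 0 then card V
        else if a = 1 \<and> i < card V \<and> j < card V \<and> (e i, e j) \<in> P then 1
        else 0,
      \<lambda>a i j.
        if a = 0 \<and> i < card V \<and> j < card V then w (e i, e j)
        else if a = 1 \<and> i < card V \<and> j < card V \<and> i \<noteq> j then \<delta> (e i, e j)
        else 0)"

definition holds_solution :: "(nat \<Rightarrow> 'a) \<Rightarrow> 'a set \<Rightarrow> memory \<Rightarrow> ('a \<times> 'a \<Rightarrow> real) \<Rightarrow> bool" where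
  "holds_solution e V s \<delta> \<longleftrightarrow>
     (\<forall>i<card V. \<forall>j<card V. i \<noteq> j \<longrightarrow> \<delta> (e i, e j) = snd s 1 i j)"

definition transforms_within ::
  "com \<Rightarrow> (nat \<Rightarrow> 'a) \<Rightarrow> 'a set \<Rightarrow> 'a rel \<Rightarrow> ('a \<times> 'a \<Rightarrow> real) \<Rightarrow> nat \<Rightarrow>
   ('a \<times> 'a \<Rightarrow> real) \<Rightarrow> ('a \<times> 'a \<Rightarrow> real) \<Rightarrow> bool" where
  "transforms_within c e V P w T \<delta> \<delta>' \<longleftrightarrow>
     (\<exists>t s. exec c (input_memory e V P w \<delta>) t s \<and> t \<le> T \<and> holds_solution e V s \<delta>')"

end

theory Submission
  imports Defs "Jordan_Normal_Form.Determinant"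
begin

text \<open>
  Number the vertices and put zeros on the diagonal. Taking for each entry of a [COV] solution the
  least entry whose constraints imply its own makes it monotone in \<open>P\<close> without increasing it; after
  that only the triangle inequalities \<open>d i j + d j k + d k i \<ge> u\<close> matter, where \<open>u\<close> is the unit.

  A \<^emph>\<open>pivot\<close> at \<open>v\<close> assigns positions \<open>x i = d i v\<close> (or \<open>x i = u - d v i\<close>) to the vertices and clamps
  every \<open>d i j\<close> to the interval that these positions allow. It preserves all constraints and settles
  \<open>v\<close> for good: \<open>d i v + d v i = u\<close>, and the metric triangle inequalities through \<open>v\<close> hold. When all
  vertices are settled, \<open>d\<close> is a solution of [FAS]. A single pivot may increase the cost, but the cost
  changes of both kinds of pivots at all vertices sum to at most \<open>0\<close>: they are controlled by
  the violations \<open>d i v - d i j - d j v\<close> of the metric triangle inequality, and regrouping the sum by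
  violations leaves the coefficients \<open>w i j + w j v - w j i - w v j - 2 * w i v\<close>, which are not
  positive for a hemimetric. So some pivot at an unsettled vertex is free of charge.

  Choosing it requires comparing costs, hence products of entries of \<open>d\<close> and \<open>w\<close>, and the machine
  cannot multiply reals. A fractional solution is therefore first moved to a vertex of the polytope
  of [COV] along integral directions, each time in the orientation that does not increase the cost;
  a vertex has rational entries with a common denominator \<open>D\<close>, a determinant, so that with the unit
  \<open>u = D\<close> all further values are naturals.
\<close>

section \<open>Pivots\<close>

text \<open>The obstacle behind the second half is multiplication. A product is available only if
  one factor is an integer of known size: binary search over a table of powers of two, itself built
  by doubling, turns such a real into a natural factor. So the directions must have integral entries
  throughout, which is why the elimination is fraction-free, and these entries need an a priori
  bound. With \<open>N = n * n\<close> coordinates, Cramer's rule and the Leibniz formula bound them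
  by \<open>N! * 3 ^ N\<close>, where 3 bounds the coefficients of a constraint; a constraint
  evaluated at a direction adds four such entries, and the result stays below
  \<open>2 ^ (2 * (N + 1) ^ 2)\<close>. Division by naturals is free, so ratios and the final
  rescaling by the unit cause no trouble.

  An integral solution avoids the walk to a vertex: its order closure is already 0/1, so the pivots
  can start with unit 1. Since they work on naturals, the outcome is then an integer between 0 and
  1.\<close>

definition cov_pt :: "nat \<Rightarrow> (nat \<Rightarrow> nat \<Rightarrow> bool) \<Rightarrow> real \<Rightarrow> (nat \<Rightarrow> nat \<Rightarrow> real) \<Rightarrow> bool" where
  "cov_pt n P u d \<longleftrightarrow>
     (\<forall>i<n. d i i = 0) \<and>
     (\<forall>i<n. \<forall>j<n. 0 \<le> d i j \<and> d i j \<le> u) \<and>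
     (\<forall>i<n. \<forall>j<n. \<forall>k<n. \<not> (i = j \<and> j = k) \<longrightarrow> u \<le> d i j + d j k + d k i) \<and>
     (\<forall>i<n. \<forall>j<n. \<forall>k<n. P i j \<longrightarrow> d j k \<le> d i k \<and> d k i \<le> d k j)"

text \<open>Think of \<open>u - d i j\<close> as the value that [FAS] demands for
  \<open>d j i\<close>: the interval requires each of the two to be at least 0 and at least the
  corresponding difference of positions. Its two margins add up to
  \<open>\<bar>x i - x j\<bar>\<close>, so it is nonempty for positions in
  \<open>[0, u]\<close>.\<close>

definition pivot :: "real \<Rightarrow> (nat \<Rightarrow> real) \<Rightarrow> (nat \<Rightarrow> nat \<Rightarrow> real) \<Rightarrow> nat \<Rightarrow> nat \<Rightarrow> real" where
  "pivot u x d i j = max (max 0 (x i - x j)) (min (d i j) (u - max 0 (x j - x i)))"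

text \<open>With \<open>True\<close>, \<open>x v = 0\<close>: the entries into \<open>v\<close> are
  kept and those out of \<open>v\<close> drop to their complement. With \<open>False\<close>,
  \<open>x v = u\<close> and the roles are exchanged. Both choices are antitone along
  \<open>P\<close>, as \<open>pivot_cov_pt\<close> requires.\<close>

definition pos :: "bool \<Rightarrow> real \<Rightarrow> (nat \<Rightarrow> nat \<Rightarrow> real) \<Rightarrow> nat \<Rightarrow> nat \<Rightarrow> real" where
  "pos b u d v i = (if b then d i v else u - d v i)"

abbreviation pivot_at :: "real \<Rightarrow> bool \<Rightarrow> (nat \<Rightarrow> nat \<Rightarrow> real) \<Rightarrow> nat \<Rightarrow> nat \<Rightarrow> nat \<Rightarrow> real" where
  "pivot_at u b d v \<equiv> pivot u (pos b u d v) d"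

definition settled :: "nat \<Rightarrow> real \<Rightarrow> (nat \<Rightarrow> nat \<Rightarrow> real) \<Rightarrow> nat \<Rightarrow> bool" where
  "settled n u d v \<longleftrightarrow>
     (\<forall>i<n. i \<noteq> v \<longrightarrow> d i v + d v i = u) \<and>
     (\<forall>i<n. \<forall>j<n. d i j \<le> d i v + d v j)"

definition cost :: "nat \<Rightarrow> (nat \<Rightarrow> nat \<Rightarrow> real) \<Rightarrow> (nat \<Rightarrow> nat \<Rightarrow> real) \<Rightarrow> real" where
  "cost n w d = (\<Sum>i<n. \<Sum>j<n. d i j * w i j)"

lemma cov_ptD:
  assumes "cov_pt n P u d" "i < n" "j < n"
  shows "d i i = 0" "0 \<le> d i j" "d i j \<le> u"
    "i \<noteq> j \<Longrightarrow> u \<le> d i j + d j i"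
    "k < n \<Longrightarrow> \<not> (i = j \<and> j = k) \<Longrightarrow> u \<le> d i j + d j k + d k i"
    "k < n \<Longrightarrow> P i j \<Longrightarrow> d j k \<le> d i k"
    "k < n \<Longrightarrow> P i j \<Longrightarrow> d k i \<le> d k j"
proof -
  show "d i i = 0" "0 \<le> d i j" "d i j \<le> u"
    "k < n \<Longrightarrow> \<not> (i = j \<and> j = k) \<Longrightarrow> u \<le> d i j + d j k + d k i"
    "k < n \<Longrightarrow> P i j \<Longrightarrow> d j k \<le> d i k"
    "k < n \<Longrightarrow> P i j \<Longrightarrow> d k i \<le> d k j"
    using assms unfolding cov_pt_def by blast+
  show "u \<le> d i j + d j i" if "i \<noteq> j"
  proof -
    have "u \<le> d i i + d i j + d j i" "d i i = 0"
      using assms that unfolding cov_pt_def by blast+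
    then show ?thesis by simp
  qed
qed

lemma pivot_bounds:
  assumes "0 \<le> x i" "x i \<le> u" "0 \<le> x j" "x j \<le> u"
  shows "0 \<le> pivot u x d i j" "pivot u x d i j \<le> u"
    "x i - x j \<le> pivot u x d i j" "pivot u x d i j \<le> u + x i - x j"
  using assms by (auto simp: pivot_def max_def min_def)

text \<open>If no entry of the triangle drops, the old inequality suffices. An entry that drops
  becomes \<open>u\<close>, which is enough alone, or \<open>u + x a - x b\<close>; in the latter
  case the other two entries are at least their differences of positions, and the differences around
  the triangle telescope to 0.\<close>

lemma pivot_triangle:
  assumes c: "cov_pt n P u d" and x: "\<And>i. i < n \<Longrightarrow> 0 \<le> x i \<and> x i \<le> u"
    and ijk: "i < n" "j < n" "k < n" "\<not> (i = j \<and> j = k)"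
  shows "u \<le> pivot u x d i j + pivot u x d j k + pivot u x d k i"
proof -
  have drop: "d a b \<le> pivot u x d a b \<or> pivot u x d a b = u \<or> pivot u x d a b = u + x a - x b"
    if "a < n" "b < n" for a b
    using cov_ptD[OF c that] x[OF that(1)] x[OF that(2)] by (auto simp: pivot_def max_def min_def)
  have nn: "0 \<le> pivot u x d a b" "x a - x b \<le> pivot u x d a b" if "a < n" "b < n" for a b
    using pivot_bounds(1,3)[of x a u b d] x[OF that(1)] x[OF that(2)] by blast+
  show ?thesis
    using drop[OF ijk(1,2)] drop[OF ijk(2,3)] drop[OF ijk(3,1)]
      nn[OF ijk(1,2)] nn[OF ijk(2,3)] nn[OF ijk(3,1)] cov_ptD(5)[OF c ijk(1,2,3,4)]
    by argo
qed

lemma pivot_mono: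
  assumes "d i j \<le> d i' j'" "x i \<le> x i'" "x j' \<le> x j"
  shows "pivot u x d i j \<le> pivot u x d i' j'"
proof -
  have "max 0 (x i - x j) \<le> max 0 (x i' - x j')" "max 0 (x j' - x i') \<le> max 0 (x j - x i)"
    using assms by (auto simp: max_def)
  then show ?thesis
    unfolding pivot_def using assms by (intro max.mono min.mono) auto
qed

text \<open>Antitone positions move both ends of the clamping interval in the direction in which
  \<open>d\<close> is monotone, so \<open>pivot_mono\<close> applies to both monotonicity
  constraints.\<close>

lemma pivot_cov_pt:
  assumes c: "cov_pt n P u d" and x: "\<And>i. i < n \<Longrightarrow> 0 \<le> x i \<and> x i \<le> u"
    and anti: "\<And>i j. i < n \<Longrightarrow> j < n \<Longrightarrow> P i j \<Longrightarrow> x j \<le> x i"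
  shows "cov_pt n P u (pivot u x d)"
  unfolding cov_pt_def
proof (intro conjI allI impI)
  fix i j assume ij: "i < n" "j < n"
  show "pivot u x d i i = 0"
    using cov_ptD(1)[OF c ij(1) ij(1)] x[OF ij(1)] by (auto simp: pivot_def)
  show "0 \<le> pivot u x d i j" "pivot u x d i j \<le> u"
    using pivot_bounds x ij by auto
  fix k assume k: "k < n"
  show "u \<le> pivot u x d i j + pivot u x d j k + pivot u x d k i" if "\<not> (i = j \<and> j = k)"
    using pivot_triangle[OF c x] ij k that by auto
  assume P: "P i j"
  show "pivot u x d j k \<le> pivot u x d i k" "pivot u x d k i \<le> pivot u x d k j"
    using cov_ptD(6,7)[OF c ij k P] anti[OF ij P] by (auto intro!: pivot_mono)
qed

lemma pos_bounds:
  assumes "cov_pt n P u d" "v < n" "i < n"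
  shows "0 \<le> pos b u d v i" "pos b u d v i \<le> u"
  using cov_ptD[OF assms(1,2,3)] cov_ptD[OF assms(1,3,2)] by (auto simp: pos_def)

lemma pos_cov_pt:
  assumes c: "cov_pt n P u d" and v: "v < n"
  shows "cov_pt n P u (pivot_at u b d v)"
proof (rule pivot_cov_pt[OF c])
  show "0 \<le> pos b u d v i \<and> pos b u d v i \<le> u" if "i < n" for i
    using pos_bounds[OF c v that] by simp
  show "pos b u d v j \<le> pos b u d v i" if "i < n" "j < n" "P i j" for i j
    using cov_ptD(6,7)[OF c that(1,2) v that(3)] by (simp add: pos_def)
qed

lemma pivot_pos_self:
  assumes c: "cov_pt n P u d" and v: "v < n" "i < n" "i \<noteq> v"
  shows "pivot_at u b d v i v = pos b u d v i"
    "pivot_at u b d v v i = u - pos b u d v i"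
  using cov_ptD(1-4)[OF c v(1,2)] cov_ptD(1-4)[OF c v(2,1)] v(3)
  by (auto simp: pivot_def pos_def max_def min_def)

text \<open>After the pivot \<open>d i v\<close> is \<open>x i\<close> and \<open>d v j\<close> is
  \<open>u - x j\<close>, so for \<open>i\<close> and \<open>j\<close> other than \<open>v\<close>
  the triangle inequality through \<open>v\<close> is the upper end \<open>u + x i - x j\<close> of
  the clamp.\<close>

lemma settled_new:
  assumes c: "cov_pt n P u d" and v: "v < n"
  shows "settled n u (pivot_at u b d v) v"
  unfolding settled_def
proof (intro conjI allI impI)
  fix i assume i: "i < n"
  let ?d = "pivot u (pos b u d v) d"
  show "?d i v + ?d v i = u" if "i \<noteq> v"
    using pivot_pos_self[OF c v i that] by simp
  fix j assume j: "j < n"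
  have d0: "?d v v = 0"
    using cov_ptD(1)[OF pos_cov_pt[OF c v] v v] .
  consider "i = v" | "j = v" | "i \<noteq> v" "j \<noteq> v" by blast
  then show "?d i j \<le> ?d i v + ?d v j"
  proof cases
    case 3
    have "?d i j \<le> u + pos b u d v i - pos b u d v j"
      using pivot_bounds(4) pos_bounds[OF c v] i j by blast
    then show ?thesis using pivot_pos_self[OF c v i 3(1)] pivot_pos_self[OF c v j 3(2)] by simp
  qed (use d0 in auto)
qed

text \<open>The positions of any other pivot are Lipschitz at a settled \<open>v\<close>:
  \<open>x i - x v \<le> d i v\<close> and \<open>x v - x i \<le> d v i\<close>. Hence the entries
  at \<open>v\<close> already lie in their intervals, and an entry raised to
  \<open>x i - x j\<close> stays below \<open>d i v + d v j\<close>.\<close>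

lemma settled_kept:
  assumes c: "cov_pt n P u d" and v: "v < n" and s: "settled n u d v"
    and v': "v' < n"
  shows "settled n u (pivot_at u b d v') v"
proof -
  let ?x = "pos b u d v'" and ?d = "pivot u (pos b u d v') d"
  have tri: "d i j \<le> d i v + d v j" if "i < n" "j < n" for i j
    using s that unfolding settled_def by blast
  have eq: "d i v + d v i = u" if "i < n" "i \<noteq> v" for i
    using s that unfolding settled_def by blast
  \<comment> \<open>The triangle inequalities in which \<open>v\<close> is an end instead of the
    midpoint: replace \<open>d i v\<close> by \<open>u - d v i\<close>, bound \<open>u\<close> by
    \<open>d i j + d j i\<close>, and apply the inequality through \<open>v\<close> to
    \<open>d j i\<close>.\<close>
  have low: "d i v \<le> d i j + d j v" "d v j \<le> d v i + d i j" if "i < n" "j < n" for i j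
  proof -
    consider "i = j" | "i = v" | "j = v" | "i \<noteq> j" "i \<noteq> v" "j \<noteq> v" by blast
    then have "d i v \<le> d i j + d j v \<and> d v j \<le> d v i + d i j"
    proof cases
      case 4
      then show ?thesis
        using tri[OF that(2,1)] cov_ptD(4)[OF c that 4(1)] eq[OF that(1) 4(2)] eq[OF that(2) 4(3)] by argo
    qed (use that v cov_ptD(1,2)[OF c] in \<open>auto\<close>)
    then show "d i v \<le> d i j + d j v" "d v j \<le> d v i + d i j" by auto
  qed
  have lip: "?x i - ?x v \<le> d i v" "?x v - ?x i \<le> d v i" if "i < n" for i
    using tri[OF that v'] low[OF that v'] tri[OF v' that] low[OF v' that] by (auto simp: pos_def)
  have xb: "0 \<le> ?x i" "?x i \<le> u" if "i < n" for i
    using pos_bounds[OF c v' that] by auto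
  have keep: "?d i v = d i v" "?d v i = d v i" if "i < n" for i
  proof -
    have "?d i v = d i v \<and> ?d v i = d v i"
    proof (cases "i = v")
      case True
      then show ?thesis using cov_ptD(1)[OF c v v] cov_ptD(1)[OF pos_cov_pt[OF c v'] v v] by simp
    next
      case False
      then show ?thesis
        using eq[OF that False] lip[OF that] cov_ptD(2,3)[OF c that v] cov_ptD(2,3)[OF c v that]
        by (auto simp: pivot_def max_def min_def)
    qed
    then show "?d i v = d i v" "?d v i = d v i" by auto
  qed
  have "?d i j \<le> d i v + d v j" if ij: "i < n" "j < n" for i j
    using tri[OF ij] lip[OF ij(1)] lip[OF ij(2)] cov_ptD(2)[OF c ij(1) v] cov_ptD(2)[OF c v ij(2)]
    by (auto simp: pivot_def max_def min_def)
  then show ?thesis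
    using eq keep unfolding settled_def by simp
qed

section \<open>The cost of pivots in terms of violated metric triangle inequalities\<close>

definition gap :: "(nat \<Rightarrow> nat \<Rightarrow> real) \<Rightarrow> nat \<Rightarrow> nat \<Rightarrow> nat \<Rightarrow> real" where
  "gap d i j v = max 0 (d i v - d i j - d j v)"

text \<open>A raise is at most the violation \<open>gap d i j v\<close>. A drop is at least each of
  the two subtracted violations, by \<open>u \<le> d i j + d j i\<close> and
  \<open>u \<le> d j v + d v j\<close>; if both are positive it is at least their sum, by the cyclic
  inequality \<open>u \<le> d j i + d i v + d v j\<close>.\<close>

lemma pivot_change_in:
  assumes c: "cov_pt n P u d" and i: "i < n" and j: "j < n" and v: "v < n"
  shows "pivot_at u True d v i j - d i j \<le> gap d i j v - gap d j i v - gap d i v j"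
proof -
  consider "i = j" | "i \<noteq> j" "v = j" | "i \<noteq> j" "v = i" | "i \<noteq> j" "v \<noteq> i" "v \<noteq> j" by blast
  then show ?thesis
  proof cases
    case 4
    have "u \<le> d i j + d j i" "u \<le> d j v + d v j" "u \<le> d j i + d i v + d v j"
      "0 \<le> d i v" "0 \<le> d i j"  "d i v \<le> u" "0 \<le> d j v" "d j v \<le> u" "d i j \<le> u"
      using cov_ptD(4)[OF c i j 4(1)] cov_ptD(4)[OF c j v] cov_ptD(5)[OF c j i v] cov_ptD(2,3)[OF c] i j v 4
      by auto
    then show ?thesis
      unfolding pivot_def pos_def gap_def if_True max_def min_def by argo
  next
    case 1
    then show ?thesis using cov_ptD[OF c i i] cov_ptD[OF c i v] cov_ptD[OF c v i]
      by (auto simp: pivot_def pos_def gap_def max_def min_def)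
  next
    case 2
    then show ?thesis using cov_ptD(1-4)[OF c i j] cov_ptD(1-4)[OF c j i]
      by (auto simp: pivot_def pos_def gap_def max_def min_def)
  next
    case 3
    then show ?thesis using cov_ptD(1-4)[OF c i j] cov_ptD(1-4)[OF c j i]
      by (auto simp: pivot_def pos_def gap_def max_def min_def)
  qed
qed

text \<open>Mirror image of \<open>pivot_change_in\<close>: transposing \<open>d\<close> and
  reversing \<open>P\<close> exchanges the two kinds of pivots.\<close>

lemma pivot_change_out:
  assumes c: "cov_pt n P u d" and i: "i < n" and j: "j < n" and v: "v < n"
  shows "pivot_at u False d v i j - d i j \<le> gap d v i j - gap d v j i - gap d i v j"
proof -
  consider "i = j" | "i \<noteq> j" "v = j" | "i \<noteq> j" "v = i" | "i \<noteq> j" "v \<noteq> i" "v \<noteq> j" by blast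
  then show ?thesis
  proof cases
    case 4
    have "u \<le> d i j + d j i" "u \<le> d i v + d v i" "u \<le> d j i + d i v + d v j"
      "0 \<le> d v i" "0 \<le> d i j"  "d v i \<le> u" "0 \<le> d v j" "d v j \<le> u" "d i j \<le> u"
      using cov_ptD(4)[OF c i j 4(1)] cov_ptD(4)[OF c i v] cov_ptD(5)[OF c j i v] cov_ptD(2,3)[OF c] i j v 4
      by auto
    then show ?thesis
      unfolding pivot_def pos_def gap_def if_False max_def min_def by argo
  next
    case 1
    then show ?thesis using cov_ptD[OF c i i] cov_ptD[OF c i v] cov_ptD[OF c v i]
      by (auto simp: pivot_def pos_def gap_def max_def min_def)
  next
    case 2
    then show ?thesis using cov_ptD(1-4)[OF c i j] cov_ptD(1-4)[OF c j i]
      by (auto simp: pivot_def pos_def gap_def max_def min_def)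
  next
    case 3
    then show ?thesis using cov_ptD(1-4)[OF c i j] cov_ptD(1-4)[OF c j i]
      by (auto simp: pivot_def pos_def gap_def max_def min_def)
  qed
qed

definition hemi :: "nat \<Rightarrow> (nat \<Rightarrow> nat \<Rightarrow> real) \<Rightarrow> bool" where
  "hemi n w \<longleftrightarrow> (\<forall>i<n. \<forall>j<n. 0 \<le> w i j) \<and> (\<forall>i<n. \<forall>j<n. \<forall>k<n. w i k \<le> w i j + w j k)"

lemma sum3_rot: "(\<Sum>v<n. \<Sum>i<n. \<Sum>j<n. f v i j) = (\<Sum>v<n. \<Sum>i<n. \<Sum>j<(n::nat). f i j v :: real)"
proof -
  have "(\<Sum>v<n. \<Sum>i<n. \<Sum>j<n. f i j v) = (\<Sum>i<n. \<Sum>v<n. \<Sum>j<n. f i j v)"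
    by (rule sum.swap)
  also have "\<dots> = (\<Sum>i<n. \<Sum>j<n. \<Sum>v<n. f i j v)"
    by (rule sum.cong[OF refl]) (rule sum.swap)
  finally show ?thesis by simp
qed

lemma cost_sum_nonpos:
  assumes c: "cov_pt n P u d" and w: "hemi n w"
  shows "(\<Sum>v<n. (cost n w (pivot_at u True d v) - cost n w d)
             + (cost n w (pivot_at u False d v) - cost n w d)) \<le> 0"
proof -
  have nn: "0 \<le> w i j" and tri: "k < n \<Longrightarrow> w i k \<le> w i j + w j k" if "i < n" "j < n" for i j k
    using w that unfolding hemi_def by blast+
  let ?S = "\<lambda>f. \<Sum>v<n. \<Sum>i<n. \<Sum>j<n. (f v i j :: real)"
  have diff: "cost n w d' - cost n w d = (\<Sum>i<n. \<Sum>j<n. (d' i j - d i j) * w i j)" for d'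
    by (simp add: cost_def sum_subtractf algebra_simps)
  have "(\<Sum>v<n. (cost n w (pivot_at u True d v) - cost n w d)
             + (cost n w (pivot_at u False d v) - cost n w d))
    = ?S (\<lambda>v i j. (pivot_at u True d v i j - d i j + (pivot_at u False d v i j - d i j)) * w i j)"
    unfolding diff by (simp only: sum.distrib distrib_right)
  also have "\<dots> \<le> ?S (\<lambda>v i j. ((gap d i j v - gap d j i v - gap d i v j) + (gap d v i j - gap d v j i - gap d i v j)) * w i j)"
    using pivot_change_in[OF c] pivot_change_out[OF c] nn
    by (intro sum_mono mult_right_mono add_mono) auto
  also have "\<dots> = ?S (\<lambda>v i j. gap d i j v * w i j) - ?S (\<lambda>v i j. gap d j i v * w i j)
      + ?S (\<lambda>v i j. gap d v i j * w i j) - ?S (\<lambda>v i j. gap d v j i * w i j) - 2 * ?S (\<lambda>v i j. gap d i v j * w i j)"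
    by (simp add: sum.distrib sum_subtractf algebra_simps sum_distrib_left)
  \<comment> \<open>From here on the bound variables of each sum are renamed so that every violation
    reads \<open>gap d v i j\<close>; the renaming is absorbed by the arguments of
    \<open>w\<close>.\<close>
  also have "?S (\<lambda>v i j. gap d i j v * w i j) = ?S (\<lambda>v i j. gap d v i j * w v i)"
    using sum3_rot[of "\<lambda>v i j. gap d v i j * w v i" n] by simp
  also have "?S (\<lambda>v i j. gap d j i v * w i j) = ?S (\<lambda>v i j. gap d v i j * w i v)"
  proof -
    have "?S (\<lambda>v i j. gap d v i j * w i v) = ?S (\<lambda>v i j. gap d i j v * w j i)"
      using sum3_rot[of "\<lambda>v i j. gap d v i j * w i v" n] by simp
    also have "\<dots> = ?S (\<lambda>v i j. gap d j i v * w i j)"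
      by (rule sum.cong[OF refl]) (rule sum.swap)
    finally show ?thesis by simp
  qed
  also have "?S (\<lambda>v i j. gap d v j i * w i j) = ?S (\<lambda>v i j. gap d v i j * w j i)"
    by (rule sum.cong[OF refl]) (rule sum.swap)
  also have "?S (\<lambda>v i j. gap d i v j * w i j) = ?S (\<lambda>v i j. gap d v i j * w v j)"
    by (rule sum.swap)
  finally have "(\<Sum>v<n. (cost n w (pivot_at u True d v) - cost n w d)
             + (cost n w (pivot_at u False d v) - cost n w d))
     \<le> ?S (\<lambda>v i j. gap d v i j * w v i) - ?S (\<lambda>v i j. gap d v i j * w i v)
       + ?S (\<lambda>v i j. gap d v i j * w i j) - ?S (\<lambda>v i j. gap d v i j * w j i) - 2 * ?S (\<lambda>v i j. gap d v i j * w v j)" .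
  also have "\<dots> = ?S (\<lambda>v i j. gap d v i j * (w v i - w i v + w i j - w j i - 2 * w v j))"
    by (simp add: sum.distrib sum_subtractf algebra_simps sum_distrib_left)
  also have "\<dots> \<le> 0"
  proof (intro sum_nonpos mult_nonneg_nonpos)
    fix v i j assume "v \<in> {..<n}" "i \<in> {..<n}" "j \<in> {..<n}"
    \<comment> \<open>The sum of \<open>w v i \<le> w v j + w j i\<close> and
      \<open>w i j \<le> w i v + w v j\<close>: both detours use \<open>w v j\<close>, which
      accounts for the factor 2.\<close>
    then show "w v i - w i v + w i j - w j i - 2 * w v j \<le> 0"
      using tri[of v j i] tri[of i v j] by simp
  qed (simp add: gap_def)
  finally show ?thesis .
qed

text \<open>At a settled vertex \<open>d i v = u - d v i\<close>, so away from \<open>v\<close> both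
  kinds of positions coincide. The inequality through \<open>v\<close> is then the upper end of the
  interval for \<open>d i j\<close>, and the one for \<open>d j i\<close>, combined with
  \<open>u \<le> d i j + d j i\<close>, is the lower end.\<close>

lemma pivot_settled_id:
  assumes c: "cov_pt n P u d" and v: "v < n" and s: "settled n u d v" and ij: "i < n" "j < n"
  shows "pivot_at u b d v i j = d i j"
proof -
  have tri: "d i j \<le> d i v + d v j" and tri': "d j i \<le> d j v + d v i"
    using s ij unfolding settled_def by blast+
  have eq: "d i v + d v i = u" if "i < n" "i \<noteq> v" for i
    using s that unfolding settled_def by blast
  consider "i = j" | "i = v" "j \<noteq> v" | "j = v" "i \<noteq> v" | "i \<noteq> j" "i \<noteq> v" "j \<noteq> v" by blast
  then show ?thesis
  proof cases
    case 4
    show ?thesis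
      using tri tri' eq[OF ij(1) 4(2)] eq[OF ij(2) 4(3)] cov_ptD(2-4)[OF c ij] 4(1)
      by (auto simp: pivot_def pos_def max_def min_def)
  next
    case 1
    then show ?thesis using cov_ptD(1)[OF c ij] cov_ptD(1)[OF pos_cov_pt[OF c v] ij] by simp
  next
    case 2
    then show ?thesis using cov_ptD(1-3)[OF c v ij(2)] eq[OF ij(2)]
      by (auto simp: pivot_def pos_def max_def min_def)
  next
    case 3
    then show ?thesis using cov_ptD(1-3)[OF c v v] cov_ptD(1-3)[OF c ij(1) v] eq[OF ij(1)]
      by (auto simp: pivot_def pos_def max_def min_def)
  qed
qed

text \<open>The sum in \<open>cost_sum_nonpos\<close> ranges over all vertices, but those in
  \<open>S\<close> contribute 0 by \<open>pivot_settled_id\<close>. If every other pivot had a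
  positive cost change, the whole sum would be positive.\<close>

lemma good_pivot_exists:
  assumes c: "cov_pt n P u d" and w: "hemi n w"
    and S: "\<And>v. v < n \<Longrightarrow> v \<in> S \<Longrightarrow> settled n u d v" and ns: "\<exists>v<n. v \<notin> S"
  shows "\<exists>v<n. \<exists>b. v \<notin> S \<and> cost n w (pivot_at u b d v) \<le> cost n w d"
proof (rule ccontr)
  assume *: "\<not> ?thesis"
  let ?f = "\<lambda>v. (cost n w (pivot_at u True d v) - cost n w d)
             + (cost n w (pivot_at u False d v) - cost n w d)"
  obtain v0 where v0: "v0 < n" "v0 \<notin> S" using ns by blast
  have "0 < sum ?f {..<n}"
  proof (rule sum_pos2[of _ v0])
    have "0 < cost n w (pivot_at u b d v0) - cost n w d" for b
      using * v0 by (cases b) (auto simp: not_le)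
    then show "0 < ?f v0" by (intro add_pos_pos)
    show "v0 \<in> {..<n}" using v0 by simp
    fix v assume "v \<in> {..<n}"
    then have v: "v < n" by simp
    show "0 \<le> ?f v"
    proof (cases "v \<in> S")
      case True
      then show ?thesis using pivot_settled_id[OF c v S[OF v True]] by (simp add: cost_def)
    next
      case False
      then have "0 \<le> cost n w (pivot_at u b d v) - cost n w d" for b
        using * v by (metis diff_ge_0_iff_ge less_imp_le not_le)
      then show ?thesis by (intro add_nonneg_nonneg)
    qed
  qed simp
  then show False using cost_sum_nonpos[OF c w] by simp
qed

section \<open>Programs with bounded loops\<close>

text \<open>Time bound for a run all of whose loops make at most \<open>B\<close> iterations.\<close>

fun time :: "com \<Rightarrow> nat \<Rightarrow> nat" where
  "time (Seq c1 c2) B = time c1 B + time c2 B"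
| "time (Cond b c1 c2) B = Suc (time c1 B + time c2 B)"
| "time (While b c) B = Suc (B * Suc (time c B))"
| "time _ B = 1"

text \<open>\<open>time\<close> charges a conditional for both branches, since sums of polynomials
  are polynomials while maxima are not.\<close>

lemma time_poly: "\<exists>p :: nat poly. \<forall>B. time c B = poly p B"
proof (induction c)
  case (Seq c1 c2)
  then obtain p q where "\<forall>B. time c1 B = poly p B" "\<forall>B. time c2 B = poly q B" by blast
  then show ?case by (intro exI[of _ "p + q"]) simp
next
  case (Cond b c1 c2)
  then obtain p q where "\<forall>B. time c1 B = poly p B" "\<forall>B. time c2 B = poly q B" by blast
  then show ?case by (intro exI[of _ "1 + p + q"]) simp
next
  case (While b c)
  then obtain p where "\<forall>B. time c B = poly p B" by blast
  then show ?case by (intro exI[of _ "1 + [:0, 1:] * (1 + p)"]) simp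
qed (auto intro: exI[of _ 1])

fun nmods :: "com \<Rightarrow> nat set" where
  "nmods (NAssign a i j x) = {a}"
| "nmods (Seq c1 c2) = nmods c1 \<union> nmods c2"
| "nmods (Cond b c1 c2) = nmods c1 \<union> nmods c2"
| "nmods (While b c) = nmods c"
| "nmods _ = {}"

fun rmods :: "com \<Rightarrow> nat set" where
  "rmods (RAssign a i j x) = {a}"
| "rmods (Seq c1 c2) = rmods c1 \<union> rmods c2"
| "rmods (Cond b c1 c2) = rmods c1 \<union> rmods c2"
| "rmods (While b c) = rmods c"
| "rmods _ = {}"

text \<open>Every postcondition comes with this for free, so specifications mention only the arrays
  that a program assigns.\<close>

definition frame :: "com \<Rightarrow> memory \<Rightarrow> memory \<Rightarrow> bool" where
  "frame c s s' \<longleftrightarrow>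
     (\<forall>a. a \<notin> nmods c \<longrightarrow> fst s' a = fst s a) \<and> (\<forall>a. a \<notin> rmods c \<longrightarrow> snd s' a = snd s a)"

lemma exec_frame: "exec c s t s' \<Longrightarrow> frame c s s'"
  by (induction rule: exec.induct) (auto simp: frame_def store_def)

definition runs :: "nat \<Rightarrow> com \<Rightarrow> memory \<Rightarrow> (memory \<Rightarrow> bool) \<Rightarrow> bool" where
  "runs B c s Q \<longleftrightarrow> (\<exists>t s'. exec c s t s' \<and> t \<le> time c B \<and> Q s')"

lemma runs_conseq:
  assumes "runs B c s Q" "\<And>s'. frame c s s' \<Longrightarrow> Q s' \<Longrightarrow> Q' s'"
  shows "runs B c s Q'"
  using assms exec_frame unfolding runs_def by blast

lemma runs_Skip: "Q s \<Longrightarrow> runs B Skip s Q"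
  using exec.Skip[of s] unfolding runs_def by (intro exI[of _ 1] exI[of _ s]) simp

definition nput :: "nat \<Rightarrow> nat \<Rightarrow> nat \<Rightarrow> nat \<Rightarrow> memory \<Rightarrow> memory" where
  "nput a i j k s = (store (fst s) a i j k, snd s)"

definition rput :: "nat \<Rightarrow> nat \<Rightarrow> nat \<Rightarrow> real \<Rightarrow> memory \<Rightarrow> memory" where
  "rput a i j x s = (fst s, store (snd s) a i j x)"

lemma nput_simps [simp]:
  "fst (nput a i j k s) a i' j' = (if i' = i \<and> j' = j then k else fst s a i' j')"
  "a' \<noteq> a \<Longrightarrow> fst (nput a i j k s) a' = fst s a'"
  "snd (nput a i j k s) = snd s"
  by (auto simp: nput_def store_def)

lemma rput_simps [simp]:
  "snd (rput a i j x s) a i' j' = (if i' = i \<and> j' = j then x else snd s a i' j')"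
  "a' \<noteq> a \<Longrightarrow> snd (rput a i j x s) a' = snd s a'"
  "fst (rput a i j x s) = fst s"
  by (auto simp: rput_def store_def)

lemma runs_NAssign:
  assumes "Q (nput a (nval i s) (nval j s) (nval x s) s)"
  shows "runs B (NAssign a i j x) s Q"
  using assms exec.NAssign[of a i j x "fst s" "snd s"] unfolding runs_def nput_def by fastforce

lemma runs_RAssign:
  assumes "Q (rput a (nval i s) (nval j s) (rval x s) s)"
  shows "runs B (RAssign a i j x) s Q"
  using assms exec.RAssign[of a i j x "fst s" "snd s"] unfolding runs_def rput_def by fastforce

lemma runs_Seq:
  assumes "runs B c1 s R" "\<And>s'. frame c1 s s' \<Longrightarrow> R s' \<Longrightarrow> runs B c2 s' Q"
  shows "runs B (Seq c1 c2) s Q"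
  using assms exec_frame unfolding runs_def by (metis add_mono exec.Seq time.simps(1))

lemma runs_then:
  assumes "runs B c1 s (\<lambda>s'. runs B c2 s' Q)"
  shows "runs B (Seq c1 c2) s Q"
  using assms by (rule runs_Seq)

lemma runs_Cond:
  assumes "bval b s \<Longrightarrow> runs B c1 s Q" "\<not> bval b s \<Longrightarrow> runs B c2 s Q"
  shows "runs B (Cond b c1 c2) s Q"
proof (cases "bval b s")
  case True
  with assms(1) obtain t s' where "exec c1 s t s'" "t \<le> time c1 B" "Q s'"
    unfolding runs_def by blast
  then show ?thesis
    using exec.CondTrue[OF True] unfolding runs_def by (intro exI[of _ "Suc t"] exI[of _ s']) auto
next
  case False
  with assms(2) obtain t s' where "exec c2 s t s'" "t \<le> time c2 B" "Q s'"
    unfolding runs_def by blast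
  then show ?thesis
    using exec.CondFalse[OF False] unfolding runs_def by (intro exI[of _ "Suc t"] exI[of _ s']) auto
qed

abbreviation NVar :: "nat \<Rightarrow> nexp" where
  "NVar v \<equiv> NCell v (NConst 0) (NConst 0)"

abbreviation RVar :: "nat \<Rightarrow> rexp" where
  "RVar v \<equiv> RCell v (NConst 0) (NConst 0)"

abbreviation NSet :: "nat \<Rightarrow> nexp \<Rightarrow> com" where
  "NSet v \<equiv> NAssign v (NConst 0) (NConst 0)"

abbreviation RSet :: "nat \<Rightarrow> rexp \<Rightarrow> com" where
  "RSet v \<equiv> RAssign v (NConst 0) (NConst 0)"

definition For :: "nat \<Rightarrow> nat \<Rightarrow> com \<Rightarrow> com" where
  "For v b c = Seq (NSet v (NConst 0))
     (While (NLess (NVar v) (NVar b)) (Seq c (NSet v (NAdd (NVar v) (NConst 1)))))"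

lemma mods_For [simp]: "nmods (For v b c) = insert v (nmods c)" "rmods (For v b c) = rmods c"
  by (auto simp: For_def)

abbreviation nset :: "nat \<Rightarrow> nat \<Rightarrow> memory \<Rightarrow> memory" where
  "nset v \<equiv> nput v 0 0"

abbreviation rset :: "nat \<Rightarrow> real \<Rightarrow> memory \<Rightarrow> memory" where
  "rset v \<equiv> rput v 0 0"

text \<open>Besides the body, an iteration costs one unit for the test and one for the increment of
  the counter, hence the two \<open>Suc\<close>.\<close>

lemma runs_loop:
  assumes step: "\<And>k s'. k < n \<Longrightarrow> frame (For v b c) s s' \<Longrightarrow> fst s' v 0 0 = k \<Longrightarrow> I k s' \<Longrightarrow>
       runs B c s' (\<lambda>s''. I (Suc k) (nset v (Suc k) s''))"
    and vb: "v \<notin> nmods c" "b \<notin> nmods c" "b \<noteq> v" and n: "fst s b 0 0 = n"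
    and s1: "frame (For v b c) s s1" "fst s1 v 0 0 = k" "I k s1" and k: "k \<le> n"
  shows "\<exists>t s'. exec (While (NLess (NVar v) (NVar b)) (Seq c (NSet v (NAdd (NVar v) (NConst 1))))) s1 t s'
     \<and> t \<le> Suc ((n - k) * Suc (Suc (time c B))) \<and> I n s'"
  using s1 k
proof (induction "n - k" arbitrary: k s1)
  case 0
  then have "\<not> bval (NLess (NVar v) (NVar b)) s1"
    using vb n by (auto simp: frame_def)
  from exec.WhileFalse[OF this] 0 show ?case
    by (intro exI[of _ 1] exI[of _ s1]) auto
next
  case (Suc m)
  have b: "fst s1 b 0 0 = n"
    using Suc.prems(1) vb n by (auto simp: frame_def)
  have less: "bval (NLess (NVar v) (NVar b)) s1"
    using b Suc by auto
  obtain t1 s2 where e1: "exec c s1 t1 s2" and t1: "t1 \<le> time c B" and I2: "I (Suc k) (nset v (Suc k) s2)"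
  proof -
    have "k < n" using Suc.hyps(2) by simp
    from step[OF this Suc.prems(1-3)] show ?thesis
      using that unfolding runs_def by blast
  qed
  have f: "frame c s1 s2" using exec_frame[OF e1] .
  then have v2: "fst s2 v 0 0 = k" using vb Suc.prems(2) by (auto simp: frame_def)
  have e2: "exec (NSet v (NAdd (NVar v) (NConst 1))) s2 1 (nset v (Suc k) s2)"
    using exec.NAssign[of v "NConst 0" "NConst 0" "NAdd (NVar v) (NConst 1)" "fst s2" "snd s2"] v2
    by (simp add: nput_def)
  have f3: "frame (For v b c) s (nset v (Suc k) s2)"
    using Suc.prems(1) f by (auto simp: frame_def)
  obtain t3 s3 where e3: "exec (While (NLess (NVar v) (NVar b)) (Seq c (NSet v (NAdd (NVar v) (NConst 1)))))
       (nset v (Suc k) s2) t3 s3" and t3: "t3 \<le> Suc ((n - Suc k) * Suc (Suc (time c B)))" and I3: "I n s3"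
  proof -
    have "m = n - Suc k" "Suc k \<le> n" using Suc.hyps(2) by simp_all
    from Suc.hyps(1)[OF this(1) f3 _ I2 this(2)] show ?thesis
      using that by force
  qed
  have "n - k = Suc (n - Suc k)" using Suc.hyps(2) by simp
  then have "Suc ((t1 + 1) + t3) \<le> Suc ((n - k) * Suc (Suc (time c B)))"
    using t1 t3 by simp
  with exec.WhileTrue[OF less exec.Seq[OF e1 e2] e3] I3 show ?case
    by (intro exI[of _ "Suc ((t1 + 1) + t3)"] exI[of _ s3] conjI)
qed

lemma runs_For:
  assumes step: "\<And>k s'. k < n \<Longrightarrow> frame (For v b c) s s' \<Longrightarrow> fst s' v 0 0 = k \<Longrightarrow> I k s' \<Longrightarrow>
       runs B c s' (\<lambda>s''. I (Suc k) (nset v (Suc k) s''))"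
    and n: "fst s b 0 0 = n" "n \<le> B" and init: "I 0 (nset v 0 s)"
    and vb: "v \<notin> nmods c" "b \<notin> nmods c" "b \<noteq> v"
  shows "runs B (For v b c) s (I n)"
proof -
  have e1: "exec (NSet v (NConst 0)) s 1 (nset v 0 s)"
    using exec.NAssign[of v "NConst 0" "NConst 0" "NConst 0" "fst s" "snd s"] by (simp add: nput_def)
  have f: "frame (For v b c) s (nset v 0 s)"
    by (auto simp: frame_def)
  obtain t s' where e2: "exec (While (NLess (NVar v) (NVar b)) (Seq c (NSet v (NAdd (NVar v) (NConst 1)))))
       (nset v 0 s) t s'" and t: "t \<le> Suc ((n - 0) * Suc (Suc (time c B)))" and I: "I n s'"
    using runs_loop[OF step vb n(1) f _ init le0] by (force simp: nput_def store_def)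
  have "(n - 0) * Suc (Suc (time c B)) \<le> B * Suc (Suc (time c B))"
    using n(2) by (intro mult_right_mono) simp_all
  with t have "t \<le> Suc (B * Suc (Suc (time c B)))"
    by (meson Suc_le_mono order_trans)
  then have "1 + t \<le> time (For v b c) B"
    by (simp add: For_def del: mult_Suc_right)
  with exec.Seq[OF e1 e2] I show ?thesis
    unfolding runs_def For_def[symmetric] by (intro exI[of _ "1 + t"] exI[of _ s'] conjI)
qed

lemma frame_nat: "frame c s s' \<Longrightarrow> a \<notin> nmods c \<Longrightarrow> fst s' a = fst s a"
  by (simp add: frame_def)

lemma frame_real: "frame c s s' \<Longrightarrow> a \<notin> rmods c \<Longrightarrow> snd s' a = snd s a"
  by (simp add: frame_def)

text \<open>The invariant speaks about the set of indices already processed and, by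
  \<open>inv\<close>, does not depend on the loop counter.\<close>

lemma runs_For_set:
  assumes step: "\<And>k s'. k < n \<Longrightarrow> frame (For v b c) s s' \<Longrightarrow> fst s' v 0 0 = k \<Longrightarrow> J {..<k} s' \<Longrightarrow>
       runs B c s' (J (insert k {..<k}))"
    and n: "fst s b 0 0 = n" "n \<le> B" and init: "J {} s"
    and inv: "\<And>Z k s. J Z s \<Longrightarrow> J Z (nset v k s)"
    and vb: "v \<notin> nmods c" "b \<notin> nmods c" "b \<noteq> v"
  shows "runs B (For v b c) s (J {..<n})"
proof (rule runs_For[where I = "\<lambda>k. J {..<k}", OF _ n _ vb])
  show "J {..<0} (nset v 0 s)" using inv init by simp
  show "runs B c s' (\<lambda>s''. J {..<Suc k} (nset v (Suc k) s''))"
    if "k < n" "frame (For v b c) s s'" "fst s' v 0 0 = k" "J {..<k} s'" for k s'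
    by (rule runs_conseq[OF step[OF that]]) (simp add: inv lessThan_Suc)
qed

text \<open>The set \<open>Z\<close> of processed pairs is given explicitly as a prefix of the
  row-major order, so that a body may rely on its finiteness and on the value of
  \<open>card Z\<close>.\<close>

lemma runs_For2:
  assumes step: "\<And>Z i j s'. i < n1 \<Longrightarrow> j < n2 \<Longrightarrow> (i, j) \<notin> Z \<Longrightarrow> frame (For v1 b1 (For v2 b2 c)) s s' \<Longrightarrow>
       fst s' v1 0 0 = i \<Longrightarrow> fst s' v2 0 0 = j \<Longrightarrow> Z = {..<i} \<times> {..<n2} \<union> {i} \<times> {..<j} \<Longrightarrow> J Z s' \<Longrightarrow> runs B c s' (J (insert (i, j) Z))"
    and n: "fst s b1 0 0 = n1" "n1 \<le> B" "fst s b2 0 0 = n2" "n2 \<le> B" and init: "J {} s"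
    and inv: "\<And>Z k s. J Z s \<Longrightarrow> J Z (nset v1 k s)" "\<And>Z k s. J Z s \<Longrightarrow> J Z (nset v2 k s)"
    and vb: "v1 \<notin> nmods c" "v2 \<notin> nmods c" "b1 \<notin> nmods c" "b2 \<notin> nmods c"
      "v1 \<noteq> v2" "b1 \<noteq> v1" "b1 \<noteq> v2" "b2 \<noteq> v1" "b2 \<noteq> v2"
  shows "runs B (For v1 b1 (For v2 b2 c)) s (J ({..<n1} \<times> {..<n2}))"
proof (rule runs_For_set[where J = "\<lambda>X. J (X \<times> {..<n2})", OF _ n(1,2) _ inv(1)])
  fix i s1
  assume i: "i < n1" "frame (For v1 b1 (For v2 b2 c)) s s1" "fst s1 v1 0 0 = i" and J: "J ({..<i} \<times> {..<n2}) s1"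
  have "runs B (For v2 b2 c) s1 (J ({..<i} \<times> {..<n2} \<union> {i} \<times> {..<n2}))"
  proof (rule runs_For_set[where J = "\<lambda>Y. J ({..<i} \<times> {..<n2} \<union> {i} \<times> Y)", OF _ _ n(4) _ inv(2)])
    show "fst s1 b2 0 0 = n2" using i(2) n(3) vb by (simp add: frame_nat)
    show "J ({..<i} \<times> {..<n2} \<union> {i} \<times> {}) s1" using J by simp
    fix j s2
    assume j: "j < n2" "frame (For v2 b2 c) s1 s2" "fst s2 v2 0 0 = j"
      and J: "J ({..<i} \<times> {..<n2} \<union> {i} \<times> {..<j}) s2"
    have "runs B c s2 (J (insert (i, j) ({..<i} \<times> {..<n2} \<union> {i} \<times> {..<j})))"
    proof (rule step[OF i(1) j(1) _ _ _ j(3) refl J])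
      show "frame (For v1 b1 (For v2 b2 c)) s s2"
        using i(2) j(2) by (simp add: frame_def)
      show "fst s2 v1 0 0 = i"
        using i(3) j(2) vb by (simp add: frame_nat)
    qed simp
    moreover have "insert (i, j) ({..<i} \<times> {..<n2} \<union> {i} \<times> {..<j}) = {..<i} \<times> {..<n2} \<union> {i} \<times> insert j {..<j}"
      by auto
    ultimately show "runs B c s2 (J ({..<i} \<times> {..<n2} \<union> {i} \<times> insert j {..<j}))" by (simp only:)
  qed (use vb in simp_all)
  moreover have "{..<i} \<times> {..<n2} \<union> {i} \<times> {..<n2} = insert i {..<i} \<times> {..<n2}" by auto
  ultimately show "runs B (For v2 b2 c) s1 (J (insert i {..<i} \<times> {..<n2}))" by (simp only:)
qed (use init vb in simp_all)

definition NEq :: "nexp \<Rightarrow> nexp \<Rightarrow> bexp" where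
  "NEq x y = BAnd (BNot (NLess x y)) (BNot (NLess y x))"

lemma bval_NEq [simp]: "bval (NEq x y) s \<longleftrightarrow> nval x s = nval y s"
  by (auto simp: NEq_def)


definition upd2 :: "(nat \<Rightarrow> nat \<Rightarrow> 'v) \<Rightarrow> nat \<Rightarrow> nat \<Rightarrow> 'v \<Rightarrow> nat \<Rightarrow> nat \<Rightarrow> 'v" where
  "upd2 m i j x = m(i := (m i)(j := x))"

lemma upd2_simps [simp]:
  "upd2 m i j x i' j' = (if i' = i \<and> j' = j then x else m i' j')" "upd2 (upd2 m i j x) i j y = upd2 m i j y"
  by (auto simp: upd2_def)

lemma put_upd2:
  "fst (nput a i j k s) a = upd2 (fst s a) i j k" "snd (rput a i j x s) a = upd2 (snd s a) i j x"
  by (simp_all add: nput_def rput_def store_def upd2_def)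

text \<open>
  Arrays of the programs below. Naturals: \<open>0\<close> number \<open>n\<close> of vertices, \<open>1\<close> order, \<open>3\<close> index of a pair,
  \<open>4\<close> coordinates of the constraint rows (in rows \<open>0, 2, 3, 4\<close>), \<open>5\<close> powers of two, \<open>6\<close> current solution,
  \<open>7\<close> candidate, \<open>8\<close> flags of the settled vertices; scalars \<open>14\<close> \<open>n * n\<close>, \<open>15\<close> its successor, \<open>16\<close> number
  of rows, \<open>17\<close> number of powers, \<open>18\<close> and \<open>20\<close> result of a conversion, \<open>22\<close> unit, \<open>23\<close> coordinate
  being eliminated, \<open>25\<close> and \<open>26\<close> result of the ratio test; the other scalars are loop counters and
  temporaries. Reals: \<open>0\<close> weights, \<open>1\<close> input and output, \<open>2\<close> order closure, \<open>3\<close> flattened solution,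
  \<open>4\<close> right-hand sides, \<open>5\<close> directions, \<open>6\<close> flattened weights, from \<open>10\<close> on scalars.
\<close>

section \<open>Order closure\<close>

text \<open>
  The value at \<open>(i, j)\<close> of the order closure is the least value of \<open>\<delta>\<close> at a pair \<open>(i', j')\<close> whose
  constraints imply those of \<open>(i, j)\<close>, capped at \<open>1\<close>.
\<close>

definition dominating :: "(nat \<Rightarrow> nat \<Rightarrow> bool) \<Rightarrow> nat \<Rightarrow> nat \<Rightarrow> (nat \<times> nat) set" where
  "dominating P i j = {(i', j'). P i' i \<and> P j j' \<and> i' \<noteq> j'}"

text \<open>The relaxation of [COV] bounds the free entries only from below, whereas
  \<open>cov_pt\<close> asks for entries of at most the unit; hence the cap. As a predicate on a
  growing set \<open>S\<close> it also serves as the invariant of the minimum search.\<close>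

definition least_of :: "(nat \<times> nat) set \<Rightarrow> (nat \<Rightarrow> nat \<Rightarrow> real) \<Rightarrow> real \<Rightarrow> bool" where
  "least_of S d x \<longleftrightarrow> x \<le> 1 \<and> (\<forall>i j. (i, j) \<in> S \<longrightarrow> x \<le> d i j) \<and>
     (x = 1 \<or> (\<exists>i j. (i, j) \<in> S \<and> x = d i j))"

lemma least_of_insert:
  assumes "least_of S d x"
  shows "d a b < x \<Longrightarrow> least_of (insert (a, b) S) d (d a b)"
    "x \<le> d a b \<Longrightarrow> least_of (insert (a, b) S) d x"
proof -
  have 1: "x \<le> 1" and 2: "\<And>i j. (i, j) \<in> S \<Longrightarrow> x \<le> d i j"
    and 3: "x = 1 \<or> (\<exists>i j. (i, j) \<in> S \<and> x = d i j)"
    using assms by (simp_all add: least_of_def)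
  show "least_of (insert (a, b) S) d (d a b)" if "d a b < x"
    unfolding least_of_def
  proof (intro conjI allI impI)
    show "d a b \<le> d i j" if "(i, j) \<in> insert (a, b) S" for i j
      using that \<open>d a b < x\<close> 2[of i j] by auto
    show "d a b = 1 \<or> (\<exists>i j. (i, j) \<in> insert (a, b) S \<and> d a b = d i j)" by blast
  qed (use 1 that in simp)
  show "least_of (insert (a, b) S) d x" if "x \<le> d a b"
    unfolding least_of_def
  proof (intro conjI allI impI)
    show "x \<le> d i j" if "(i, j) \<in> insert (a, b) S" for i j
      using that \<open>x \<le> d a b\<close> 2[of i j] by auto
    show "x = 1 \<or> (\<exists>i j. (i, j) \<in> insert (a, b) S \<and> x = d i j)" using 3 by blast
  qed (rule 1)
qed

definition is_closure :: "nat \<Rightarrow> (nat \<Rightarrow> nat \<Rightarrow> bool) \<Rightarrow> (nat \<Rightarrow> nat \<Rightarrow> real) \<Rightarrow> nat \<Rightarrow> nat \<Rightarrow> real \<Rightarrow> bool" where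
  "is_closure n P d i j x \<longleftrightarrow>
     (if i = j then x = 0
      else least_of ({..<n} \<times> {..<n} \<inter> dominating P i j) d x)"

definition close_cell :: com where
  "close_cell =
     Seq (RAssign 2 (NVar 10) (NVar 11) (RNat (NConst 1)))
    (Seq (For 12 0 (For 13 0
           (Cond (BAnd (BAnd (NLess (NConst 0) (NCell 1 (NVar 12) (NVar 10)))
                             (NLess (NConst 0) (NCell 1 (NVar 11) (NVar 13))))
                       (BAnd (BNot (NEq (NVar 12) (NVar 13)))
                             (RLess (RCell 1 (NVar 12) (NVar 13)) (RCell 2 (NVar 10) (NVar 11)))))
              (RAssign 2 (NVar 10) (NVar 11) (RCell 1 (NVar 12) (NVar 13)))
              Skip)))
         (Cond (NEq (NVar 10) (NVar 11)) (RAssign 2 (NVar 10) (NVar 11) (RNat (NConst 0))) Skip))"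

definition close :: com where
  "close = For 10 0 (For 11 0 close_cell)"

lemma mods_close_cell [simp]: "nmods close_cell = {12, 13}" "rmods close_cell = {2}"
  by (auto simp: close_cell_def)

lemma mods_close [simp]: "nmods close = {10, 11, 12, 13}" "rmods close = {2}"
  by (auto simp: close_def)

lemma runs_close_cell:
  assumes i: "fst s 10 0 0 = i" and j: "fst s 11 0 0 = j" and n: "fst s 0 0 0 = n" "n \<le> B"
  shows "runs B close_cell s (\<lambda>s'. \<exists>x. snd s' 2 = upd2 (snd s 2) i j x \<and>
           is_closure n (\<lambda>i j. 0 < fst s 1 i j) (snd s 1) i j x)"
proof -
  let ?Q = "\<lambda>s'. \<exists>x. snd s' 2 = upd2 (snd s 2) i j x \<and>
           is_closure n (\<lambda>i j. 0 < fst s 1 i j) (snd s 1) i j x"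
  let ?D = "dominating (\<lambda>i j. 0 < fst s 1 i j) i j"
  let ?J = "\<lambda>Z s'. \<exists>x. snd s' 2 = upd2 (snd s 2) i j x \<and>
     least_of (Z \<inter> ?D) (snd s 1) x"
  let ?b = "BAnd (BAnd (NLess (NConst 0) (NCell 1 (NVar 12) (NVar 10)))
                             (NLess (NConst 0) (NCell 1 (NVar 11) (NVar 13))))
                       (BAnd (BNot (NEq (NVar 12) (NVar 13)))
                             (RLess (RCell 1 (NVar 12) (NVar 13)) (RCell 2 (NVar 10) (NVar 11))))"
  let ?c = "For 12 0 (For 13 0
           (Cond ?b
              (RAssign 2 (NVar 10) (NVar 11) (RCell 1 (NVar 12) (NVar 13)))
              Skip))"
  let ?e = "Cond (NEq (NVar 10) (NVar 11)) (RAssign 2 (NVar 10) (NVar 11) (RNat (NConst 0))) Skip"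
  let ?s = "rput 2 i j 1 s"
  have loop: "runs B ?c ?s (?J ({..<n} \<times> {..<n}))"
  proof (rule runs_For2[where J = ?J and ?n1.0 = n and ?n2.0 = n], goal_cases)
    case (1 Z a b s')
    have fr: "fst s' 10 0 0 = i" "fst s' 11 0 0 = j" "fst s' 1 = fst s 1" "snd s' 1 = snd s 1"
      using 1(4) i j by (simp_all add: frame_def)
    obtain x where x: "snd s' 2 = upd2 (snd s 2) i j x"
      and m: "least_of (Z \<inter> ?D) (snd s 1) x" using 1(8) by blast
    have D: "(a, b) \<in> ?D \<longleftrightarrow> 0 < fst s 1 a i \<and> 0 < fst s 1 j b \<and> a \<noteq> b"
      by (auto simp: dominating_def)
    show ?case
    proof (rule runs_Cond)
      assume *: "bval ?b s'"
      then have "(a, b) \<in> ?D" "snd s 1 a b < x" using fr 1(5,6) x D by auto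
      then have "least_of (insert (a, b) Z \<inter> ?D) (snd s 1) (snd s 1 a b)"
        using least_of_insert(1)[OF m] by (simp add: Int_insert_left)
      then show "runs B (RAssign 2 (NVar 10) (NVar 11) (RCell 1 (NVar 12) (NVar 13))) s' (?J (insert (a, b) Z))"
        using fr 1(5,6) x by (intro runs_RAssign) (auto simp: put_upd2)
    next
      assume *: "\<not> bval ?b s'"
      then have "(a, b) \<in> ?D \<Longrightarrow> x \<le> snd s 1 a b" using fr 1(5,6) x D by auto
      then have "least_of (insert (a, b) Z \<inter> ?D) (snd s 1) x"
        using least_of_insert(2)[OF m] m by (simp add: Int_insert_left)
      then show "runs B Skip s' (?J (insert (a, b) Z))"
        using x by (intro runs_Skip) auto
    qed
  next
    case 6
    show ?case by (intro exI[of _ 1] conjI) (simp_all add: put_upd2 least_of_def)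
  qed (use n in simp_all)
  have "runs B ?e s'
      ?Q"
    if f: "frame ?c ?s s'" and J: "?J ({..<n} \<times> {..<n}) s'" for s'
  proof -
    have fr: "fst s' 10 0 0 = i" "fst s' 11 0 0 = j"
      using i j f by (simp_all add: frame_def)
    obtain x where "snd s' 2 = upd2 (snd s 2) i j x" "least_of ({..<n} \<times> {..<n} \<inter> ?D) (snd s 1) x"
      using J by blast
    then have x: "snd s' 2 = upd2 (snd s 2) i j x"
      and c: "is_closure n (\<lambda>i j. 0 < fst s 1 i j) (snd s 1) i j (if i = j then 0 else x)"
      by (simp_all add: is_closure_def)
    show ?thesis
      by (intro runs_Cond runs_RAssign runs_Skip exI[of _ "if i = j then 0 else x"] conjI c)
        (simp_all add: fr x put_upd2)
  qed
  then have "runs B (Seq ?c ?e) ?s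
      ?Q"
    by (rule runs_Seq[OF loop])
  then show ?thesis
    unfolding close_cell_def using i j by (intro runs_then[OF runs_RAssign]) simp
qed

lemma runs_close:
  assumes n: "fst s 0 0 0 = n" "n \<le> B"
  shows "runs B close s (\<lambda>s'. \<forall>i<n. \<forall>j<n.
           is_closure n (\<lambda>i j. 0 < fst s 1 i j) (snd s 1) i j (snd s' 2 i j))"
proof -
  let ?C = "is_closure n (\<lambda>i j. 0 < fst s 1 i j) (snd s 1)"
  let ?J = "\<lambda>Z s'. \<forall>i j. (i, j) \<in> Z \<longrightarrow> ?C i j (snd s' 2 i j)"
  have "runs B close s (?J ({..<n} \<times> {..<n}))"
    unfolding close_def
  proof (rule runs_For2[where J = ?J and ?n1.0 = n and ?n2.0 = n], goal_cases)
    case (1 Z i j s')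
    have fr: "fst s' 0 0 0 = n" "fst s' 1 = fst s 1" "snd s' 1 = snd s 1"
      using 1(4) n by (simp_all add: frame_def)
    have "?J (insert (i, j) Z) s''"
      if "\<exists>x. snd s'' 2 = upd2 (snd s' 2) i j x \<and> is_closure n (\<lambda>i j. 0 < fst s' 1 i j) (snd s' 1) i j x" for s''
      using that 1(8) unfolding fr by auto
    then show ?case by (rule runs_conseq[OF runs_close_cell[OF 1(5,6) fr(1) n(2)]])
  qed (use n in simp_all)
  then show ?thesis by (rule runs_conseq) simp
qed

text \<open>An entry other than 1 is the value of \<open>d\<close> at a dominating pair. Take such
  pairs for all entries of a cycle: transitivity through the shared vertices gives exactly the
  premises of C2 or C3. If some entry of the cycle is 1, nonnegativity of the others
  suffices.\<close>

lemma closure_cov_pt: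
  assumes y: "\<And>i j. i < n \<Longrightarrow> j < n \<Longrightarrow> is_closure n P d i j (y i j)"
    and refl: "\<And>i. i < n \<Longrightarrow> P i i"
    and trans: "\<And>i j k. i < n \<Longrightarrow> j < n \<Longrightarrow> k < n \<Longrightarrow> P i j \<Longrightarrow> P j k \<Longrightarrow> P i k"
    and nn: "\<And>i j. i < n \<Longrightarrow> j < n \<Longrightarrow> i \<noteq> j \<Longrightarrow> 0 \<le> d i j"
    and fix0: "\<And>i j. i < n \<Longrightarrow> j < n \<Longrightarrow> i \<noteq> j \<Longrightarrow> P i j \<Longrightarrow> d j i = 0"
    and C2: "\<And>x1 y1 x2 y2. x1 < n \<Longrightarrow> y1 < n \<Longrightarrow> x2 < n \<Longrightarrow> y2 < n \<Longrightarrow> x1 \<noteq> y1 \<Longrightarrow> x2 \<noteq> y2 \<Longrightarrow>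
       P x2 y1 \<Longrightarrow> P x1 y2 \<Longrightarrow> 1 \<le> d x1 y1 + d x2 y2"
    and C3: "\<And>x1 y1 x2 y2 x3 y3. x1 < n \<Longrightarrow> y1 < n \<Longrightarrow> x2 < n \<Longrightarrow> y2 < n \<Longrightarrow> x3 < n \<Longrightarrow> y3 < n \<Longrightarrow>
       x1 \<noteq> y1 \<Longrightarrow> x2 \<noteq> y2 \<Longrightarrow> x3 \<noteq> y3 \<Longrightarrow> P x2 y1 \<Longrightarrow> P x3 y2 \<Longrightarrow> P x1 y3 \<Longrightarrow>
       1 \<le> d x1 y1 + d x2 y2 + d x3 y3"
  shows "cov_pt n P 1 y" "\<And>i j. i < n \<Longrightarrow> j < n \<Longrightarrow> i \<noteq> j \<Longrightarrow> y i j \<le> d i j"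
proof -
  have diag: "y i i = 0" if "i < n" for i
    using y[OF that that] by (simp add: is_closure_def)
  have le1: "y i j \<le> 1" if "i < n" "j < n" for i j
    using y[OF that] by (auto simp: is_closure_def least_of_def split: if_splits)
  have le: "y i j \<le> d i' j'"
    if "i < n" "j < n" "i \<noteq> j" "i' < n" "j' < n" "P i' i" "P j j'" "i' \<noteq> j'" for i j i' j'
    using y[OF that(1,2)] that by (auto simp: is_closure_def least_of_def dominating_def)
  have attained: "y i j = 1 \<or> (\<exists>i'<n. \<exists>j'<n. P i' i \<and> P j j' \<and> i' \<noteq> j' \<and> y i j = d i' j')"
    if "i < n" "j < n" "i \<noteq> j" for i j
    using y[OF that(1,2)] that(3) by (auto simp: is_closure_def least_of_def dominating_def)
  show "y i j \<le> d i j" if "i < n" "j < n" "i \<noteq> j" for i j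
    using le[OF that that(1,2) refl[OF that(1)] refl[OF that(2)] that(3)] .
  have ge0: "0 \<le> y i j" if "i < n" "j < n" for i j
  proof (cases "i = j")
    case False
    then show ?thesis using attained[OF that False] nn by (metis zero_le_one)
  qed (use diag that in simp)
  have fixy: "y j i = 0" if "i < n" "j < n" "i \<noteq> j" "P i j" for i j
    using le[OF that(2,1) that(3)[symmetric] that(2,1) refl[OF that(2)] refl[OF that(1)] that(3)[symmetric]]
      fix0[OF that] ge0[OF that(2,1)] by simp
  have mono: "y j k \<le> y i k" "y k i \<le> y k j" if ijk: "i < n" "j < n" "k < n" "P i j" for i j k
  proof -
    \<comment> \<open>A pair dominating \<open>(i, k)\<close> also dominates \<open>(j, k)\<close>
      by transitivity, so the minimum at \<open>(j, k)\<close> is taken over a larger set;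
      \<open>step2\<close> is the same in the second coordinate.\<close>
    have step1: "y j k \<le> y i k" if k: "k \<noteq> i" "k \<noteq> j"
    proof (cases "y i k = 1")
      case False
      then obtain a b where 1: "a < n" "b < n" "P a i" "P k b" "a \<noteq> b" "y i k = d a b"
        using attained[OF ijk(1,3) k(1)[symmetric]] by blast
      then show ?thesis
        using le[OF ijk(2,3) k(2)[symmetric] 1(1,2) trans[OF 1(1) ijk(1,2) 1(3) ijk(4)] 1(4,5)] by simp
    qed (use le1 ijk in simp)
    have step2: "y k i \<le> y k j" if k: "k \<noteq> i" "k \<noteq> j"
    proof (cases "y k j = 1")
      case False
      then obtain a b where 1: "a < n" "b < n" "P a k" "P j b" "a \<noteq> b" "y k j = d a b"
        using attained[OF ijk(3,2) k(2)] by blast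
      then show ?thesis
        using le[OF ijk(3,1) k(1) 1(1,2,3) trans[OF ijk(1,2) 1(2) ijk(4) 1(4)] 1(5)] by simp
    qed (use le1 ijk in simp)
    \<comment> \<open>Here one side of the inequality is a diagonal entry, so the other one must
      vanish: it is an entry against the order, which the convention fixes to 0.\<close>
    have "k = i \<Longrightarrow> j \<noteq> i \<Longrightarrow> y j k = 0" "k = j \<Longrightarrow> j \<noteq> i \<Longrightarrow> y k i = 0"
      using fixy[OF ijk(1,2) _ ijk(4)] by auto
    then show "y j k \<le> y i k" "y k i \<le> y k j"
      using step1 step2 diag[OF ijk(1)] diag[OF ijk(2)] ge0 ijk
      by (cases "j = i"; cases "k = i"; cases "k = j"; simp)+
  qed
  have pair: "1 \<le> y i j + y j i" if ij: "i < n" "j < n" "i \<noteq> j" for i j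
  proof -
    show ?thesis
    proof (cases "y i j = 1 \<or> y j i = 1")
      case False
      obtain a b where 1: "a < n" "b < n" "P a i" "P j b" "a \<noteq> b" "y i j = d a b"
        using attained[OF ij] False by blast
      obtain a' b' where 2: "a' < n" "b' < n" "P a' j" "P i b'" "a' \<noteq> b'" "y j i = d a' b'"
        using attained[OF ij(2,1) ij(3)[symmetric]] False by blast
      have "P a' b" "P a b'"
        using trans[OF 2(1) ij(2) 1(2) 2(3) 1(4)] trans[OF 1(1) ij(1) 2(2) 1(3) 2(4)] .
      then show ?thesis using C2[OF 1(1,2) 2(1,2) 1(5) 2(5)] 1(6) 2(6) by simp
    qed (use ge0[OF ij(1,2)] ge0[OF ij(2,1)] in auto)
  qed
  have triple: "1 \<le> y i j + y j k + y k i"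
    if ij: "i < n" "j < n" "k < n" "i \<noteq> j" "j \<noteq> k" "k \<noteq> i" for i j k
  proof -
    show ?thesis
    proof (cases "y i j = 1 \<or> y j k = 1 \<or> y k i = 1")
      case False
      obtain a b where 1: "a < n" "b < n" "P a i" "P j b" "a \<noteq> b" "y i j = d a b"
        using attained[OF ij(1,2,4)] False by blast
      obtain a' b' where 2: "a' < n" "b' < n" "P a' j" "P k b'" "a' \<noteq> b'" "y j k = d a' b'"
        using attained[OF ij(2,3,5)] False by blast
      obtain a'' b'' where 3: "a'' < n" "b'' < n" "P a'' k" "P i b''" "a'' \<noteq> b''" "y k i = d a'' b''"
        using attained[OF ij(3,1,6)] False by blast
      have "P a' b" "P a'' b'" "P a b''"
        using trans[OF 2(1) ij(2) 1(2) 2(3) 1(4)] trans[OF 3(1) ij(3) 2(2) 3(3) 2(4)]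
          trans[OF 1(1) ij(1) 3(2) 1(3) 3(4)] .
      then show ?thesis using C3[OF 1(1,2) 2(1,2) 3(1,2) 1(5) 2(5) 3(5)] 1(6) 2(6) 3(6) by simp
    qed (use ge0[OF ij(1,2)] ge0[OF ij(2,3)] ge0[OF ij(3,1)] in auto)
  qed
  have all_triples: "1 \<le> y i j + y j k + y k i"
    if ijk: "i < n" "j < n" "k < n" "\<not> (i = j \<and> j = k)" for i j k
  proof -
    consider "i = j" "i \<noteq> k" | "j = k" "i \<noteq> j" | "k = i" "i \<noteq> j" | "i \<noteq> j" "j \<noteq> k" "k \<noteq> i"
      using ijk(4) by blast
    then show ?thesis
    proof cases
      case 1
      then show ?thesis using pair[OF ijk(1,3) 1(2)] diag[OF ijk(1)] by simp
    next
      case 2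
      then show ?thesis using pair[OF ijk(1,2) 2(2)] diag[OF ijk(2)] by simp
    next
      case 3
      then show ?thesis using pair[OF ijk(1,2) 3(2)] diag[OF ijk(1)] by simp
    qed (rule triple[OF ijk(1-3)])
  qed
  show "cov_pt n P 1 y"
    unfolding cov_pt_def
    by (intro conjI allI impI) ((rule diag ge0 le1 mono all_triples; assumption)+)
qed

lemma closure_01:
  assumes "is_closure n P d i j x" "\<And>i j. i < n \<Longrightarrow> j < n \<Longrightarrow> i \<noteq> j \<Longrightarrow> d i j \<in> {0, 1}"
  shows "x \<in> {0, 1}"
proof (cases "i = j \<or> x = 1")
  case False
  then obtain a b where "a < n" "b < n" "a \<noteq> b" "x = d a b"
    using assms(1) by (auto simp: is_closure_def least_of_def dominating_def)
  then show ?thesis using assms(2) by simp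
qed (use assms(1) in \<open>auto simp: is_closure_def\<close>)

section \<open>Conversion of integral reals\<close>

definition power_table :: "memory \<Rightarrow> bool" where
  "power_table s \<longleftrightarrow> (\<forall>k\<le>fst s 17 0 0. fst s 5 0 k = 2 ^ k)"

definition next_power :: com where
  "next_power =
     Seq (NAssign 5 (NConst 0) (NAdd (NVar 17) (NConst 1))
           (NAdd (NCell 5 (NConst 0) (NVar 17)) (NCell 5 (NConst 0) (NVar 17))))
         (NSet 17 (NAdd (NVar 17) (NConst 1)))"

text \<open>The two nested loops and the two doublings per iteration realise the exponent
  \<open>2 * (L * L)\<close>, where \<open>L\<close> is the content of scalar 15; this is the bit
  length that \<open>entry_bound_pow\<close> provides for.\<close>

definition make_powers :: com where
  "make_powers =
     Seq (NSet 17 (NConst 0)) (Seq (NAssign 5 (NConst 0) (NConst 0) (NConst 1))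
       (For 10 15 (For 11 15 (Seq next_power next_power))))"

lemma mods_make_powers [simp]: "nmods make_powers = {5, 10, 11, 17}" "rmods make_powers = {}"
  by (auto simp: make_powers_def next_power_def)

lemma runs_next_power:
  assumes "power_table s" "fst s 17 0 0 = m"
  shows "runs B next_power s (\<lambda>s'. power_table s' \<and> fst s' 17 0 0 = Suc m)"
  unfolding next_power_def
  by (intro runs_then runs_NAssign) (use assms in \<open>simp add: power_table_def le_Suc_eq\<close>)

lemma runs_make_powers:
  assumes "fst s 15 0 0 = L" "L \<le> B"
  shows "runs B make_powers s (\<lambda>s'. power_table s' \<and> fst s' 17 0 0 = 2 * (L * L))"
proof -
  let ?J = "\<lambda>Z s'. power_table s' \<and> fst s' 17 0 0 = 2 * card Z"
  let ?s = "nput 5 0 0 1 (nset 17 0 s)"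
  have "runs B (For 10 15 (For 11 15 (Seq next_power next_power))) ?s (?J ({..<L} \<times> {..<L}))"
  proof (rule runs_For2[where J = ?J and ?n1.0 = L and ?n2.0 = L], goal_cases)
    case (1 Z i j s')
    then have fin: "finite Z" by simp
    show ?case
    proof (rule runs_Seq, rule runs_next_power)
      show "power_table s'" "fst s' 17 0 0 = 2 * card Z" using 1(8) by simp_all
      fix s2 assume "power_table s2 \<and> fst s2 17 0 0 = Suc (2 * card Z)"
      then have "runs B next_power s2 (\<lambda>s'. power_table s' \<and> fst s' 17 0 0 = Suc (Suc (2 * card Z)))"
        using runs_next_power by blast
      then show "runs B next_power s2 (?J (insert (i, j) Z))"
        using fin 1(3) by simp
    qed
  qed (use assms in \<open>simp_all add: power_table_def next_power_def\<close>)
  then have loop: "runs B (For 10 15 (For 11 15 (Seq next_power next_power))) ?s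
      (\<lambda>s'. power_table s' \<and> fst s' 17 0 0 = 2 * (L * L))"
    by (simp add: card_cartesian_product)
  show ?thesis
    unfolding make_powers_def
    by (rule runs_then, rule runs_NAssign, rule runs_then, rule runs_NAssign) (use loop in simp)
qed

text \<open>
  Conversion of an integral real to a pair of naturals, its positive and its negative part, by
  binary search. This is what makes it usable as a factor.
\<close>

definition conv_loop :: com where
  "conv_loop = For 19 17
     (Cond (RLess (RVar 11) (RNat (NAdd (NVar 21) (NCell 5 (NConst 0) (NSub (NSub (NVar 17) (NConst 1)) (NVar 19))))))
        Skip
        (NSet 21 (NAdd (NVar 21) (NCell 5 (NConst 0) (NSub (NSub (NVar 17) (NConst 1)) (NVar 19))))))"

definition conv :: "rexp \<Rightarrow> com" where
  "conv x =
     Seq (RSet 10 x)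
    (Seq (Cond (RLess (RVar 10) (RNat (NConst 0))) (RSet 11 (RSub (RNat (NConst 0)) (RVar 10))) (RSet 11 (RVar 10)))
    (Seq (NSet 21 (NConst 0))
    (Seq conv_loop
         (Cond (RLess (RVar 10) (RNat (NConst 0)))
            (Seq (NSet 18 (NConst 0)) (NSet 20 (NVar 21)))
            (Seq (NSet 18 (NVar 21)) (NSet 20 (NConst 0)))))))"

lemma mods_conv [simp]: "nmods (conv x) = {18, 19, 20, 21}" "rmods (conv x) = {10, 11}"
  by (auto simp: conv_def conv_loop_def)

lemma runs_conv_loop:
  assumes K: "fst s 17 0 0 = K" "K \<le> B" and pow: "power_table s"
    and z: "snd s 11 0 0 = real m" "m < 2 ^ K" and acc: "fst s 21 0 0 = 0"
  shows "runs B conv_loop s (\<lambda>s'. fst s' 21 0 0 = m)"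
proof -
  let ?x = "NAdd (NVar 21) (NCell 5 (NConst 0) (NSub (NSub (NVar 17) (NConst 1)) (NVar 19)))"
  \<comment> \<open>After \<open>k\<close> rounds the accumulator holds the leading \<open>k\<close>
    of the \<open>K\<close> bits of \<open>m\<close>; what is missing is less than
    \<open>2 ^ (K - k)\<close>.\<close>
  let ?I = "\<lambda>k s'. fst s' 21 0 0 \<le> m \<and> m < fst s' 21 0 0 + 2 ^ (K - k)"
  have "runs B conv_loop s (?I K)"
    unfolding conv_loop_def
  proof (rule runs_For[where I = ?I and n = K], goal_cases)
    case (1 k s')
    have fr: "fst s' 17 0 0 = K" "fst s' 5 = fst s 5" "snd s' 11 = snd s 11"
      using 1(2) K by (simp_all add: frame_def)
    have p: "fst s' 5 0 (K - Suc 0 - k) = 2 ^ (K - Suc k)"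
      using pow K(1) 1(1) unfolding fr power_table_def by simp
    have "K - k = Suc (K - Suc k)" using 1(1) by simp
    then have K': "(2::nat) ^ (K - k) = 2 ^ (K - Suc k) + 2 ^ (K - Suc k)" by simp
    have lt: "real m < real a + 2 ^ b \<longleftrightarrow> m < a + 2 ^ b" for a b
      by (metis of_nat_add of_nat_less_iff of_nat_numeral of_nat_power)
    show ?case
    proof (rule runs_Cond)
      assume "bval (RLess (RVar 11) (RNat ?x)) s'"
      then have "m < fst s' 21 0 0 + 2 ^ (K - Suc k)"
        using lt 1(3) fr z p by simp
      then show "runs B Skip s' (\<lambda>s''. ?I (Suc k) (nset 19 (Suc k) s''))"
        using 1(4) by (intro runs_Skip) simp
    next
      assume "\<not> bval (RLess (RVar 11) (RNat ?x)) s'"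
      then have "\<not> m < fst s' 21 0 0 + 2 ^ (K - Suc k)"
        using lt 1(3) fr z p by simp
      then show "runs B (NSet 21 ?x) s'
          (\<lambda>s''. ?I (Suc k) (nset 19 (Suc k) s''))"
        using 1(3,4) fr p K' by (intro runs_NAssign) simp
    qed
  qed (use K z acc in simp_all)
  then show ?thesis by (rule runs_conseq) simp
qed

lemma runs_conv:
  assumes K: "fst s 17 0 0 \<le> B" and pow: "power_table s"
    and z: "rval x s = z" "z \<in> \<int>" "\<bar>z\<bar> < 2 ^ fst s 17 0 0"
  shows "runs B (conv x) s (\<lambda>s'. real (fst s' 18 0 0) = max 0 z \<and> real (fst s' 20 0 0) = max 0 (- z))"
proof -
  obtain l where l: "z = of_int l" using z(2) by (elim Ints_cases)
  define m where "m = nat \<bar>l\<bar>"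
  have m: "\<bar>z\<bar> = real m" by (simp add: l m_def)
  have mK: "m < 2 ^ fst s 17 0 0"
    using z(3) unfolding m by (metis of_nat_less_iff of_nat_numeral of_nat_power)
  let ?e = "Cond (RLess (RVar 10) (RNat (NConst 0)))
            (Seq (NSet 18 (NConst 0)) (NSet 20 (NVar 21)))
            (Seq (NSet 18 (NVar 21)) (NSet 20 (NConst 0)))"
  let ?s = "nset 21 0 (rset 11 \<bar>z\<bar> (rset 10 z s))"
  have loop: "runs B conv_loop ?s (\<lambda>s'. fst s' 21 0 0 = m)"
    by (rule runs_conv_loop[OF refl]) (use K pow m mK in \<open>simp_all add: power_table_def\<close>)
  have "runs B (Seq conv_loop
         ?e) ?s
     (\<lambda>s'. real (fst s' 18 0 0) = max 0 z \<and> real (fst s' 20 0 0) = max 0 (- z))"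
  proof (rule runs_Seq[OF loop])
    fix s' assume f: "frame conv_loop ?s s'" and m': "fst s' 21 0 0 = m"
    then have "snd s' 10 0 0 = z"
      by (simp add: frame_real conv_loop_def)
    then show "runs B ?e s'
         (\<lambda>s'. real (fst s' 18 0 0) = max 0 z \<and> real (fst s' 20 0 0) = max 0 (- z))"
      by (intro runs_Cond runs_then runs_NAssign) (use m m' in auto)
  qed
  then have main: "runs B (Seq (NSet 21 (NConst 0)) (Seq conv_loop
         ?e)) (rset 11 \<bar>z\<bar> (rset 10 z s))
     (\<lambda>s'. real (fst s' 18 0 0) = max 0 z \<and> real (fst s' 20 0 0) = max 0 (- z))"
    by (intro runs_then[OF runs_NAssign]) simp
  have abs: "runs B (Cond (RLess (RVar 10) (RNat (NConst 0))) (RSet 11 (RSub (RNat (NConst 0)) (RVar 10)))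
      (RSet 11 (RVar 10))) (rset 10 z s) (\<lambda>s'. s' = rset 11 \<bar>z\<bar> (rset 10 z s))"
    by (rule runs_Cond; rule runs_RAssign; simp)
  show ?thesis
    unfolding conv_def
    by (rule runs_then, rule runs_RAssign, rule runs_Seq[where R = "\<lambda>s'. s' = rset 11 \<bar>z\<bar> (rset 10 z s)"])
      (use abs main in \<open>simp_all add: z\<close>)
qed

section \<open>The constraint system\<close>

definition ix :: "nat \<Rightarrow> nat \<Rightarrow> nat \<Rightarrow> nat" where
  "ix n i j = i * n + j"

lemma ix_less: "i < n \<Longrightarrow> j < n \<Longrightarrow> ix n i j < n * n"
proof -
  assume "i < n" "j < n"
  then have "Suc i * n \<le> n * n" by (intro mult_right_mono) simp_all
  moreover have "ix n i j < Suc i * n" using \<open>j < n\<close> by (simp add: ix_def)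
  ultimately show ?thesis by linarith
qed

lemma ix_inj: "j < n \<Longrightarrow> j' < n \<Longrightarrow> ix n i j = ix n i' j' \<Longrightarrow> i = i' \<and> j = j'"
proof -
  assume *: "j < n" "j' < n" "ix n i j = ix n i' j'"
  then have "(i * n + j) div n = (i' * n + j') div n" "(i * n + j) mod n = (i' * n + j') mod n"
    unfolding ix_def by simp_all
  then show ?thesis using *(1,2) by simp
qed

lemma ix_surj: "t < n * n \<Longrightarrow> \<exists>i<n. \<exists>j<n. t = ix n i j"
proof -
  assume t: "t < n * n"
  then have "n > 0" by (cases n) auto
  then show ?thesis
    using t by (intro exI[of _ "t div n"] conjI exI[of _ "t mod n"]) (simp_all add: ix_def less_mult_imp_div_less)
qed

definition tables :: com where
  "tables =
     Seq (NSet 14 (NConst 0))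
    (Seq (For 10 0 (For 11 0
            (Seq (NAssign 3 (NVar 10) (NVar 11) (NVar 14))
            (Seq (RAssign 6 (NConst 0) (NVar 14) (RCell 0 (NVar 10) (NVar 11)))
            (Seq (RAssign 3 (NConst 0) (NVar 14) (RCell 2 (NVar 10) (NVar 11)))
                 (NSet 14 (NAdd (NVar 14) (NConst 1))))))))
    (Seq (RAssign 3 (NConst 0) (NVar 14) (RNat (NConst 0)))
         (NSet 15 (NAdd (NVar 14) (NConst 1)))))"

lemma mods_tables [simp]: "nmods tables = {3, 10, 11, 14, 15}" "rmods tables = {3, 6}"
  by (auto simp: tables_def)

lemma runs_tables:
  assumes n: "fst s 0 0 0 = n" "n \<le> B"
  shows "runs B tables s (\<lambda>s'. fst s' 14 0 0 = n * n \<and> fst s' 15 0 0 = Suc (n * n) \<and> snd s' 3 0 (n * n) = 0 \<and>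
     (\<forall>i<n. \<forall>j<n. fst s' 3 i j = ix n i j \<and> snd s' 6 0 (ix n i j) = snd s 0 i j \<and>
        snd s' 3 0 (ix n i j) = snd s 2 i j))"
proof -
  let ?c = "Seq (NAssign 3 (NVar 10) (NVar 11) (NVar 14))
            (Seq (RAssign 6 (NConst 0) (NVar 14) (RCell 0 (NVar 10) (NVar 11)))
            (Seq (RAssign 3 (NConst 0) (NVar 14) (RCell 2 (NVar 10) (NVar 11)))
                 (NSet 14 (NAdd (NVar 14) (NConst 1)))))"
  let ?ok = "\<lambda>s' i j. fst s' 3 i j = ix n i j \<and> snd s' 6 0 (ix n i j) = snd s 0 i j \<and>
        snd s' 3 0 (ix n i j) = snd s 2 i j"
  let ?J = "\<lambda>Z s'. fst s' 14 0 0 = card Z \<and> (\<forall>i j. (i, j) \<in> Z \<longrightarrow> ?ok s' i j)"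
  have loop: "runs B (For 10 0 (For 11 0 ?c)) (nset 14 0 s) (?J ({..<n} \<times> {..<n}))"
  proof (rule runs_For2[where J = ?J and ?n1.0 = n and ?n2.0 = n], goal_cases)
    case (1 Z i j s')
    have fr: "snd s' 0 = snd s 0" "snd s' 2 = snd s 2"
      using 1(4) by (simp_all add: frame_def)
    have fin: "finite Z" using 1(7) by simp
    \<comment> \<open>Array indices are obtained by counting instead of multiplying: in row-major
      order the counter at \<open>(i, j)\<close> has passed \<open>i\<close> full rows and
      \<open>j\<close> further cells.\<close>
    have cZ: "card Z = ix n i j"
      unfolding 1(7) ix_def by (subst card_Un_disjoint) (auto simp: card_cartesian_product)
    have ne: "ix n a b \<noteq> ix n i j" if "(a, b) \<in> Z" for a b
      using that 1(1-3,7) ix_inj[of b n j a i] by auto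
    have "?J (insert (i, j) Z) (nset 14 (Suc (ix n i j)) (rput 3 0 (ix n i j) (snd s 2 i j)
            (rput 6 0 (ix n i j) (snd s 0 i j) (nput 3 i j (ix n i j) s'))))"
      using 1(3,8) fin cZ ne by auto
    then show ?case
      by (intro runs_then[OF runs_NAssign] runs_then[OF runs_RAssign] runs_NAssign)
        (use 1(5,6,8) cZ fr in simp)
  qed (use n in simp_all)
  show ?thesis
    unfolding tables_def
  proof (rule runs_then, rule runs_NAssign, rule runs_Seq[where R = "?J ({..<n} \<times> {..<n})"], goal_cases)
    case 1
    then show ?case using loop by simp
  next
    case (2 s')
    have "ix n i j \<noteq> n * n" if "i < n" "j < n" for i j
      using ix_less[OF that] by simp
    then show ?case
      by (intro runs_then[OF runs_RAssign] runs_NAssign) (use 2(2) in \<open>simp add: card_cartesian_product\<close>)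
  qed
qed

type_synonym row = "nat \<times> nat \<times> nat \<times> nat \<times> real"

definition rowset :: "memory \<Rightarrow> row set" where
  "rowset s = (\<lambda>m. (fst s 4 0 m, fst s 4 2 m, fst s 4 3 m, fst s 4 4 m, snd s 4 0 m)) ` {..<fst s 16 0 0}"

text \<open>Each constraint of \<open>cov_pt\<close> can be written with at most three added entries
  and one subtracted entry. The uniform format makes every row evaluable by a single
  expression.\<close>

fun sat :: "(nat \<Rightarrow> real) \<Rightarrow> row \<Rightarrow> bool" where
  "sat z (a, b, c, q, \<beta>) \<longleftrightarrow> \<beta> \<le> z a + z b + z c - z q"

text \<open>
  The rows whose satisfaction by \<open>z\<close> expresses \<open>cov_pt n P 1 (\<lambda>i j. z (ix n i j))\<close>; the index
  \<open>n * n\<close> is a dummy at which \<open>z\<close> vanishes.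
\<close>

definition rows_at :: "nat \<Rightarrow> (nat \<Rightarrow> nat \<Rightarrow> bool) \<Rightarrow> nat \<Rightarrow> nat \<Rightarrow> nat \<Rightarrow> row set" where
  "rows_at n P i j k =
     (if i = j \<and> j = k then {} else {(ix n i j, ix n j k, ix n k i, n * n, 1)}) \<union>
     (if P i j then {(ix n i k, n * n, n * n, ix n j k, 0), (ix n k j, n * n, n * n, ix n k i, 0)} else {}) \<union>
     {(ix n i j, n * n, n * n, n * n, 0), (n * n, n * n, n * n, ix n i j, if i = j then 0 else - 1)}"

definition all_rows :: "nat \<Rightarrow> (nat \<Rightarrow> nat \<Rightarrow> bool) \<Rightarrow> row set" where
  "all_rows n P = (\<Union>i<n. \<Union>j<n. \<Union>k<n. rows_at n P i j k)"

lemma all_rows_cov_pt: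
  assumes z: "z (n * n) = 0"
  shows "(\<forall>r\<in>all_rows n P. sat z r) \<longleftrightarrow> cov_pt n P 1 (\<lambda>i j. z (ix n i j))"
proof
  assume *: "\<forall>r\<in>all_rows n P. sat z r"
  have r: "sat z r" if "i < n" "j < n" "k < n" "r \<in> rows_at n P i j k" for i j k r
    using * that unfolding all_rows_def by blast
  show "cov_pt n P 1 (\<lambda>i j. z (ix n i j))"
    unfolding cov_pt_def
  proof (intro conjI allI impI)
    fix i j assume ij: "i < n" "j < n"
    \<comment> \<open>On the diagonal the right-hand side of the upper-bound row is 0 instead of -1,
      so the two bounds force the entry to vanish.\<close>
    show "z (ix n i i) = 0"
      using r[OF ij(1,1,1), of "(ix n i i, n * n, n * n, n * n, 0)"]
        r[OF ij(1,1,1), of "(n * n, n * n, n * n, ix n i i, 0)"] z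
      by (simp add: rows_at_def)
    show nn: "0 \<le> z (ix n i j)"
      using r[OF ij ij(1), of "(ix n i j, n * n, n * n, n * n, 0)"] z by (simp add: rows_at_def)
    show "z (ix n i j) \<le> 1"
      using r[OF ij ij(1), of "(n * n, n * n, n * n, ix n i j, if i = j then 0 else - 1)"] z
      by (simp add: rows_at_def split: if_splits)
    fix k assume k: "k < n"
    show "1 \<le> z (ix n i j) + z (ix n j k) + z (ix n k i)" if "\<not> (i = j \<and> j = k)"
      using r[OF ij k, of "(ix n i j, ix n j k, ix n k i, n * n, 1)"] z that
      by (simp add: rows_at_def)
    assume "P i j"
    then show "z (ix n j k) \<le> z (ix n i k)" "z (ix n k i) \<le> z (ix n k j)"
      using r[OF ij k, of "(ix n i k, n * n, n * n, ix n j k, 0)"]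
        r[OF ij k, of "(ix n k j, n * n, n * n, ix n k i, 0)"] z
      by (simp_all add: rows_at_def)
  qed
next
  assume c: "cov_pt n P 1 (\<lambda>i j. z (ix n i j))"
  show "\<forall>r\<in>all_rows n P. sat z r"
  proof
    fix r assume "r \<in> all_rows n P"
    then obtain i j k where ijk: "i < n" "j < n" "k < n" and r: "r \<in> rows_at n P i j k"
      unfolding all_rows_def by blast
    show "sat z r"
      using r cov_ptD[OF c ijk(1,2)] cov_ptD(5-7)[OF c ijk] z
      unfolding rows_at_def by (auto split: if_splits)
  qed
qed

lemma all_rows_bounds:
  assumes "(a, b, c, q, \<beta>) \<in> all_rows n P"
  shows "a \<le> n * n" "b \<le> n * n" "c \<le> n * n" "q \<le> n * n" "\<beta> \<in> \<int>"
proof -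
  obtain i j k where ijk: "i < n" "j < n" "k < n" and r: "(a, b, c, q, \<beta>) \<in> rows_at n P i j k"
    using assms unfolding all_rows_def by blast
  have "ix n i j \<le> n * n" "ix n i k \<le> n * n" "ix n j k \<le> n * n" "ix n k i \<le> n * n" "ix n k j \<le> n * n"
    using ijk by (auto intro!: less_imp_le ix_less)
  then show "a \<le> n * n" "b \<le> n * n" "c \<le> n * n" "q \<le> n * n" "\<beta> \<in> \<int>"
    using r by (auto simp: rows_at_def split: if_splits)
qed

text \<open>Each coordinate is bounded on both sides by rows of the system. Consequently a move that
  changes coordinate \<open>t\<close> is blocked eventually, and the ratio test always finds a
  row.\<close>

lemma all_rows_box:
  assumes "t < n * n"
  shows "(t, n * n, n * n, n * n, 0) \<in> all_rows n P" "\<exists>\<beta>. (n * n, n * n, n * n, t, \<beta>) \<in> all_rows n P"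
proof -
  obtain i j where ij: "i < n" "j < n" "t = ix n i j" using ix_surj[OF assms] by blast
  then have "rows_at n P i j i \<subseteq> all_rows n P" unfolding all_rows_def by blast
  then show "(t, n * n, n * n, n * n, 0) \<in> all_rows n P" "\<exists>\<beta>. (n * n, n * n, n * n, t, \<beta>) \<in> all_rows n P"
    unfolding ij(3) by (auto simp: rows_at_def)
qed

definition emit :: "nexp \<Rightarrow> nexp \<Rightarrow> nexp \<Rightarrow> nexp \<Rightarrow> rexp \<Rightarrow> com" where
  "emit a b c q x =
     Seq (NAssign 4 (NConst 0) (NVar 16) a)
    (Seq (NAssign 4 (NConst 2) (NVar 16) b)
    (Seq (NAssign 4 (NConst 3) (NVar 16) c)
    (Seq (NAssign 4 (NConst 4) (NVar 16) q)
    (Seq (RAssign 4 (NConst 0) (NVar 16) x)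
         (NSet 16 (NAdd (NVar 16) (NConst 1)))))))"

lemma mods_emit [simp]: "nmods (emit a b c q x) = {4, 16}" "rmods (emit a b c q x) = {4}"
  by (auto simp: emit_def)

text \<open>The operands of \<open>emit\<close> only refer to cells that \<open>emit\<close> does not modify.\<close>

definition stable :: "nexp \<Rightarrow> memory \<Rightarrow> bool" where
  "stable x s \<longleftrightarrow> (\<forall>s'. (\<forall>a. a \<noteq> 4 \<longrightarrow> a \<noteq> 16 \<longrightarrow> fst s' a = fst s a) \<longrightarrow> nval x s' = nval x s)"

lemma stableD:
  "stable x s \<Longrightarrow> (\<And>a. a \<noteq> 4 \<Longrightarrow> a \<noteq> 16 \<Longrightarrow> fst s' a = fst s a) \<Longrightarrow> nval x s' = nval x s"
  unfolding stable_def by blast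

definition IX :: "nat \<Rightarrow> nat \<Rightarrow> nexp" where
  "IX u v = NCell 3 (NVar u) (NVar v)"

lemma runs_emit:
  assumes st: "stable a s" "stable b s" "stable c s" "stable q s"
    and x: "x = RNat (NConst 0) \<or> x = RNat (NConst 1) \<or> x = RSub (RNat (NConst 0)) (RNat (NConst 1))"
    and v: "nval a s = va" "nval b s = vb" "nval c s = vc" "nval q s = vq" "rval x s = vx"
    and Q: "\<And>s'. frame (emit a b c q x) s s' \<Longrightarrow> rowset s' = insert (va, vb, vc, vq, vx) (rowset s) \<Longrightarrow>
        fst s' 16 0 0 = Suc (fst s 16 0 0) \<Longrightarrow> Q s'"
  shows "runs B (emit a b c q x) s Q"
proof -
  let ?m = "fst s 16 0 0"
  let ?s1 = "nput 4 0 ?m va s"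
  let ?s2 = "nput 4 2 ?m vb ?s1"
  let ?s3 = "nput 4 3 ?m vc ?s2"
  let ?s4 = "nput 4 4 ?m vq ?s3"
  let ?s' = "nset 16 (Suc ?m) (rput 4 0 ?m vx ?s4)"
  have e: "nval b ?s1 = vb" "nval c ?s2 = vc" "nval q ?s3 = vq"
    using stableD[OF st(2), of ?s1] stableD[OF st(3), of ?s2] stableD[OF st(4), of ?s3] v by simp_all
  have x': "rval x ?s4 = vx" using x v(5) by auto
  have row: "rowset ?s' = insert (va, vb, vc, vq, vx) (rowset s)"
    unfolding rowset_def by (auto simp: lessThan_Suc image_iff)
  have fr: "frame (emit a b c q x) s ?s'" by (simp add: frame_def)
  have "Q ?s'" using Q[OF fr row] by simp
  then show ?thesis
    unfolding emit_def
    by (intro runs_then[OF runs_NAssign] runs_then[OF runs_RAssign] runs_NAssign) (simp add: v e x')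
qed

definition emit_rows :: com where
  "emit_rows =
     Seq (Cond (BAnd (NEq (NVar 10) (NVar 11)) (NEq (NVar 11) (NVar 12))) Skip
            (emit (IX 10 11) (IX 11 12) (IX 12 10) (NVar 14) (RNat (NConst 1))))
    (Seq (Cond (NLess (NConst 0) (NCell 1 (NVar 10) (NVar 11)))
            (Seq (emit (IX 10 12) (NVar 14) (NVar 14) (IX 11 12) (RNat (NConst 0)))
                 (emit (IX 12 11) (NVar 14) (NVar 14) (IX 12 10) (RNat (NConst 0))))
            Skip)
    (Seq (emit (IX 10 11) (NVar 14) (NVar 14) (NVar 14) (RNat (NConst 0)))
         (Cond (NEq (NVar 10) (NVar 11))
            (emit (NVar 14) (NVar 14) (NVar 14) (IX 10 11) (RNat (NConst 0)))
            (emit (NVar 14) (NVar 14) (NVar 14) (IX 10 11) (RSub (RNat (NConst 0)) (RNat (NConst 1)))))))"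

definition make_rows :: com where
  "make_rows = Seq (NSet 16 (NConst 0)) (For 10 0 (For 11 0 (For 12 0 emit_rows)))"

lemma mods_emit_rows [simp]: "nmods emit_rows = {4, 16}" "rmods emit_rows = {4}"
  by (auto simp: emit_rows_def)

lemma mods_make_rows [simp]: "nmods make_rows = {4, 10, 11, 12, 16}" "rmods make_rows = {4}"
  by (auto simp: make_rows_def)

lemma stable_NVar [simp]: "v \<noteq> 4 \<Longrightarrow> v \<noteq> 16 \<Longrightarrow> stable (NVar v) s"
  by (simp add: stable_def)

lemma stable_IX [simp]: "u \<noteq> 4 \<Longrightarrow> u \<noteq> 16 \<Longrightarrow> v \<noteq> 4 \<Longrightarrow> v \<noteq> 16 \<Longrightarrow> stable (IX u v) s"
  by (simp add: stable_def IX_def)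

text \<open>Five rows at most: one cyclic inequality, two for monotonicity and two bounds. The
  bounds are emitted again for every \<open>k\<close>, which \<open>rowset\<close>, being a set,
  does not see.\<close>

lemma runs_emit_rows:
  assumes v: "fst s 10 0 0 = i" "fst s 11 0 0 = j" "fst s 12 0 0 = k" "fst s 14 0 0 = n * n"
    and ix: "\<And>i j. i < n \<Longrightarrow> j < n \<Longrightarrow> fst s 3 i j = ix n i j" and ijk: "i < n" "j < n" "k < n"
  shows "runs B emit_rows s (\<lambda>s'. rowset s' = rowset s \<union> rows_at n (\<lambda>i j. 0 < fst s 1 i j) i j k \<and>
     fst s' 16 0 0 \<le> fst s 16 0 0 + 5)"
proof -
  let ?G = "\<lambda>s'. fst s' 10 0 0 = i \<and> fst s' 11 0 0 = j \<and> fst s' 12 0 0 = k \<and> fst s' 14 0 0 = n * n \<and>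
     fst s' 3 = fst s 3 \<and> fst s' 1 = fst s 1"
  have val: "nval (IX 10 11) s' = ix n i j" "nval (IX 11 12) s' = ix n j k" "nval (IX 12 10) s' = ix n k i"
    "nval (IX 10 12) s' = ix n i k" "nval (IX 12 11) s' = ix n k j" "nval (NVar 14) s' = n * n"
    if "?G s'" for s'
    using that ix ijk by (simp_all add: IX_def)
  have G: "?G s'" if "?G s1" "frame (emit a b c q x) s1 s'" for s1 s' a b c q x
    using that by (simp add: frame_def)
  let ?R1 = "if i = j \<and> j = k then {} else {(ix n i j, ix n j k, ix n k i, n * n, 1::real)}"
  let ?R2 = "if 0 < fst s 1 i j then {(ix n i k, n * n, n * n, ix n j k, 0::real), (ix n k j, n * n, n * n, ix n k i, 0)} else {}"
  have g0: "?G s" using v by simp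
  show ?thesis
    unfolding emit_rows_def
  proof (rule runs_Seq[where R = "\<lambda>s'. ?G s' \<and> rowset s' = rowset s \<union> ?R1 \<and> fst s' 16 0 0 \<le> fst s 16 0 0 + 1"], goal_cases)
    case 1
    show ?case
      apply (rule runs_Cond)
       apply (rule runs_Skip, use v in simp)
      apply (rule runs_emit[OF _ _ _ _ _ val(1)[OF g0] val(2)[OF g0] val(3)[OF g0] val(6)[OF g0] refl]; (simp; fail)?)
      subgoal premises p for s'
        using p(1) v G[OF g0 p(2)] p(3,4) by auto
      done
  next
    case (2 s1)
    note 1 = 2(2)
    then have g1: "?G s1" by blast
    show ?case
    proof (rule runs_Seq[where R = "\<lambda>s'. ?G s' \<and> rowset s' = rowset s \<union> ?R1 \<union> ?R2 \<and> fst s' 16 0 0 \<le> fst s 16 0 0 + 3"], goal_cases)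
      case _: 1
      show ?case
      proof (rule runs_Cond, goal_cases)
        case _: 2
        then have "\<not> 0 < fst s 1 i j" using g1 by simp
        then show ?case by (intro runs_Skip) (use 1 in simp)
      next
        case _: 1
        then have P: "0 < fst s 1 i j" using g1 by simp
        show ?case
          apply (rule runs_then)
          apply (rule runs_emit[OF _ _ _ _ _ val(4)[OF g1] val(6)[OF g1] val(6)[OF g1] val(2)[OF g1] refl]; (simp; fail)?)
          subgoal premises p for s2
          proof -
            have g2: "?G s2" by (rule G[OF g1 p(1)])
            show ?thesis
              apply (rule runs_emit[OF _ _ _ _ _ val(5)[OF g2] val(6)[OF g2] val(6)[OF g2] val(3)[OF g2] refl]; (simp; fail)?)
              subgoal premises q for s3
                using G[OF g2 q(1)] q(2,3) p(2,3) 1 P by auto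
              done
          qed
          done
      qed
    next
      case (2 s2)
      note p2 = 2(2)
      then have g2: "?G s2" by blast
      show ?case
        apply (rule runs_then)
        apply (rule runs_emit[OF _ _ _ _ _ val(1)[OF g2] val(6)[OF g2] val(6)[OF g2] val(6)[OF g2] refl]; (simp; fail)?)
        subgoal premises p for s3
        proof -
          have g3: "?G s3" by (rule G[OF g2 p(1)])
          show ?thesis
            apply (rule runs_Cond)
             apply (rule runs_emit[OF _ _ _ _ _ val(6)[OF g3] val(6)[OF g3] val(6)[OF g3] val(1)[OF g3] refl]; (simp; fail)?)
            subgoal premises q for s4
              using q g3 p(2,3) p2 unfolding rows_at_def by auto
            apply (rule runs_emit[OF _ _ _ _ _ val(6)[OF g3] val(6)[OF g3] val(6)[OF g3] val(1)[OF g3] refl]; (simp; fail)?)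
            subgoal premises q for s4
              using q g3 p(2,3) p2 unfolding rows_at_def by auto
            done
        qed
        done
    qed
  qed
qed

lemma runs_make_rows:
  assumes n: "fst s 0 0 0 = n" "n \<le> B" and N: "fst s 14 0 0 = n * n"
    and ix: "\<And>i j. i < n \<Longrightarrow> j < n \<Longrightarrow> fst s 3 i j = ix n i j"
  shows "runs B make_rows s (\<lambda>s'. rowset s' = all_rows n (\<lambda>i j. 0 < fst s 1 i j) \<and>
     fst s' 16 0 0 \<le> 5 * (n * (n * n)))"
proof -
  let ?P = "\<lambda>i j. 0 < fst s 1 i j"
  let ?J = "\<lambda>Z s'. rowset s' = (\<Union>(i, j, k)\<in>Z. rows_at n ?P i j k) \<and> fst s' 16 0 0 \<le> 5 * card Z"
  let ?sq = "{..<n} \<times> {..<n}"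
  have loop: "runs B (For 10 0 (For 11 0 (For 12 0 emit_rows))) (nset 16 0 s) (?J ({..<n} \<times> ?sq))"
  proof (rule runs_For_set[where J = "\<lambda>X. ?J (X \<times> ?sq)" and n = n], goal_cases)
    case (1 i s1)
    have fr1: "fst s1 0 0 0 = n" "fst s1 14 0 0 = n * n" "fst s1 3 = fst s 3" "fst s1 1 = fst s 1"
      using 1(2) n N by (simp_all add: frame_def)
    have "runs B (For 11 0 (For 12 0 emit_rows)) s1 (?J ({..<i} \<times> ?sq \<union> {i} \<times> ?sq))"
    proof (rule runs_For2[where J = "\<lambda>Y. ?J ({..<i} \<times> ?sq \<union> {i} \<times> Y)" and ?n1.0 = n and ?n2.0 = n], goal_cases)
      case (1 Z j k s2)
      have fr2: "fst s2 10 0 0 = i" "fst s2 14 0 0 = n * n" "fst s2 3 = fst s 3" "fst s2 1 = fst s 1"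
        using 1(4) fr1 \<open>fst s1 10 0 0 = i\<close> by (simp_all add: frame_def)
      let ?Z = "{..<i} \<times> ?sq \<union> {i} \<times> Z"
      have fin: "finite Z" using 1(7) by simp
      have nin: "(i, j, k) \<notin> ?Z" using 1(3) by simp
      have ins: "{..<i} \<times> ?sq \<union> {i} \<times> insert (j, k) Z = insert (i, j, k) ?Z" by blast
      have card: "card (insert (i, j, k) ?Z) = Suc (card ?Z)"
        using fin nin by (intro card_insert_disjoint) simp_all
      have body: "runs B emit_rows s2 (\<lambda>s'. rowset s' = rowset s2 \<union> rows_at n (\<lambda>i j. 0 < fst s2 1 i j) i j k \<and>
          fst s' 16 0 0 \<le> fst s2 16 0 0 + 5)"
        by (rule runs_emit_rows) (use 1(1,2,5,6) fr2 ix \<open>i < n\<close> in simp_all)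
      show ?case
        unfolding ins card
      proof (rule runs_conseq[OF body])
        fix s3 assume "rowset s3 = rowset s2 \<union> rows_at n (\<lambda>i j. 0 < fst s2 1 i j) i j k \<and>
          fst s3 16 0 0 \<le> fst s2 16 0 0 + 5"
        then show "rowset s3 = (\<Union>(i, j, k)\<in>insert (i, j, k) ?Z. rows_at n ?P i j k) \<and> fst s3 16 0 0 \<le> 5 * Suc (card ?Z)"
          using 1(8) unfolding fr2 by (simp add: Un_commute)
      qed
    next
      case 6
      then show ?case using 1(4) by simp
    qed (use fr1 n in \<open>simp_all add: rowset_def\<close>)
    moreover have "{..<i} \<times> ?sq \<union> {i} \<times> ?sq = insert i {..<i} \<times> ?sq" by blast
    ultimately show ?case by (simp only:)
  qed (use n in \<open>simp_all add: rowset_def\<close>)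
  have "(\<Union>(i, j, k)\<in>{..<n} \<times> ?sq. rows_at n ?P i j k) = all_rows n ?P"
    unfolding all_rows_def by blast
  with loop have "runs B (For 10 0 (For 11 0 (For 12 0 emit_rows))) (nset 16 0 s)
      (\<lambda>s'. rowset s' = all_rows n ?P \<and> fst s' 16 0 0 \<le> 5 * (n * (n * n)))"
    by (simp add: card_cartesian_product)
  then show ?thesis
    unfolding make_rows_def by (intro runs_then[OF runs_NAssign]) simp
qed

section \<open>Fraction-free elimination\<close>

lemma det_Ints:
  fixes A :: "real mat"
  assumes A: "A \<in> carrier_mat n n" and int: "\<And>i j. i < n \<Longrightarrow> j < n \<Longrightarrow> A $$ (i, j) \<in> \<int>"
  shows "det A \<in> \<int>"
proof -
  have "signof p \<in> (\<int> :: real set)" for p :: "nat \<Rightarrow> nat"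
    by (simp add: sign_def)
  moreover have "(\<Prod>i = 0..<n. A $$ (i, p i)) \<in> \<int>" if "p permutes {0..<n}" for p
    using int permutes_in_image[OF that] by (intro Ints_prod) auto
  ultimately show ?thesis
    unfolding det_def'[OF A] by (intro Ints_sum Ints_mult) auto
qed

lemma det_abs_le:
  fixes A :: "real mat"
  assumes A: "A \<in> carrier_mat n n" and bound: "\<And>i j. i < n \<Longrightarrow> j < n \<Longrightarrow> \<bar>A $$ (i, j)\<bar> \<le> c"
  shows "\<bar>det A\<bar> \<le> fact n * c ^ n"
proof -
  have "\<bar>signof p * (\<Prod>i = 0..<n. A $$ (i, p i))\<bar> \<le> c ^ n" if p: "p permutes {0..<n}" for p
  proof -
    have "\<bar>signof p * (\<Prod>i = 0..<n. A $$ (i, p i))\<bar> = (\<Prod>i = 0..<n. \<bar>A $$ (i, p i)\<bar>)"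
      by (simp add: abs_mult abs_prod sign_def)
    also have "\<dots> \<le> (\<Prod>i = 0..<n. c)"
      using bound permutes_in_image[OF p] by (intro prod_mono) auto
    finally show ?thesis by simp
  qed
  then have "\<bar>det A\<bar> \<le> (\<Sum>p | p permutes {0..<n}. c ^ n)"
    unfolding det_def'[OF A] by (intro order.trans[OF sum_abs] sum_mono) auto
  also have "\<dots> = fact n * c ^ n"
    by (simp add: card_permutations)
  finally show ?thesis .
qed

definition sq :: "nat \<Rightarrow> (nat \<Rightarrow> nat \<Rightarrow> real) \<Rightarrow> real mat" where
  "sq n A = mat n n (\<lambda>(i, j). A i j)"

lemma sq_carrier [simp]: "sq n A \<in> carrier_mat n n"
  by (simp add: sq_def)

lemma cramer:
  assumes "\<And>i. i < t \<Longrightarrow> (\<Sum>j<t. A i j * x j) = c i" "k < t"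
  shows "det (sq t (\<lambda>i j. if j = k then c i else A i j)) = x k * det (sq t A)"
proof -
  have eq: "sq t A *\<^sub>v vec t x = vec t c"
    using assms(1) by (intro eq_vecI) (auto simp: sq_def scalar_prod_def lessThan_atLeast0)
  have "replace_col (sq t A) (sq t A *\<^sub>v vec t x) k = sq t (\<lambda>i j. if j = k then c i else A i j)"
    unfolding eq by (intro eq_matI) (auto simp: sq_def replace_col_def)
  then show ?thesis
    using cramer_lemma_mat[OF sq_carrier, of "vec t x" t k A] assms(2) by simp
qed

lemma det_sq_last_col:
  "det (sq (Suc t) (\<lambda>i j. if j = t then (if i = t then p else 0) else A i j)) = p * det (sq t A)"
proof -
  let ?B = "sq (Suc t) (\<lambda>i j. if j = t then (if i = t then p else 0) else A i j)"
  have "det ?B = (\<Sum>i<Suc t. ?B $$ (i, t) * cofactor ?B i t)"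
    by (rule laplace_expansion_column) auto
  also have "\<dots> = p * cofactor ?B t t"
    by (subst sum.remove[of _ t]) (auto simp: sq_def intro!: sum.neutral)
  also have "cofactor ?B t t = det (mat_delete ?B t t)"
    by (simp add: cofactor_def flip: power_mult_distrib)
  also have "mat_delete ?B t t = sq t A"
    by (intro eq_matI) (auto simp: sq_def mat_delete_def)
  finally show ?thesis .
qed

text \<open>The bound 3 is the one of \<open>coef_bounds\<close>: the three added coordinates of a
  row may coincide.\<close>

lemma sq_int_bound:
  assumes "\<And>i j. i < t \<Longrightarrow> j < t \<Longrightarrow> A i j \<in> \<int> \<and> \<bar>A i j\<bar> \<le> 3"
  shows "det (sq t A) \<in> \<int>" "\<bar>det (sq t A)\<bar> \<le> fact t * 3 ^ t"
  using assms by (auto intro!: det_Ints det_abs_le simp: sq_def)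

text \<open>
  Fraction-free elimination: \<open>h r\<close> (for \<open>t \<le> r < N\<close>) is a basis of the directions that keep the
  tight rows \<open>\<mu> 0, \<dots>, \<mu> (t - 1)\<close> tight, normalised by \<open>h r r = D\<close>, where \<open>D\<close> is the absolute
  value of the determinant of these rows on the coordinates below \<open>t\<close>. By Cramer's rule this
  normalisation makes all entries integral.
\<close>

definition elim_inv ::
  "nat \<Rightarrow> (nat \<Rightarrow> nat \<Rightarrow> real) \<Rightarrow> nat \<Rightarrow> (nat \<Rightarrow> nat) \<Rightarrow> real \<Rightarrow> (nat \<Rightarrow> nat \<Rightarrow> real) \<Rightarrow> bool" where
  "elim_inv N A t \<mu> D h \<longleftrightarrow>
     0 < D \<and> D = \<bar>det (sq t (\<lambda>i. A (\<mu> i)))\<bar> \<and>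
     (\<forall>r. t \<le> r \<longrightarrow> r < N \<longrightarrow> h r r = D \<and> (\<forall>k. t \<le> k \<longrightarrow> k < N \<longrightarrow> k \<noteq> r \<longrightarrow> h r k = 0) \<and>
        (\<forall>i<t. (\<Sum>k<N. A (\<mu> i) k * h r k) = 0))"

lemma sum_split_off:
  assumes "(t::nat) \<le> r" "r < N" "\<And>k. t \<le> k \<Longrightarrow> k < N \<Longrightarrow> k \<noteq> r \<Longrightarrow> z k = 0"
  shows "(\<Sum>k<N. a k * z k) = (\<Sum>k<t. a k * z k) + a r * (z r :: real)"
proof -
  have "a k * z k = 0" if "k \<in> {..<N} - insert r {..<t}" for k
  proof -
    have "t \<le> k" "k < N" "k \<noteq> r" using that by auto
    then show ?thesis using assms(3) by simp
  qed
  then have "(\<Sum>k<N. a k * z k) = (\<Sum>k\<in>insert r {..<t}. a k * z k)"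
    using assms(1,2) by (intro sum.mono_neutral_right) auto
  then show ?thesis using assms(1) by simp
qed

lemma fact_pow_mono: "t \<le> N \<Longrightarrow> fact t * 3 ^ t \<le> (fact N * 3 ^ N :: real)"
  by (intro mult_mono fact_mono power_increasing) auto

text \<open>The coordinates of \<open>h r / D\<close> below \<open>t\<close> solve the system of the
  tight rows with column \<open>r\<close> moved to the right-hand side. By Cramer's rule each is a
  quotient of an integral determinant by one of absolute value \<open>D\<close>, so multiplying by
  \<open>D\<close> leaves a determinant up to sign.\<close>

lemma elim_int:
  assumes inv: "elim_inv N A t \<mu> D h"
    and A: "\<And>i k. i < t \<Longrightarrow> k < N \<Longrightarrow> A (\<mu> i) k \<in> \<int> \<and> \<bar>A (\<mu> i) k\<bar> \<le> 3"
    and r: "t \<le> r" "r < N" and k: "k < N"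
  shows "h r k \<in> \<int>" "\<bar>h r k\<bar> \<le> fact N * 3 ^ N"
proof -
  let ?M = "\<lambda>i. A (\<mu> i)"
  have D: "0 < D" "D = \<bar>det (sq t ?M)\<bar>" and hr: "h r r = D"
    "\<And>k. t \<le> k \<Longrightarrow> k < N \<Longrightarrow> k \<noteq> r \<Longrightarrow> h r k = 0" "\<And>i. i < t \<Longrightarrow> (\<Sum>k<N. ?M i k * h r k) = 0"
    using inv r unfolding elim_inv_def by blast+
  have tN: "t \<le> N" using r by simp
  have Dint: "det (sq t ?M) \<in> \<int>" and Db: "\<bar>det (sq t ?M)\<bar> \<le> fact t * 3 ^ t"
    using sq_int_bound[of t ?M] A tN by auto
  have "h r k \<in> \<int> \<and> \<bar>h r k\<bar> \<le> fact t * 3 ^ t"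
  proof (cases "k < t")
    case True
    \<comment> \<open>Among the coordinates from \<open>t\<close> on, \<open>h r\<close> is nonzero
      only at \<open>r\<close>, with value \<open>D\<close>; dividing the tightness equation by
      \<open>D\<close> leaves a square system.\<close>
    have "(\<Sum>j<t. ?M i j * (h r j / D)) = - ?M i r" if "i < t" for i
    proof -
      have "(\<Sum>j<t. ?M i j * h r j) + ?M i r * D = 0"
        using hr(3)[OF that] sum_split_off[where a = "?M i" and z = "h r", OF r hr(2)] hr(1) by simp
      then have "(\<Sum>j<t. ?M i j * h r j) / D = - ?M i r"
        using D(1) by (simp add: field_simps)
      then show ?thesis by (simp add: sum_divide_distrib)
    qed
    from cramer[where A = ?M and t = t and k = k, OF this True]
    have eq: "det (sq t (\<lambda>i j. if j = k then - ?M i r else ?M i j)) = h r k / D * det (sq t ?M)" .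
    have "\<bar>h r k / D * det (sq t ?M)\<bar> = \<bar>h r k\<bar>"
      using D by (simp add: abs_mult)
    moreover have "h r k = h r k / D * det (sq t ?M) \<or> h r k = - (h r k / D * det (sq t ?M))"
      using D by (cases "det (sq t ?M) < 0") auto
    moreover have "det (sq t (\<lambda>i j. if j = k then - ?M i r else ?M i j)) \<in> \<int>"
      "\<bar>det (sq t (\<lambda>i j. if j = k then - ?M i r else ?M i j))\<bar> \<le> fact t * 3 ^ t"
      by (rule sq_int_bound; use A r tN in auto)+
    ultimately show ?thesis
      unfolding eq by (metis Ints_minus)
  next
    case False
    then have "h r k = 0 \<or> h r k = D"
      using hr k by (metis not_le)
    then show ?thesis
      using D Dint Db by (auto simp: abs_if)
  qed
  with fact_pow_mono[OF tN] show "h r k \<in> \<int>" "\<bar>h r k\<bar> \<le> fact N * 3 ^ N"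
    by auto
qed

lemma elim_init:
  "elim_inv N A 0 \<mu> 1 (\<lambda>r k. if k = r then 1 else 0)"
  by (auto simp: elim_inv_def sq_def det_dim_zero)

text \<open>This is Bareiss' update. It subtracts the right multiple of the pivot direction
  \<open>g\<close> so that the new row \<open>m\<close> vanishes on \<open>h' r\<close>; since
  \<open>\<bar>p\<bar>\<close> is again the absolute value of the determinant of the tight rows, the
  normalisation is restored, and with it the integrality of \<open>elim_int\<close> in spite of the
  division by \<open>D\<close>.\<close>

lemma elim_step:
  assumes inv: "elim_inv N A t \<mu> D h" and t: "t < N"
    and s: "s = 1 \<or> s = -1" and g: "g = (\<lambda>k. s * h t k)"
    and p: "p = (\<Sum>k<N. A m k * g k)" "p < 0"
    and h': "\<And>r k. t < r \<Longrightarrow> r < N \<Longrightarrow> k < N \<Longrightarrow>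
       h' r k = (\<bar>p\<bar> * h r k + (\<Sum>k<N. A m k * h r k) * g k) / D"
  shows "elim_inv N A (Suc t) (\<mu>(t := m)) \<bar>p\<bar> h'"
proof -
  let ?M = "\<lambda>i. A (\<mu> i)" and ?M' = "\<lambda>i. A ((\<mu>(t := m)) i)"
  have D: "0 < D" "D = \<bar>det (sq t ?M)\<bar>" and hr: "\<And>r. t \<le> r \<Longrightarrow> r < N \<Longrightarrow> h r r = D"
    "\<And>r k. t \<le> r \<Longrightarrow> r < N \<Longrightarrow> t \<le> k \<Longrightarrow> k < N \<Longrightarrow> k \<noteq> r \<Longrightarrow> h r k = 0"
    "\<And>r i. t \<le> r \<Longrightarrow> r < N \<Longrightarrow> i < t \<Longrightarrow> (\<Sum>k<N. ?M i k * h r k) = 0"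
    using inv unfolding elim_inv_def by blast+
  have g0: "(\<Sum>k<N. ?M i k * g k) = 0" if "i < t" for i
    using hr(3)[of t i] t that s by (auto simp: g sum_negf)
  have gk: "g k = 0" if "t < k" "k < N" for k
    using hr(2)[of t k] t that by (simp add: g)
  have split: "(\<Sum>k<N. a k * g k) = (\<Sum>j<Suc t. a j * g j)" for a
    using sum_split_off[where a = a and z = g and t = t and r = t and N = N] t gk by simp
  \<comment> \<open>Cramer's rule applied to \<open>g\<close> itself: its coordinates up to
    \<open>t\<close> solve the extended system whose right-hand side is \<open>p\<close> in the last
    row and 0 elsewhere.\<close>
  have "det (sq (Suc t) (\<lambda>i j. if j = t then (if i = t then p else 0) else ?M' i j)) = g t * det (sq (Suc t) ?M')"
  proof (rule cramer)
    show "(\<Sum>j<Suc t. ?M' i j * g j) = (if i = t then p else 0)" if "i < Suc t" for i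
      using that g0[of i] p(1) split[of "?M' i"] by (cases "i = t") auto
  qed simp
  moreover have "sq t ?M' = sq t ?M" by (auto simp: sq_def intro!: eq_matI)
  ultimately have "p * det (sq t ?M) = g t * det (sq (Suc t) ?M')"
    by (simp only: det_sq_last_col)
  then have "\<bar>p\<bar> * D = D * \<bar>det (sq (Suc t) ?M')\<bar>"
    using D s hr(1)[of t] t by (metis abs_mult abs_minus_cancel abs_of_pos g le_refl mult_1 mult_minus1)
  then have p': "\<bar>p\<bar> = \<bar>det (sq (Suc t) ?M')\<bar>"
    using D(1) by simp
  show ?thesis
    unfolding elim_inv_def
  proof (intro conjI allI impI)
    show "0 < \<bar>p\<bar>" "\<bar>p\<bar> = \<bar>det (sq (Suc t) ?M')\<bar>" using p p' by auto
    fix r assume r: "Suc t \<le> r" "r < N"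
    have h'r: "h' r k = (\<bar>p\<bar> * h r k + (\<Sum>k<N. A m k * h r k) * g k) / D" if "k < N" for k
      using h' r that by simp
    show "h' r r = \<bar>p\<bar>" using hr(1)[of r] r gk[of r] D(1) h'r[of r] by simp
    show "h' r k = 0" if "Suc t \<le> k" "k < N" "k \<noteq> r" for k
      using h'r[of k] that hr(2)[of r k] r gk[of k] by simp
    fix i assume i: "i < Suc t"
    have "(\<Sum>k<N. ?M' i k * h' r k) = (\<Sum>k<N. (\<bar>p\<bar> * (?M' i k * h r k) + (\<Sum>k<N. A m k * h r k) * (?M' i k * g k)) / D)"
      using h'r by (intro sum.cong) (auto simp: algebra_simps add_divide_distrib)
    also have "\<dots> = (\<bar>p\<bar> * (\<Sum>k<N. ?M' i k * h r k) + (\<Sum>k<N. A m k * h r k) * (\<Sum>k<N. ?M' i k * g k)) / D"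
      by (simp add: sum_divide_distrib[symmetric] sum.distrib sum_distrib_left)
    \<comment> \<open>On the new row \<open>m\<close> the two terms cancel because
      \<open>p < 0\<close>, that is \<open>\<bar>p\<bar> = - p\<close>; on the old rows both sums
      vanish.\<close>
    also have "\<dots> = 0"
      using hr(3)[of r i] g0[of i] p r i by (cases "i = t") auto
    finally show "(\<Sum>k<N. ?M' i k * h' r k) = 0" .
  qed
qed

text \<open>With as many tight rows as coordinates, \<open>y\<close> is the solution of a
  nonsingular integral system, and Cramer's rule makes \<open>D\<close> a common
  denominator.\<close>

lemma elim_final:
  assumes inv: "elim_inv N A N \<mu> D h"
    and A: "\<And>i k. i < N \<Longrightarrow> k < N \<Longrightarrow> A (\<mu> i) k \<in> \<int> \<and> \<bar>A (\<mu> i) k\<bar> \<le> 3"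
    and b: "\<And>i. i < N \<Longrightarrow> b (\<mu> i) \<in> \<int>" and eq: "\<And>i. i < N \<Longrightarrow> (\<Sum>k<N. A (\<mu> i) k * y k) = b (\<mu> i)"
    and k: "k < N"
  shows "D * y k \<in> \<int>"
proof -
  let ?M = "\<lambda>i. A (\<mu> i)"
  have D: "D = \<bar>det (sq N ?M)\<bar>"
    using inv unfolding elim_inv_def by blast
  have "det (sq N (\<lambda>i j. if j = k then b (\<mu> i) else ?M i j)) \<in> \<int>"
    using A b by (intro det_Ints) (auto simp: sq_def)
  then have "y k * det (sq N ?M) \<in> \<int>"
    using cramer[where A = ?M and x = y and c = "\<lambda>i. b (\<mu> i)", OF eq k] by simp
  then show ?thesis
    unfolding D by (cases "det (sq N ?M) < 0") (auto simp: mult.commute)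
qed

lemma elim_D_bound:
  assumes inv: "elim_inv N A t \<mu> D h" and t: "t \<le> N"
    and A: "\<And>i k. i < t \<Longrightarrow> k < N \<Longrightarrow> A (\<mu> i) k \<in> \<int> \<and> \<bar>A (\<mu> i) k\<bar> \<le> 3"
  shows "0 < D" "D \<in> \<int>" "D \<le> fact N * 3 ^ N"
proof -
  have D: "0 < D" "D = \<bar>det (sq t (\<lambda>i. A (\<mu> i)))\<bar>"
    using inv unfolding elim_inv_def by blast+
  moreover have "det (sq t (\<lambda>i. A (\<mu> i))) \<in> \<int>" "\<bar>det (sq t (\<lambda>i. A (\<mu> i)))\<bar> \<le> fact t * 3 ^ t"
    using A t by (auto intro!: sq_int_bound)
  ultimately show "0 < D" "D \<in> \<int>" "D \<le> fact N * 3 ^ N"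
    using fact_pow_mono[OF t] by (auto simp: abs_if)
qed

section \<open>Moving to a vertex\<close>

definition lin :: "memory \<Rightarrow> nat \<Rightarrow> (nat \<Rightarrow> real) \<Rightarrow> real" where
  "lin s m z = z (fst s 4 0 m) + z (fst s 4 2 m) + z (fst s 4 3 m) - z (fst s 4 4 m)"

definition coef :: "memory \<Rightarrow> nat \<Rightarrow> nat \<Rightarrow> real" where
  "coef s m k = of_bool (k = fst s 4 0 m) + of_bool (k = fst s 4 2 m) + of_bool (k = fst s 4 3 m)
     - of_bool (k = fst s 4 4 m)"

definition rhs :: "memory \<Rightarrow> nat \<Rightarrow> real" where
  "rhs s m = snd s 4 0 m"

definition row_exp :: "nat \<Rightarrow> nexp \<Rightarrow> nexp \<Rightarrow> rexp" where
  "row_exp a r m =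
     RSub (RAdd (RAdd (RCell a r (NCell 4 (NConst 0) m)) (RCell a r (NCell 4 (NConst 2) m)))
       (RCell a r (NCell 4 (NConst 3) m))) (RCell a r (NCell 4 (NConst 4) m))"

lemma rval_row_exp [simp]: "rval (row_exp a r m) s = lin s (nval m s) (snd s a (nval r s))"
  by (simp add: row_exp_def lin_def)

lemma lin_cong: "fst s' 4 = fst s 4 \<Longrightarrow> lin s' = lin s"
  by (simp add: lin_def fun_eq_iff)

lemma lin_lincomb: "lin s m (\<lambda>k. x * z k + y * z' k) = x * lin s m z + y * lin s m z'"
  by (simp add: lin_def algebra_simps)

lemma coef_bounds: "coef s m k \<in> \<int>" "\<bar>coef s m k\<bar> \<le> 3"
  by (auto simp: coef_def of_bool_def)

lemma sum_delta_lt: "z N = 0 \<Longrightarrow> (a::nat) \<le> N \<Longrightarrow> (\<Sum>k<N. of_bool (k = a) * z k) = (z a :: real)"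
proof -
  assume z: "z N = 0" "a \<le> N"
  have "(\<Sum>k<N. of_bool (k = a) * z k) = (\<Sum>k<N. if k = a then z a else 0)"
    by (intro sum.cong) auto
  then show ?thesis using z by (cases "a = N") simp_all
qed

lemma sum_coef:
  assumes "z N = 0" "fst s 4 0 m \<le> N" "fst s 4 2 m \<le> N" "fst s 4 3 m \<le> N" "fst s 4 4 m \<le> N"
  shows "(\<Sum>k<N. coef s m k * z k) = lin s m z"
  using assms unfolding coef_def lin_def
  by (simp only: ring_distribs sum.distrib sum_subtractf sum_delta_lt)

lemma lin_int_bound:
  assumes "\<And>k. k < N \<Longrightarrow> z k \<in> \<int> \<and> \<bar>z k\<bar> \<le> b" "z N = 0" "0 \<le> b"
    "fst s 4 0 m \<le> N" "fst s 4 2 m \<le> N" "fst s 4 3 m \<le> N" "fst s 4 4 m \<le> N"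
  shows "lin s m z \<in> \<int>" "\<bar>lin s m z\<bar> \<le> 4 * b"
proof -
  have "z k \<in> \<int>" "\<bar>z k\<bar> \<le> b" if "k \<le> N" for k
    using assms(1)[of k] assms(2,3) that by (cases "k = N"; simp)+
  then have "z (fst s 4 0 m) \<in> \<int>" "z (fst s 4 2 m) \<in> \<int>" "z (fst s 4 3 m) \<in> \<int>" "z (fst s 4 4 m) \<in> \<int>"
    "\<bar>z (fst s 4 0 m)\<bar> \<le> b" "\<bar>z (fst s 4 2 m)\<bar> \<le> b" "\<bar>z (fst s 4 3 m)\<bar> \<le> b" "\<bar>z (fst s 4 4 m)\<bar> \<le> b"
    using assms(4-7) by blast+
  then show "lin s m z \<in> \<int>" "\<bar>lin s m z\<bar> \<le> 4 * b"
    unfolding lin_def by (simp, linarith)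
qed

text \<open>The factor 4 is for the four summands of a row. With
  \<open>fact N \<le> 2 ^ (N * N)\<close> and \<open>3 ^ N \<le> 2 ^ (2 * N)\<close> the exponent
  needed is \<open>2 + N * N + 2 * N\<close>, which for positive \<open>N\<close> is less than
  \<open>2 * (Suc N * Suc N)\<close>.\<close>

lemma entry_bound_pow:
  assumes "0 < N"
  shows "4 * (fact N * 3 ^ N) < (2 :: real) ^ (2 * (Suc N * Suc N))"
proof -
  have "(fact N :: real) \<le> real N ^ N" using fact_le_power[of N, where ?'a = real] by simp
  also have "\<dots> \<le> (2 ^ N) ^ N"
    by (intro power_mono) (auto simp: less_imp_le of_nat_less_two_power)
  finally have f: "(fact N :: real) \<le> 2 ^ (N * N)" by (simp add: power_mult)
  have "(3 :: real) ^ N \<le> 4 ^ N" by (intro power_mono) auto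
  also have "(4 :: real) ^ N = 2 ^ (2 * N)" by (simp add: power_mult)
  finally have "4 * (fact N * 3 ^ N) \<le> 4 * (2 ^ (N * N) * (2 :: real) ^ (2 * N))"
    using f by (intro mult_left_mono mult_mono) auto
  also have "\<dots> = 2 ^ (2 + N * N + 2 * N)" by (simp add: power_add)
  also have "\<dots> < 2 ^ (2 * (Suc N * Suc N))"
    using assms by (intro power_strict_increasing) auto
  finally show ?thesis .
qed

definition conv_ready :: "nat \<Rightarrow> memory \<Rightarrow> bool" where
  "conv_ready B s \<longleftrightarrow> power_table s \<and> fst s 17 0 0 \<le> B"

lemma conv_ready_frame:
  "conv_ready B s \<Longrightarrow> fst s' 5 = fst s 5 \<Longrightarrow> fst s' 17 = fst s 17 \<Longrightarrow> conv_ready B s'"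
  by (simp add: conv_ready_def power_table_def)

lemma runs_conv_factor:
  assumes r: "conv_ready B s" and z: "rval x s = z" "z \<in> \<int>" "\<bar>z\<bar> < 2 ^ fst s 17 0 0"
    and Q: "\<And>s'. frame (conv x) s s' \<Longrightarrow> real (fst s' 18 0 0) = max 0 z \<Longrightarrow> real (fst s' 20 0 0) = max 0 (- z) \<Longrightarrow>
       (\<And>y. real (fst s' 18 0 0) * y - real (fst s' 20 0 0) * y = z * y) \<Longrightarrow> Q s'"
  shows "runs B (conv x) s Q"
proof (rule runs_conseq[OF runs_conv])
  show "fst s 17 0 0 \<le> B" "power_table s" using r by (simp_all add: conv_ready_def)
  show "rval x s = z" "z \<in> \<int>" "\<bar>z\<bar> < 2 ^ fst s 17 0 0" by (fact z)+
  fix s' assume f: "frame (conv x) s s'" and v: "real (fst s' 18 0 0) = max 0 z \<and> real (fst s' 20 0 0) = max 0 (- z)"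
  have "real (fst s' 18 0 0) * y - real (fst s' 20 0 0) * y = z * y" for y
    using v by (simp add: max_def)
  then show "Q s'" using Q[OF f] v by simp
qed

section \<open>Orientation, ratio test, move and elimination\<close>

definition direction_cost :: com where
  "direction_cost =
     Seq (RSet 20 (RNat (NConst 0)))
       (For 24 14
         (Seq (conv (RCell 5 (NVar 23) (NVar 24)))
              (RSet 20 (RAdd (RVar 20)
                (RSub (RScale (NVar 18) (RCell 6 (NConst 0) (NVar 24)))
                      (RScale (NVar 20) (RCell 6 (NConst 0) (NVar 24))))))))"

lemma mods_direction_cost [simp]:
  "nmods direction_cost = {18, 19, 20, 21, 24}" "rmods direction_cost = {10, 11, 20}"
  by (auto simp: direction_cost_def)

definition entries_ok :: "nat \<Rightarrow> memory \<Rightarrow> (nat \<Rightarrow> real) \<Rightarrow> bool" where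
  "entries_ok N s z \<longleftrightarrow> (\<forall>k<N. z k \<in> \<int> \<and> \<bar>z k\<bar> < 2 ^ fst s 17 0 0)"

lemma runs_direction_cost:
  assumes t: "fst s 23 0 0 = t" and N: "fst s 14 0 0 = N" "N \<le> B" and r: "conv_ready B s"
    and e: "entries_ok N s (snd s 5 t)"
  shows "runs B direction_cost s (\<lambda>s'. snd s' 20 0 0 = (\<Sum>k<N. snd s 5 t k * snd s 6 0 k))"
proof -
  let ?a = "RSet 20 (RAdd (RVar 20)
                (RSub (RScale (NVar 18) (RCell 6 (NConst 0) (NVar 24)))
                      (RScale (NVar 20) (RCell 6 (NConst 0) (NVar 24)))))"
  let ?I = "\<lambda>l s'. snd s' 20 0 0 = (\<Sum>k<l. snd s 5 t k * snd s 6 0 k)"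
  have loop: "runs B (For 24 14
         (Seq (conv (RCell 5 (NVar 23) (NVar 24)))
              ?a)) (rset 20 0 s) (?I N)"
  proof (rule runs_For[where I = ?I and n = N], goal_cases)
    case (1 k s')
    have fr: "fst s' 23 0 0 = t" "fst s' 5 = fst s 5" "fst s' 17 = fst s 17" "snd s' 5 = snd s 5" "snd s' 6 = snd s 6"
      using 1(2) t by (simp_all add: frame_def)
    have z: "snd s 5 t k \<in> \<int>" "\<bar>snd s 5 t k\<bar> < 2 ^ fst s 17 0 0"
      using e 1(1) by (simp_all add: entries_ok_def)
    show ?case
    proof (rule runs_then, rule runs_conv_factor[where z = "snd s 5 t k"])
      show "conv_ready B s'" using conv_ready_frame[OF r fr(2,3)] .
      show "rval (RCell 5 (NVar 23) (NVar 24)) s' = snd s 5 t k" using fr 1(3) by simp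
      show "snd s 5 t k \<in> \<int>" "\<bar>snd s 5 t k\<bar> < 2 ^ fst s' 17 0 0" using z fr by simp_all
      fix s2 assume f: "frame (conv (RCell 5 (NVar 23) (NVar 24))) s' s2"
        and p: "\<And>y. real (fst s2 18 0 0) * y - real (fst s2 20 0 0) * y = snd s 5 t k * y"
      have "fst s2 24 0 0 = k" "snd s2 6 = snd s 6" "snd s2 20 = snd s' 20"
        using f 1(3) fr by (simp_all add: frame_def)
      then show "runs B ?a s2
            (\<lambda>s''. ?I (Suc k) (nset 24 (Suc k) s''))"
        by (intro runs_RAssign) (simp add: p 1(4))
    qed
  qed (use N in simp_all)
  show ?thesis
    unfolding direction_cost_def by (rule runs_then, rule runs_RAssign) (use loop in simp)
qed

definition flip :: com where
  "flip = Cond (RLess (RNat (NConst 0)) (RVar 20))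
     (For 24 14 (RAssign 5 (NVar 23) (NVar 24) (RSub (RNat (NConst 0)) (RCell 5 (NVar 23) (NVar 24))))) Skip"

lemma mods_flip [simp]: "nmods flip = {24}" "rmods flip = {5}"
  by (auto simp: flip_def)

lemma runs_flip:
  assumes t: "fst s 23 0 0 = t" and N: "fst s 14 0 0 = N" "N \<le> B"
  shows "runs B flip s (\<lambda>s'. \<exists>\<sigma>. (\<sigma> = 1 \<or> \<sigma> = -1) \<and> \<sigma> * snd s 20 0 0 \<le> 0 \<and>
     snd s' 5 = (snd s 5)(t := (\<lambda>k. if k < N then \<sigma> * snd s 5 t k else snd s 5 t k)))"
  unfolding flip_def
proof (rule runs_Cond)
  assume c: "bval (RLess (RNat (NConst 0)) (RVar 20)) s"
  let ?I = "\<lambda>l s'. snd s' 5 = (snd s 5)(t := (\<lambda>k. if k < l then - snd s 5 t k else snd s 5 t k))"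
  have "runs B (For 24 14 (RAssign 5 (NVar 23) (NVar 24) (RSub (RNat (NConst 0)) (RCell 5 (NVar 23) (NVar 24))))) s (?I N)"
  proof (rule runs_For[where I = ?I and n = N], goal_cases)
    case (1 k s')
    have fr: "fst s' 23 0 0 = t"
      using 1(2) t by (simp_all add: frame_def)
    show ?case
      by (rule runs_RAssign) (simp add: fr 1(3,4) put_upd2, auto simp: upd2_def fun_eq_iff)
  qed (use N in simp_all)
  then show "runs B (For 24 14 (RAssign 5 (NVar 23) (NVar 24) (RSub (RNat (NConst 0)) (RCell 5 (NVar 23) (NVar 24))))) s
     (\<lambda>s'. \<exists>\<sigma>. (\<sigma> = 1 \<or> \<sigma> = -1) \<and> \<sigma> * snd s 20 0 0 \<le> 0 \<and>
     snd s' 5 = (snd s 5)(t := (\<lambda>k. if k < N then \<sigma> * snd s 5 t k else snd s 5 t k)))"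
    by (rule runs_conseq) (rule exI[of _ "-1"], use c in \<open>simp add: fun_eq_iff\<close>)
next
  assume c: "\<not> bval (RLess (RNat (NConst 0)) (RVar 20)) s"
  then show "runs B Skip s (\<lambda>s'. \<exists>\<sigma>. (\<sigma> = 1 \<or> \<sigma> = -1) \<and> \<sigma> * snd s 20 0 0 \<le> 0 \<and>
     snd s' 5 = (snd s 5)(t := (\<lambda>k. if k < N then \<sigma> * snd s 5 t k else snd s 5 t k)))"
    by (intro runs_Skip exI[of _ 1]) (auto simp: fun_eq_iff)
qed

text \<open>Scalar 25 records whether a ratio has been found and so replaces an infinite initial
  value. For a negative \<open>a m\<close>, \<open>conv\<close> leaves \<open>- a m\<close> in
  natural scalar 20, where it can be used as a divisor.\<close>

definition ratio_test :: com where
  "ratio_test =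
     Seq (NSet 25 (NConst 0))
       (For 27 16
         (Seq (RSet 22 (row_exp 5 (NVar 23) (NVar 27)))
         (Cond (RLess (RVar 22) (RNat (NConst 0)))
           (Seq (conv (RVar 22))
           (Seq (RSet 23 (RQuot (RSub (row_exp 3 (NConst 0) (NVar 27)) (RCell 4 (NConst 0) (NVar 27))) (NVar 20)))
           (Cond (BAnd (NLess (NConst 0) (NVar 25)) (BNot (RLess (RVar 23) (RVar 21))))
              Skip
              (Seq (NSet 25 (NConst 1)) (Seq (RSet 21 (RVar 23)) (NSet 26 (NVar 27)))))))
           Skip)))"

lemma mods_ratio_test [simp]:
  "nmods ratio_test = {18, 19, 20, 21, 25, 26, 27}" "rmods ratio_test = {10, 11, 21, 22, 23}"
  by (auto simp: ratio_test_def)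

definition best_ratio :: "nat \<Rightarrow> (nat \<Rightarrow> real) \<Rightarrow> (nat \<Rightarrow> real) \<Rightarrow> nat \<Rightarrow> real \<Rightarrow> bool" where
  "best_ratio l a b m \<tau> \<longleftrightarrow> m < l \<and> a m < 0 \<and> \<tau> = b m / - a m \<and> (\<forall>m'<l. a m' < 0 \<longrightarrow> \<tau> \<le> b m' / - a m')"

lemma runs_ratio_test:
  assumes t: "fst s 23 0 0 = t" and M: "fst s 16 0 0 = M" "M \<le> B" and r: "conv_ready B s"
    and a: "\<And>m. m < M \<Longrightarrow> a m = lin s m (snd s 5 t)" "\<And>m. m < M \<Longrightarrow> a m \<in> \<int> \<and> \<bar>a m\<bar> < 2 ^ fst s 17 0 0"
    and b: "\<And>m. m < M \<Longrightarrow> b m = lin s m (snd s 3 0) - rhs s m"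
    and ex: "\<exists>m<M. a m < 0"
  shows "runs B ratio_test s (\<lambda>s'. best_ratio M a b (fst s' 26 0 0) (snd s' 21 0 0))"
proof -
  let ?I = "\<lambda>l s'. (fst s' 25 0 0 = 0 \<and> (\<forall>m<l. 0 \<le> a m)) \<or>
     (0 < fst s' 25 0 0 \<and> best_ratio l a b (fst s' 26 0 0) (snd s' 21 0 0))"
  let ?b = "BAnd (NLess (NConst 0) (NVar 25)) (BNot (RLess (RVar 23) (RVar 21)))"
  let ?q = "RQuot (RSub (row_exp 3 (NConst 0) (NVar 27)) (RCell 4 (NConst 0) (NVar 27))) (NVar 20)"
  let ?upd = "Cond ?b
              Skip
              (Seq (NSet 25 (NConst 1)) (Seq (RSet 21 (RVar 23)) (NSet 26 (NVar 27))))"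
  let ?c = "Seq (RSet 22 (row_exp 5 (NVar 23) (NVar 27)))
         (Cond (RLess (RVar 22) (RNat (NConst 0)))
           (Seq (conv (RVar 22))
           (Seq (RSet 23 ?q)
           ?upd)) Skip)"
  have loop: "runs B (For 27 16 ?c) (nset 25 0 s) (?I M)"
  proof (rule runs_For[where I = ?I and n = M], goal_cases)
    case (1 k s')
    have fr: "fst s' 23 0 0 = t" "fst s' 5 = fst s 5" "fst s' 17 = fst s 17" "fst s' 4 = fst s 4"
      "snd s' 5 = snd s 5" "snd s' 3 = snd s 3" "snd s' 4 = snd s 4"
      using 1(2) t by (simp_all add: frame_def)
    have I: "?I k s'" by (fact 1(4))
    have va: "rval (row_exp 5 (NVar 23) (NVar 27)) s' = a k"
      using fr 1(1,3) a(1) by (simp add: lin_def)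
    let ?s1 = "rset 22 (a k) s'"
    have "runs B (Cond (RLess (RVar 22) (RNat (NConst 0)))
           (Seq (conv (RVar 22))
           (Seq (RSet 23 ?q)
           ?upd)) Skip) ?s1 (\<lambda>s''. ?I (Suc k) (nset 27 (Suc k) s''))"
    proof (rule runs_Cond)
      assume "\<not> bval (RLess (RVar 22) (RNat (NConst 0))) ?s1"
      then have "0 \<le> a k" by simp
      then show "runs B Skip ?s1 (\<lambda>s''. ?I (Suc k) (nset 27 (Suc k) s''))"
        using I by (intro runs_Skip) (auto simp: less_Suc_eq best_ratio_def)
    next
      assume "bval (RLess (RVar 22) (RNat (NConst 0))) ?s1"
      then have neg: "a k < 0" by simp
      show "runs B (Seq (conv (RVar 22))
           (Seq (RSet 23 ?q)
           ?upd)) ?s1 (\<lambda>s''. ?I (Suc k) (nset 27 (Suc k) s''))"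
      proof (rule runs_then, rule runs_conv_factor[where z = "a k"])
        show "conv_ready B ?s1" using conv_ready_frame[OF r] fr by simp
        show "rval (RVar 22) ?s1 = a k" by simp
        show "a k \<in> \<int>" "\<bar>a k\<bar> < 2 ^ fst ?s1 17 0 0" using a(2) 1(1) fr by simp_all
        fix s2 assume f: "frame (conv (RVar 22)) ?s1 s2" and "real (fst s2 20 0 0) = max 0 (- a k)"
        then have v: "real (fst s2 20 0 0) = - a k" using neg by simp
        have fr2: "fst s2 27 0 0 = k" "fst s2 4 = fst s 4" "snd s2 3 = snd s 3" "snd s2 4 = snd s 4"
          "fst s2 25 = fst s' 25" "fst s2 26 = fst s' 26" "snd s2 21 = snd s' 21"
          using f fr 1(3) by (simp_all add: frame_def)
        have q: "rval ?q s2 = b k / - a k"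
          using fr2 b[OF 1(1)] v by (simp add: lin_def rhs_def)
        let ?s3 = "rset 23 (b k / - a k) s2"
        have "runs B ?upd ?s3 (\<lambda>s''. ?I (Suc k) (nset 27 (Suc k) s''))"
        proof (rule runs_Cond)
          assume "bval ?b ?s3"
          then have "0 < fst s' 25 0 0" "snd s' 21 0 0 \<le> b k / - a k" using fr2 by simp_all
          then have "?I (Suc k) (nset 27 (Suc k) ?s3)"
            using I fr2 by (auto simp: less_Suc_eq best_ratio_def)
          then show "runs B Skip ?s3 (\<lambda>s''. ?I (Suc k) (nset 27 (Suc k) s''))"
            by (rule runs_Skip)
        next
          assume "\<not> bval ?b ?s3"
          then have c: "fst s' 25 0 0 = 0 \<or> b k / - a k < snd s' 21 0 0" using fr2 by auto
          have "best_ratio (Suc k) a b k (b k / - a k)"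
            unfolding best_ratio_def
          proof (intro conjI allI impI)
            fix m' assume m': "m' < Suc k" "a m' < 0"
            show "b k / - a k \<le> b m' / - a m'"
            proof (cases "m' = k")
              case False
              then have "m' < k" using m'(1) by simp
              then have "0 < fst s' 25 0 0 \<and> snd s' 21 0 0 \<le> b m' / - a m'"
                using I m'(2) unfolding best_ratio_def by (metis not_le)
              then show ?thesis using c by auto
            qed simp
          qed (use neg in simp_all)
          then show "runs B (Seq (NSet 25 (NConst 1)) (Seq (RSet 21 (RVar 23)) (NSet 26 (NVar 27)))) ?s3
              (\<lambda>s''. ?I (Suc k) (nset 27 (Suc k) s''))"
            by (intro runs_then[OF runs_NAssign] runs_then[OF runs_RAssign] runs_NAssign) (simp add: fr2)
        qed
        then show "runs B (Seq (RSet 23 ?q)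
            ?upd) s2 (\<lambda>s''. ?I (Suc k) (nset 27 (Suc k) s''))"
          by (intro runs_then[OF runs_RAssign]) (simp only: q nval.simps)
      qed
    qed
    then show ?case
      by (intro runs_then[OF runs_RAssign]) (simp only: va nval.simps)
  qed (use M in simp_all)
  have loop': "runs B (For 27 16 ?c) (nset 25 0 s) (\<lambda>s'. best_ratio M a b (fst s' 26 0 0) (snd s' 21 0 0))"
    by (rule runs_conseq[OF loop]) (use ex in \<open>auto simp: not_less[symmetric]\<close>)
  then show ?thesis
    unfolding ratio_test_def by (intro runs_then[OF runs_NAssign]) simp
qed

definition move :: com where
  "move = For 24 14
     (Seq (conv (RCell 5 (NVar 23) (NVar 24)))
       (RAssign 3 (NConst 0) (NVar 24) (RAdd (RCell 3 (NConst 0) (NVar 24))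
          (RSub (RScale (NVar 18) (RVar 21)) (RScale (NVar 20) (RVar 21))))))"

lemma mods_move [simp]: "nmods move = {18, 19, 20, 21, 24}" "rmods move = {3, 10, 11}"
  by (auto simp: move_def)

lemma runs_move:
  assumes t: "fst s 23 0 0 = t" and N: "fst s 14 0 0 = N" "N \<le> B" and r: "conv_ready B s"
    and e: "entries_ok N s (snd s 5 t)"
  shows "runs B move s (\<lambda>s'. \<forall>k. snd s' 3 0 k =
     (if k < N then snd s 3 0 k + snd s 5 t k * snd s 21 0 0 else snd s 3 0 k))"
proof -
  let ?I = "\<lambda>l s'. \<forall>k. snd s' 3 0 k = (if k < l then snd s 3 0 k + snd s 5 t k * snd s 21 0 0 else snd s 3 0 k)"
  have "runs B move s (?I N)"
    unfolding move_def
  proof (rule runs_For[where I = ?I and n = N], goal_cases)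
    case (1 k s')
    have fr: "fst s' 23 0 0 = t" "fst s' 5 = fst s 5" "fst s' 17 = fst s 17" "snd s' 5 = snd s 5" "snd s' 21 = snd s 21"
      using 1(2) t by (simp_all add: frame_def)
    have z: "snd s 5 t k \<in> \<int>" "\<bar>snd s 5 t k\<bar> < 2 ^ fst s 17 0 0"
      using e 1(1) by (simp_all add: entries_ok_def)
    show ?case
    proof (rule runs_then, rule runs_conv_factor[where z = "snd s 5 t k"])
      show "conv_ready B s'" using conv_ready_frame[OF r fr(2,3)] .
      show "rval (RCell 5 (NVar 23) (NVar 24)) s' = snd s 5 t k" using fr 1(3) by simp
      show "snd s 5 t k \<in> \<int>" "\<bar>snd s 5 t k\<bar> < 2 ^ fst s' 17 0 0" using z fr by simp_all
      fix s2 assume f: "frame (conv (RCell 5 (NVar 23) (NVar 24))) s' s2"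
        and p: "\<And>y. real (fst s2 18 0 0) * y - real (fst s2 20 0 0) * y = snd s 5 t k * y"
      have fr2: "fst s2 24 0 0 = k" "snd s2 21 = snd s 21" "snd s2 3 = snd s' 3"
        using f 1(3) fr by (simp_all add: frame_def)
      show "runs B (RAssign 3 (NConst 0) (NVar 24) (RAdd (RCell 3 (NConst 0) (NVar 24))
          (RSub (RScale (NVar 18) (RVar 21)) (RScale (NVar 20) (RVar 21))))) s2
            (\<lambda>s''. ?I (Suc k) (nset 24 (Suc k) s''))"
        by (rule runs_RAssign) (simp add: fr2 p 1(4) less_Suc_eq)
    qed
  qed (use N in simp_all)
  then show ?thesis .
qed

text \<open>Direction \<open>t\<close> is only read, so updating the later directions in place is
  safe. The value of the blocking row on direction \<open>r\<close> is converted before any entry of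
  that direction is overwritten. The old determinant stays in scalar 22 as divisor until the end;
  the new one waits in scalar 28.\<close>

definition eliminate :: com where
  "eliminate =
     Seq (conv (row_exp 5 (NVar 23) (NVar 26)))
    (Seq (NSet 28 (NVar 20))
    (Seq (For 29 14
           (Cond (NLess (NVar 23) (NVar 29))
             (Seq (conv (row_exp 5 (NVar 29) (NVar 26)))
               (For 24 14
                 (RAssign 5 (NVar 29) (NVar 24)
                   (RQuot (RAdd (RScale (NVar 28) (RCell 5 (NVar 29) (NVar 24)))
                       (RSub (RScale (NVar 18) (RCell 5 (NVar 23) (NVar 24)))
                             (RScale (NVar 20) (RCell 5 (NVar 23) (NVar 24))))) (NVar 22)))))
             Skip))
         (NSet 22 (NVar 28))))"

lemma mods_eliminate [simp]:
  "nmods eliminate = {18, 19, 20, 21, 22, 24, 28, 29}" "rmods eliminate = {5, 10, 11}"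
  by (auto simp: eliminate_def)

lemma runs_eliminate:
  assumes t: "fst s 23 0 0 = t" and N: "fst s 14 0 0 = N" "N \<le> B" and r: "conv_ready B s"
    and m: "fst s 26 0 0 = m" and D: "real (fst s 22 0 0) = D"
    and p: "lin s m (snd s 5 t) = p" "p < 0"
    and a: "\<And>r. t \<le> r \<Longrightarrow> r < N \<Longrightarrow> lin s m (snd s 5 r) \<in> \<int> \<and> \<bar>lin s m (snd s 5 r)\<bar> < 2 ^ fst s 17 0 0"
    and tN: "t < N" and dummy: "fst s 4 0 m \<le> N" "fst s 4 2 m \<le> N" "fst s 4 3 m \<le> N" "fst s 4 4 m \<le> N"
  shows "runs B eliminate s (\<lambda>s'. real (fst s' 22 0 0) = \<bar>p\<bar> \<and>
     (\<forall>r k. snd s' 5 r k = (if t < r \<and> r < N \<and> k < N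
        then (\<bar>p\<bar> * snd s 5 r k + lin s m (snd s 5 r) * snd s 5 t k) / D else snd s 5 r k)))"
proof -
  let ?new = "\<lambda>r k. (\<bar>p\<bar> * snd s 5 r k + lin s m (snd s 5 r) * snd s 5 t k) / D"
  let ?I = "\<lambda>l s'. \<forall>r k. snd s' 5 r k = (if t < r \<and> r < l \<and> k < N then ?new r k else snd s 5 r k)"
  let ?asg = "RAssign 5 (NVar 29) (NVar 24)
                   (RQuot (RAdd (RScale (NVar 28) (RCell 5 (NVar 29) (NVar 24)))
                       (RSub (RScale (NVar 18) (RCell 5 (NVar 23) (NVar 24)))
                             (RScale (NVar 20) (RCell 5 (NVar 23) (NVar 24))))) (NVar 22))"
  let ?loop = "For 29 14
           (Cond (NLess (NVar 23) (NVar 29))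
             (Seq (conv (row_exp 5 (NVar 29) (NVar 26))) (For 24 14 ?asg)) Skip)"
  have outer: "runs B ?loop s1 (?I N)"
    if s1: "fst s1 23 0 0 = t" "fst s1 14 0 0 = N" "fst s1 26 0 0 = m" "fst s1 22 = fst s 22" "fst s1 4 = fst s 4"
      "fst s1 5 = fst s 5" "fst s1 17 = fst s 17" "snd s1 5 = snd s 5" "real (fst s1 28 0 0) = \<bar>p\<bar>" for s1
  proof (rule runs_For[where I = ?I and n = N], goal_cases)
    case (1 r s2)
    have fr: "fst s2 23 0 0 = t" "fst s2 14 0 0 = N" "fst s2 26 0 0 = m" "fst s2 22 = fst s 22" "fst s2 4 = fst s 4"
      "fst s2 5 = fst s 5" "fst s2 17 = fst s 17" "real (fst s2 28 0 0) = \<bar>p\<bar>"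
      using 1(2) s1 by (simp_all add: frame_def)
    show ?case
    proof (rule runs_Cond)
      assume "\<not> bval (NLess (NVar 23) (NVar 29)) s2"
      then have "\<not> t < r" using fr 1(3) by simp
      then have "?I (Suc r) (nset 29 (Suc r) s2)" using 1(4) by (auto simp: less_Suc_eq)
      then show "runs B Skip s2 (\<lambda>s''. ?I (Suc r) (nset 29 (Suc r) s''))" by (rule runs_Skip)
    next
      assume "bval (NLess (NVar 23) (NVar 29)) s2"
      then have tr: "t < r" using fr 1(3) by simp
      have row: "snd s2 5 r = snd s 5 r" using 1(4) by (simp add: fun_eq_iff)
      have rowt: "snd s2 5 t = snd s 5 t" using 1(4) by (simp add: fun_eq_iff)
      let ?q = "lin s m (snd s 5 r)"
      show "runs B (Seq (conv (row_exp 5 (NVar 29) (NVar 26))) (For 24 14 ?asg)) s2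
         (\<lambda>s''. ?I (Suc r) (nset 29 (Suc r) s''))"
      proof (rule runs_then, rule runs_conv_factor[where z = ?q])
        show "conv_ready B s2" using conv_ready_frame[OF \<open>conv_ready B s\<close> fr(6,7)] .
        show "rval (row_exp 5 (NVar 29) (NVar 26)) s2 = ?q"
          using fr 1(3) row lin_cong[OF fr(5)] by simp
        show "?q \<in> \<int>" "\<bar>?q\<bar> < 2 ^ fst s2 17 0 0" using a[of r] tr 1(1) fr by simp_all
        fix s3 assume f: "frame (conv (row_exp 5 (NVar 29) (NVar 26))) s2 s3"
          and q: "\<And>y. real (fst s3 18 0 0) * y - real (fst s3 20 0 0) * y = ?q * y"
        have fr3: "fst s3 23 0 0 = t" "fst s3 14 0 0 = N" "fst s3 22 = fst s 22" "fst s3 29 0 0 = r"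
          "real (fst s3 28 0 0) = \<bar>p\<bar>" "snd s3 5 = snd s2 5"
          using f fr 1(3) by (simp_all add: frame_def)
        let ?L = "\<lambda>l s'. \<forall>r' k. snd s' 5 r' k = (if r' = r \<and> k < l then ?new r k else snd s2 5 r' k)"
        have "runs B (For 24 14 ?asg) s3 (?L N)"
        proof (rule runs_For[where I = ?L and n = N], goal_cases)
          case (1 k s4)
          have fr4: "fst s4 23 0 0 = t" "fst s4 29 0 0 = r" "fst s4 22 = fst s 22" "real (fst s4 28 0 0) = \<bar>p\<bar>"
            "fst s4 18 = fst s3 18" "fst s4 20 = fst s3 20"
            using 1(2) fr3 by (simp_all add: frame_def)
          have e: "snd s4 5 r k = snd s 5 r k" "snd s4 5 t k = snd s 5 t k"
            using 1(4) row rowt tr by simp_all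
          have v: "rval (RQuot (RAdd (RScale (NVar 28) (RCell 5 (NVar 29) (NVar 24)))
                       (RSub (RScale (NVar 18) (RCell 5 (NVar 23) (NVar 24)))
                             (RScale (NVar 20) (RCell 5 (NVar 23) (NVar 24))))) (NVar 22)) s4 = ?new r k"
            by (simp add: fr4 e 1(3) D q)
          have "?L (Suc k) (nset 24 (Suc k) (rput 5 r k (?new r k) s4))"
            using 1(4) by (auto simp: less_Suc_eq)
          then show ?case
            by (intro runs_RAssign) (simp only: v nval.simps fr4 1(3) simp_thms)
        qed (use fr3 N in simp_all)
        then show "runs B (For 24 14 ?asg) s3 (\<lambda>s''. ?I (Suc r) (nset 29 (Suc r) s''))"
        proof (rule runs_conseq)
          fix s' :: memory assume L: "?L N s'"
          have "snd s' 5 r' k = (if t < r' \<and> r' < Suc r \<and> k < N then ?new r' k else snd s 5 r' k)" for r' k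
            using L 1(4) tr by (cases "r' = r") (auto simp: less_Suc_eq)
          then show "?I (Suc r) (nset 29 (Suc r) s')" by simp
        qed
      qed
    qed
  qed (use s1 N in \<open>simp_all add: less_Suc_eq\<close>)
  show ?thesis
    unfolding eliminate_def
  proof (rule runs_then, rule runs_conv_factor[where z = p])
    show "conv_ready B s" by (fact r)
    show "rval (row_exp 5 (NVar 23) (NVar 26)) s = p" using t m p by simp
    show "p \<in> \<int>" "\<bar>p\<bar> < 2 ^ fst s 17 0 0" using a[of t] tN p by auto
    fix s1 assume f: "frame (conv (row_exp 5 (NVar 23) (NVar 26))) s s1" and "real (fst s1 20 0 0) = max 0 (- p)"
    then have v: "real (fst s1 20 0 0) = \<bar>p\<bar>" using p(2) by simp
    let ?s2 = "nset 28 (fst s1 20 0 0) s1"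
    have "runs B ?loop ?s2 (?I N)"
      by (rule outer) (use f t N m v in \<open>simp_all add: frame_def\<close>)
    then have "runs B (Seq ?loop (NSet 22 (NVar 28))) ?s2 (\<lambda>s'. real (fst s' 22 0 0) = \<bar>p\<bar> \<and> ?I N s')"
    proof (rule runs_Seq)
      fix s' assume f': "frame ?loop ?s2 s'" and I: "?I N s'"
      have "fst s' 28 = fst ?s2 28" using f' by (simp add: frame_def)
      then show "runs B (NSet 22 (NVar 28)) s' (\<lambda>s'. real (fst s' 22 0 0) = \<bar>p\<bar> \<and> ?I N s')"
        using I v by (intro runs_NAssign) simp
    qed
    then show "runs B (Seq (NSet 28 (NVar 20)) (Seq ?loop (NSet 22 (NVar 28)))) s1
      (\<lambda>s'. real (fst s' 22 0 0) = \<bar>p\<bar> \<and> ?I N s')"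
      by (intro runs_then[OF runs_NAssign]) simp
  qed
qed

text \<open>The inner loop covers \<open>N + 1\<close> columns, so that the dummy coordinate of each
  direction is 0.\<close>

definition init_basis :: com where
  "init_basis =
     Seq (NSet 22 (NConst 1))
       (For 29 14 (For 24 15
         (Cond (NEq (NVar 29) (NVar 24))
           (RAssign 5 (NVar 29) (NVar 24) (RNat (NConst 1)))
           (RAssign 5 (NVar 29) (NVar 24) (RNat (NConst 0))))))"

definition purify_step :: com where
  "purify_step = Seq direction_cost (Seq flip (Seq ratio_test (Seq move eliminate)))"

definition purify :: com where
  "purify = Seq init_basis (For 23 14 purify_step)"

lemma mods_init_basis [simp]: "nmods init_basis = {22, 24, 29}" "rmods init_basis = {5}"
  by (auto simp: init_basis_def)

lemma mods_purify_step [simp]: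
  "nmods purify_step = {18, 19, 20, 21, 22, 24, 25, 26, 27, 28, 29}"
  "rmods purify_step = {3, 5, 10, 11, 20, 21, 22, 23}"
  by (auto simp: purify_step_def)

lemma mods_purify [simp]:
  "nmods purify = {18, 19, 20, 21, 22, 23, 24, 25, 26, 27, 28, 29}"
  "rmods purify = {3, 5, 10, 11, 20, 21, 22, 23}"
  by (auto simp: purify_def)

lemma runs_init_basis:
  assumes N: "fst s 14 0 0 = N" "N \<le> B" "fst s 15 0 0 = Suc N" "Suc N \<le> B"
  shows "runs B init_basis s (\<lambda>s'. fst s' 22 0 0 = 1 \<and> (\<forall>r<N. \<forall>k\<le>N. snd s' 5 r k = (if k = r then 1 else 0)))"
proof -
  let ?c = "Cond (NEq (NVar 29) (NVar 24))
           (RAssign 5 (NVar 29) (NVar 24) (RNat (NConst 1)))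
           (RAssign 5 (NVar 29) (NVar 24) (RNat (NConst 0)))"
  let ?J = "\<lambda>Z s'. fst s' 22 0 0 = 1 \<and> (\<forall>r k. (r, k) \<in> Z \<longrightarrow> snd s' 5 r k = (if k = r then 1 else 0))"
  have loop: "runs B (For 29 14 (For 24 15 ?c)) (nset 22 1 s) (?J ({..<N} \<times> {..<Suc N}))"
  proof (rule runs_For2[where J = ?J and ?n1.0 = N and ?n2.0 = "Suc N"], goal_cases)
    case (1 Z r k s')
    show ?case
      by (rule runs_Cond; rule runs_RAssign) (use 1(5,6,8) in auto)
  qed (use N in simp_all)
  then have "runs B (For 29 14 (For 24 15 ?c)) (nset 22 1 s)
      (\<lambda>s'. fst s' 22 0 0 = 1 \<and> (\<forall>r<N. \<forall>k\<le>N. snd s' 5 r k = (if k = r then 1 else 0)))"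
    by (rule runs_conseq) simp
  then show ?thesis
    unfolding init_basis_def by (intro runs_then[OF runs_NAssign]) simp
qed

section \<open>The walk to a vertex\<close>

definition rows_ok :: "nat \<Rightarrow> memory \<Rightarrow> bool" where
  "rows_ok N s \<longleftrightarrow>
     (\<forall>m<fst s 16 0 0. fst s 4 0 m \<le> N \<and> fst s 4 2 m \<le> N \<and> fst s 4 3 m \<le> N \<and> fst s 4 4 m \<le> N \<and> rhs s m \<in> \<int>) \<and>
     (\<forall>t<N. (\<exists>m<fst s 16 0 0. fst s 4 0 m = t \<and> fst s 4 2 m = N \<and> fst s 4 3 m = N \<and> fst s 4 4 m = N) \<and>
            (\<exists>m<fst s 16 0 0. fst s 4 0 m = N \<and> fst s 4 2 m = N \<and> fst s 4 3 m = N \<and> fst s 4 4 m = t))"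

definition feasible :: "memory \<Rightarrow> (nat \<Rightarrow> real) \<Rightarrow> bool" where
  "feasible s y \<longleftrightarrow> (\<forall>m<fst s 16 0 0. rhs s m \<le> lin s m y)"

text \<open>The list \<open>\<mu>\<close> of independent tight rows exists only in the proof: the
  program remembers nothing of these rows but the directions and the determinant.\<close>

definition purify_inv :: "nat \<Rightarrow> memory \<Rightarrow> real \<Rightarrow> nat \<Rightarrow> memory \<Rightarrow> bool" where
  "purify_inv N s c t s' \<longleftrightarrow>
     (\<exists>\<mu>. elim_inv N (coef s) t \<mu> (real (fst s' 22 0 0)) (snd s' 5) \<and>
        (\<forall>i<t. \<mu> i < fst s 16 0 0 \<and> lin s (\<mu> i) (snd s' 3 0) = rhs s (\<mu> i))) \<and>
     feasible s (snd s' 3 0) \<and> snd s' 3 0 N = 0 \<and> (\<forall>r<N. snd s' 5 r N = 0) \<and>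
     (\<Sum>k<N. snd s' 3 0 k * snd s 6 0 k) \<le> c"

lemma lin_eqI:
  assumes "rows_ok N s" "m < fst s 16 0 0" "\<And>k. k \<le> N \<Longrightarrow> z k = z' k"
  shows "lin s m z = lin s m z'"
proof -
  have "fst s 4 0 m \<le> N" "fst s 4 2 m \<le> N" "fst s 4 3 m \<le> N" "fst s 4 4 m \<le> N"
    using assms(1,2) by (simp_all add: rows_ok_def)
  then show ?thesis unfolding lin_def by (simp add: assms(3))
qed

text \<open>The move follows \<open>\<sigma> * h t\<close> up to the first row that becomes tight.
  Rows already tight remain so, as they vanish on \<open>h t\<close>. The blocking row is negative
  on the direction, hence independent of them, and is the next row of the elimination.\<close>

lemma runs_purify_step:
  assumes ok: "rows_ok N s" and N: "fst s 14 0 0 = N" "N \<le> B" and M: "fst s 16 0 0 \<le> B"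
    and r: "conv_ready B s" and K: "fst s 17 0 0 = 2 * (Suc N * Suc N)" and t: "t < N"
    and inv: "purify_inv N s c t s1"
    and fr: "fst s1 23 0 0 = t" "fst s1 14 = fst s 14" "fst s1 16 = fst s 16" "fst s1 17 = fst s 17"
      "fst s1 4 = fst s 4" "fst s1 5 = fst s 5" "snd s1 4 = snd s 4" "snd s1 6 = snd s 6"
  shows "runs B purify_step s1 (purify_inv N s c (Suc t))"
proof -
  define M where "M = fst s 16 0 0"
  define h where "h = snd s1 5"
  define y where "y = snd s1 3 0"
  define D where "D = real (fst s1 22 0 0)"
  let ?b = "fact N * 3 ^ N :: real"
  obtain \<mu> where el: "elim_inv N (coef s) t \<mu> D h"
    and tight: "\<And>i. i < t \<Longrightarrow> \<mu> i < M \<and> lin s (\<mu> i) y = rhs s (\<mu> i)"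
    using inv unfolding purify_inv_def M_def h_def y_def D_def by blast
  have feas: "\<And>m. m < M \<Longrightarrow> rhs s m \<le> lin s m y" and yN: "y N = 0" and hN: "\<And>r. r < N \<Longrightarrow> h r N = 0"
    and cost: "(\<Sum>k<N. y k * snd s 6 0 k) \<le> c"
    using inv unfolding purify_inv_def feasible_def M_def h_def y_def by blast+
  have ptr: "fst s 4 0 m \<le> N" "fst s 4 2 m \<le> N" "fst s 4 3 m \<le> N" "fst s 4 4 m \<le> N" if "m < M" for m
    using ok that unfolding rows_ok_def M_def by blast+
  have hint: "h r k \<in> \<int>" "\<bar>h r k\<bar> \<le> ?b" if "t \<le> r" "r < N" "k < N" for r k
    using elim_int[OF el _ that] coef_bounds by blast+
  have b4: "4 * ?b < 2 ^ fst s 17 0 0" using entry_bound_pow[of N] t unfolding K by simp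
  have b0: "0 \<le> ?b" by simp
  have b1: "?b < 2 ^ fst s 17 0 0" using b4 b0 by linarith
  have Dpos: "0 < D" and hd: "h t t = D" using el t unfolding elim_inv_def by blast+
  have lins: "lin s' = lin s" if "fst s' 4 = fst s 4" for s' by (rule lin_cong[OF that])
  have e1: "entries_ok N s1 (snd s1 5 t)"
    unfolding entries_ok_def fr(4) using hint[OF order_refl t] b1 unfolding h_def by fastforce
  show ?thesis
    unfolding purify_step_def
  proof (rule runs_Seq[OF runs_direction_cost[OF fr(1) _ N(2) _ e1]])
    show "fst s1 14 0 0 = N" using fr N by simp
    show "conv_ready B s1" using conv_ready_frame[OF r fr(6,4)] .
    fix s2 assume f2: "frame direction_cost s1 s2" and c2: "snd s2 20 0 0 = (\<Sum>k<N. snd s1 5 t k * snd s1 6 0 k)"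
    have fr2: "fst s2 23 0 0 = t" "fst s2 14 = fst s 14" "fst s2 16 = fst s 16" "fst s2 17 = fst s 17"
      "fst s2 4 = fst s 4" "fst s2 5 = fst s 5" "snd s2 4 = snd s 4" "snd s2 5 = h" "snd s2 3 0 = y"
      "real (fst s2 22 0 0) = D"
      using f2 fr by (simp_all add: frame_def h_def y_def D_def)
    let ?c = "\<Sum>k<N. h t k * snd s 6 0 k"
    have c2': "snd s2 20 0 0 = ?c" using c2 fr by (simp add: h_def)
    show "runs B (Seq flip (Seq ratio_test (Seq move eliminate))) s2 (purify_inv N s c (Suc t))"
    proof (rule runs_Seq[OF runs_flip[OF fr2(1) _ N(2)]])
      show "fst s2 14 0 0 = N" using fr2 N by simp
      fix s3 assume f3: "frame flip s2 s3"
        and "\<exists>\<sigma>. (\<sigma> = 1 \<or> \<sigma> = -1) \<and> \<sigma> * snd s2 20 0 0 \<le> 0 \<and>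
          snd s3 5 = (snd s2 5)(t := (\<lambda>k. if k < N then \<sigma> * snd s2 5 t k else snd s2 5 t k))"
      then obtain \<sigma> where \<sigma>: "\<sigma> = 1 \<or> \<sigma> = -1" and \<sigma>c: "\<sigma> * ?c \<le> 0"
        and h3: "snd s3 5 = h(t := (\<lambda>k. if k < N then \<sigma> * h t k else h t k))"
        unfolding c2' fr2 by blast
      define g where "g = snd s3 5 t"
      have g: "g k = \<sigma> * h t k" if "k \<le> N" for k
        using that hN[OF t] h3 by (cases "k = N") (simp_all add: g_def)
      have gN: "g N = 0" using g hN[OF t] by simp
      have h3r: "snd s3 5 r = h r" if "r \<noteq> t" for r using that h3 by simp
      have gint: "g k \<in> \<int>" "\<bar>g k\<bar> \<le> ?b" if "k < N" for k
        using hint[OF order_refl t that] g[of k] that \<sigma> by auto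
      have fr3: "fst s3 23 0 0 = t" "fst s3 14 = fst s 14" "fst s3 16 = fst s 16" "fst s3 17 = fst s 17"
        "fst s3 4 = fst s 4" "fst s3 5 = fst s 5" "snd s3 4 = snd s 4" "snd s3 3 0 = y"
        "real (fst s3 22 0 0) = D"
        using f3 fr2 by (simp_all add: frame_def)
      define a where "a m = lin s m g" for m
      define b where "b m = lin s m y - rhs s m" for m
      have aint: "a m \<in> \<int>" "\<bar>a m\<bar> < 2 ^ fst s 17 0 0" if "m < M" for m
        using lin_int_bound[where z = g and N = N and b = ?b and s = s and m = m] gint gN b0 ptr[OF that] b4
        unfolding a_def by fastforce+
      \<comment> \<open>The direction has the value \<open>D\<close> or \<open>- D\<close> at
        coordinate \<open>t\<close>, so one of the two bounds of this coordinate decreases along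
        it.\<close>
      have ex: "\<exists>m<M. a m < 0"
      proof -
        have gt: "g t = \<sigma> * D" using g t hd by simp
        obtain m1 m2 where m1: "m1 < M" "fst s 4 0 m1 = t" "fst s 4 2 m1 = N" "fst s 4 3 m1 = N" "fst s 4 4 m1 = N"
          and m2: "m2 < M" "fst s 4 0 m2 = N" "fst s 4 2 m2 = N" "fst s 4 3 m2 = N" "fst s 4 4 m2 = t"
          using ok t unfolding rows_ok_def M_def by blast
        have "a m1 = \<sigma> * D" "a m2 = - (\<sigma> * D)"
          using m1 m2 gt gN by (simp_all add: a_def lin_def)
        then show ?thesis using \<sigma> Dpos m1(1) m2(1) by (metis mult_1 mult_minus1 neg_less_0_iff_less)
      qed
      show "runs B (Seq ratio_test (Seq move eliminate)) s3 (purify_inv N s c (Suc t))"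
      proof (rule runs_Seq[OF runs_ratio_test[where a = a and b = b and M = M, OF fr3(1)]])
        show "fst s3 16 0 0 = M" using fr3 by (simp add: M_def)
        show "M \<le> B" using assms(4) by (simp add: M_def)
        show "conv_ready B s3" using conv_ready_frame[OF r fr3(6,4)] .
        show "a m = lin s3 m (snd s3 5 t)" for m
          using lins[OF fr3(5)] by (simp add: a_def g_def)
        show "a m \<in> \<int> \<and> \<bar>a m\<bar> < 2 ^ fst s3 17 0 0" if "m < M" for m
          using aint[OF that] fr3 by simp
        show "b m = lin s3 m (snd s3 3 0) - rhs s3 m" for m
          using lins[OF fr3(5)] fr3 by (simp add: b_def rhs_def)
        show "\<exists>m<M. a m < 0" by (fact ex)
        fix s4 assume f4: "frame ratio_test s3 s4" and best: "best_ratio M a b (fst s4 26 0 0) (snd s4 21 0 0)"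
        define m where "m = fst s4 26 0 0"
        define \<tau> where "\<tau> = snd s4 21 0 0"
        have m: "m < M" "a m < 0" "\<tau> = b m / - a m" "\<And>m'. m' < M \<Longrightarrow> a m' < 0 \<Longrightarrow> \<tau> \<le> b m' / - a m'"
          using best unfolding best_ratio_def m_def \<tau>_def by blast+
        have \<tau>0: "0 \<le> \<tau>" using m(1-3) feas[OF m(1)] by (simp add: b_def divide_nonneg_neg)
        have fr4: "fst s4 23 0 0 = t" "fst s4 14 = fst s 14" "fst s4 16 = fst s 16" "fst s4 17 = fst s 17"
          "fst s4 4 = fst s 4" "fst s4 5 = fst s 5" "snd s4 5 = snd s3 5" "snd s4 3 0 = y"
          "real (fst s4 22 0 0) = D"
          using f4 fr3 by (simp_all add: frame_def)
        have e4: "entries_ok N s4 (snd s4 5 t)"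
          unfolding entries_ok_def fr4 g_def[symmetric] using gint b1 by fastforce
        show "runs B (Seq move eliminate) s4 (purify_inv N s c (Suc t))"
        proof (rule runs_Seq[OF runs_move[OF fr4(1) _ N(2) _ e4]])
          show "fst s4 14 0 0 = N" using fr4 N by simp
          show "conv_ready B s4" using conv_ready_frame[OF r fr4(6,4)] .
          fix s5 assume f5: "frame move s4 s5" and y5: "\<forall>k. snd s5 3 0 k =
             (if k < N then snd s4 3 0 k + snd s4 5 t k * snd s4 21 0 0 else snd s4 3 0 k)"
          have fr5: "fst s5 23 0 0 = t" "fst s5 14 = fst s 14" "fst s5 16 = fst s 16" "fst s5 17 = fst s 17"
            "fst s5 4 = fst s 4" "fst s5 5 = fst s 5" "snd s5 5 = snd s3 5" "fst s5 26 0 0 = m"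
            "real (fst s5 22 0 0) = D"
            using f5 fr4 by (simp_all add: frame_def m_def)
          define y' where "y' = snd s5 3 0"
          have y': "y' k = y k + \<tau> * g k" if "k \<le> N" for k
            using y5 that gN fr4 unfolding y'_def g_def \<tau>_def by (cases "k = N") simp_all
          have liny': "lin s m' y' = lin s m' y + \<tau> * a m'" if "m' < M" for m'
          proof -
            have "lin s m' y' = lin s m' (\<lambda>k. 1 * y k + \<tau> * g k)"
              by (rule lin_eqI[OF ok]) (use that y' in \<open>simp_all add: M_def\<close>)
            then show ?thesis unfolding lin_lincomb a_def by simp
          qed
          have feas': "rhs s m' \<le> lin s m' y'" if "m' < M" for m'
          proof (cases "a m' < 0")
            case True
            then have "\<tau> * - a m' \<le> b m'"
              using m(4)[OF that True] True by (subst (asm) pos_le_divide_eq) simp_all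
            then show ?thesis using liny'[OF that] by (simp add: b_def)
          next
            case False
            then have "0 \<le> \<tau> * a m'" using \<tau>0 by simp
            then show ?thesis using liny'[OF that] feas[OF that] by linarith
          qed
          have tight_m: "lin s m y' = rhs s m"
            using liny'[OF m(1)] m(2,3) by (simp add: b_def)
          have sumg: "(\<Sum>k<N. coef s m' k * g k) = a m'" if "m' < M" for m'
            unfolding a_def using sum_coef[where z = g, OF gN ptr[OF that]] .
          have tight': "lin s (\<mu> i) y' = rhs s (\<mu> i)" if "i < t" for i
          proof -
            have \<mu>: "\<mu> i < M" "lin s (\<mu> i) y = rhs s (\<mu> i)" using tight[OF that] by blast+
            have "a (\<mu> i) = (\<Sum>k<N. coef s (\<mu> i) k * g k)" using sumg[OF \<mu>(1)] by simp
            also have "\<dots> = (\<Sum>k<N. \<sigma> * (coef s (\<mu> i) k * h t k))"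
              by (intro sum.cong) (simp_all add: g)
            also have "\<dots> = \<sigma> * (\<Sum>k<N. coef s (\<mu> i) k * h t k)" by (simp only: sum_distrib_left)
            also have "(\<Sum>k<N. coef s (\<mu> i) k * h t k) = 0"
              using el that t unfolding elim_inv_def by blast
            finally show ?thesis using liny'[OF \<mu>(1)] \<mu>(2) by simp
          qed
          have cost': "(\<Sum>k<N. y' k * snd s 6 0 k) \<le> c"
          proof -
            have "(\<Sum>k<N. y' k * snd s 6 0 k) = (\<Sum>k<N. y k * snd s 6 0 k + \<tau> * \<sigma> * (h t k * snd s 6 0 k))"
              by (intro sum.cong) (simp_all add: y' g algebra_simps)
            also have "\<dots> = (\<Sum>k<N. y k * snd s 6 0 k) + \<tau> * (\<sigma> * ?c)"
              by (simp add: sum.distrib sum_distrib_left mult.assoc)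
            also have "\<tau> * (\<sigma> * ?c) \<le> 0" using \<tau>0 \<sigma>c by (rule mult_nonneg_nonpos)
            finally show ?thesis using cost by linarith
          qed
          have lin5: "lin s5 = lin s" by (rule lins[OF fr5(5)])
          have lint: "lin s5 m (snd s5 5 t) = a m" using lin5 fr5 by (simp add: a_def g_def)
          show "runs B eliminate s5 (purify_inv N s c (Suc t))"
          proof (rule runs_conseq[OF runs_eliminate[OF fr5(1) _ N(2) _ fr5(8,9) lint m(2) _ t]])
            show "fst s5 14 0 0 = N" using fr5 N by simp
            show "conv_ready B s5" using conv_ready_frame[OF r fr5(6,4)] .
            show "lin s5 m (snd s5 5 r) \<in> \<int> \<and> \<bar>lin s5 m (snd s5 5 r)\<bar> < 2 ^ fst s5 17 0 0"
              if "t \<le> r" "r < N" for r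
            proof (cases "r = t")
              case True
              then show ?thesis using lint aint[OF m(1)] fr5 by simp
            next
              case False
              have "lin s m (h r) \<in> \<int>" "\<bar>lin s m (h r)\<bar> \<le> 4 * ?b"
                using lin_int_bound[where z = "h r" and N = N and b = ?b and s = s and m = m]
                  hint[OF that] hN[OF that(2)] b0 ptr[OF m(1)] by blast+
              then show ?thesis using lin5 fr5 h3r[OF False] b4 by simp
            qed
            show "fst s5 4 0 m \<le> N" "fst s5 4 2 m \<le> N" "fst s5 4 3 m \<le> N" "fst s5 4 4 m \<le> N"
              using ptr[OF m(1)] fr5 by simp_all
            fix s6 assume f6: "frame eliminate s5 s6" and post: "real (fst s6 22 0 0) = \<bar>a m\<bar> \<and>
               (\<forall>r k. snd s6 5 r k = (if t < r \<and> r < N \<and> k < N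
               then (\<bar>a m\<bar> * snd s5 5 r k + lin s5 m (snd s5 5 r) * snd s5 5 t k) / D else snd s5 5 r k))"
            have y6: "snd s6 3 0 = y'" using f6 by (simp add: frame_def y'_def)
            have "elim_inv N (coef s) (Suc t) (\<mu>(t := m)) \<bar>a m\<bar> (snd s6 5)"
            proof (rule elim_step[OF el t \<sigma> refl])
              show "a m = (\<Sum>k<N. coef s m k * (\<sigma> * h t k))"
                unfolding sumg[OF m(1), symmetric] by (intro sum.cong) (simp_all add: g)
              show "a m < 0" by (fact m(2))
              fix r k assume rk: "t < r" "r < N" "k < N"
              have "(\<Sum>k<N. coef s m k * h r k) = lin s m (h r)"
                using sum_coef[where z = "h r", OF hN[OF rk(2)] ptr[OF m(1)]] .
              moreover have "snd s5 5 t k = \<sigma> * h t k"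
                using g[of k] rk(3) fr5 by (simp add: g_def)
              moreover have "snd s5 5 r = h r" using fr5 h3r rk(1) by simp
              ultimately show "snd s6 5 r k = (\<bar>a m\<bar> * h r k + (\<Sum>k<N. coef s m k * h r k) * (\<sigma> * h t k)) / D"
                using post rk lin5 by simp
            qed
            moreover have "\<forall>i<Suc t. (\<mu>(t := m)) i < M \<and> lin s ((\<mu>(t := m)) i) y' = rhs s ((\<mu>(t := m)) i)"
              using tight tight' tight_m m(1) by (simp add: less_Suc_eq)
            moreover have "snd s6 5 r N = 0" if "r < N" for r
              using post hN[OF that] gN h3r[of r] fr5 by (cases "r = t") (simp_all add: g_def)
            moreover have "y' N = 0" using y'[of N] yN gN by simp
            ultimately show "purify_inv N s c (Suc t) s6"
              unfolding purify_inv_def feasible_def y6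
              using post feas' cost' unfolding M_def by (intro conjI exI[of _ "\<mu>(t := m)"]) simp_all
          qed
        qed
      qed
    qed
  qed
qed

text \<open>After \<open>N\<close> steps the tight rows determine the point. The last determinant is
  left in natural scalar 22, where the pivots expect the unit.\<close>

lemma runs_purify:
  assumes ok: "rows_ok N s" and N: "fst s 14 0 0 = N" "N \<le> B" "fst s 15 0 0 = Suc N" "Suc N \<le> B"
    and M: "fst s 16 0 0 \<le> B"
    and r: "conv_ready B s" and K: "fst s 17 0 0 = 2 * (Suc N * Suc N)"
    and feas: "feasible s (snd s 3 0)" and yN: "snd s 3 0 N = 0"
  shows "runs B purify s (\<lambda>s'. feasible s (snd s' 3 0) \<and> snd s' 3 0 N = 0 \<and>
     (\<Sum>k<N. snd s' 3 0 k * snd s 6 0 k) \<le> (\<Sum>k<N. snd s 3 0 k * snd s 6 0 k) \<and>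
     0 < fst s' 22 0 0 \<and> real (fst s' 22 0 0) \<le> fact N * 3 ^ N \<and>
     (\<forall>k<N. real (fst s' 22 0 0) * snd s' 3 0 k \<in> \<int>))"
proof -
  let ?c = "\<Sum>k<N. snd s 3 0 k * snd s 6 0 k"
  have loop: "runs B (For 23 14 purify_step) s1 (purify_inv N s ?c N)"
    if f: "frame init_basis s s1" and i: "fst s1 22 0 0 = 1" "\<forall>r<N. \<forall>k\<le>N. snd s1 5 r k = (if k = r then 1 else 0)" for s1
  proof (rule runs_For[where I = "purify_inv N s ?c" and n = N])
    show "runs B purify_step s' (\<lambda>s''. purify_inv N s ?c (Suc t) (nset 23 (Suc t) s''))"
      if t: "t < N" "frame (For 23 14 purify_step) s1 s'" "fst s' 23 0 0 = t" "purify_inv N s ?c t s'" for t s'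
    proof (rule runs_conseq[OF runs_purify_step[OF ok N(1,2) M r K t(1,4,3)]])
      show "fst s' 14 = fst s 14" "fst s' 16 = fst s 16" "fst s' 17 = fst s 17" "fst s' 4 = fst s 4"
        "fst s' 5 = fst s 5" "snd s' 4 = snd s 4" "snd s' 6 = snd s 6"
        using f t(2) by (simp_all add: frame_def)
    qed (simp add: purify_inv_def)
    have y1: "snd s1 3 = snd s 3" using f by (simp add: frame_def)
    have "elim_inv N (coef s) 0 \<mu> 1 (snd s1 5)" for \<mu>
      using elim_init[of N "coef s" \<mu>] i(2) unfolding elim_inv_def by simp
    then show "purify_inv N s ?c 0 (nset 23 0 s1)"
      using i feas yN y1 by (simp add: purify_inv_def)
    show "fst s1 14 0 0 = N" using f N by (simp add: frame_def)
  qed (use N in simp_all)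
  show ?thesis
    unfolding purify_def
  proof (rule runs_Seq[OF runs_init_basis[OF N]], elim conjE)
    fix s1 assume f: "frame init_basis s s1" and i: "fst s1 22 0 0 = 1" "\<forall>r<N. \<forall>k\<le>N. snd s1 5 r k = (if k = r then 1 else 0)"
    show "runs B (For 23 14 purify_step) s1 (\<lambda>s'. feasible s (snd s' 3 0) \<and> snd s' 3 0 N = 0 \<and>
     (\<Sum>k<N. snd s' 3 0 k * snd s 6 0 k) \<le> ?c \<and>
     0 < fst s' 22 0 0 \<and> real (fst s' 22 0 0) \<le> fact N * 3 ^ N \<and>
     (\<forall>k<N. real (fst s' 22 0 0) * snd s' 3 0 k \<in> \<int>))"
    proof (rule runs_conseq[OF loop[OF f i]])
      fix s' assume inv: "purify_inv N s ?c N s'"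
      then obtain \<mu> where el: "elim_inv N (coef s) N \<mu> (real (fst s' 22 0 0)) (snd s' 5)"
        and tight: "\<And>i. i < N \<Longrightarrow> \<mu> i < fst s 16 0 0 \<and> lin s (\<mu> i) (snd s' 3 0) = rhs s (\<mu> i)"
        and yN': "snd s' 3 0 N = 0"
        unfolding purify_inv_def by blast
      have "(\<Sum>k<N. coef s (\<mu> i) k * snd s' 3 0 k) = rhs s (\<mu> i)" "rhs s (\<mu> i) \<in> \<int>" if "i < N" for i
      proof -
        have ptr: "fst s 4 0 (\<mu> i) \<le> N" "fst s 4 2 (\<mu> i) \<le> N" "fst s 4 3 (\<mu> i) \<le> N" "fst s 4 4 (\<mu> i) \<le> N"
          "rhs s (\<mu> i) \<in> \<int>"
          using ok tight[OF that] unfolding rows_ok_def by blast+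
        show "(\<Sum>k<N. coef s (\<mu> i) k * snd s' 3 0 k) = rhs s (\<mu> i)" "rhs s (\<mu> i) \<in> \<int>"
          using sum_coef[where z = "snd s' 3 0", OF yN' ptr(1-4)] tight[OF that] ptr(5) by simp_all
      qed
      then have "real (fst s' 22 0 0) * snd s' 3 0 k \<in> \<int>" if "k < N" for k
        by (intro elim_final[OF el _ _ _ that, where b = "rhs s"]) (use coef_bounds in blast)+
      moreover have "0 < real (fst s' 22 0 0)" "real (fst s' 22 0 0) \<le> fact N * 3 ^ N"
        using elim_D_bound[OF el order_refl] coef_bounds by blast+
      ultimately show "feasible s (snd s' 3 0) \<and> snd s' 3 0 N = 0 \<and>
     (\<Sum>k<N. snd s' 3 0 k * snd s 6 0 k) \<le> ?c \<and>
     0 < fst s' 22 0 0 \<and> real (fst s' 22 0 0) \<le> fact N * 3 ^ N \<and>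
     (\<forall>k<N. real (fst s' 22 0 0) * snd s' 3 0 k \<in> \<int>)"
        using inv unfolding purify_inv_def by simp
    qed
  qed
qed

section \<open>Choosing the pivots\<close>

text \<open>Truncated subtraction turns \<open>max\<close>, \<open>min\<close> and the clamp of \<open>pivot\<close> into expressions.\<close>

definition pivot_exp :: "nexp \<Rightarrow> nexp \<Rightarrow> nexp" where
  "pivot_exp xi xj =
     (let lo = NSub xi xj; hi = NSub (NVar 22) (NSub xj xi); d = NCell 6 (NVar 32) (NVar 33);
          m = NSub d (NSub d hi)
      in NAdd m (NSub lo m))"

lemma nval_pivot_exp:
  assumes "\<And>k. real (x k) = X k"
    and "nval xi s = x i" "nval xj s = x j" "fst s 32 0 0 = i" "fst s 33 0 0 = j"
  shows "real (nval (pivot_exp xi xj) s) = pivot (real (fst s 22 0 0)) X (\<lambda>i j. real (fst s 6 i j)) i j"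
proof -
  have sub: "real (a - b) = max 0 (real a - real b)" for a b :: nat
    by (cases "a \<le> b") (simp_all add: of_nat_diff)
  have mn: "real (a - (a - b)) = min (real a) (real b)" for a b :: nat
    by (cases "a \<le> b") simp_all
  have mx: "real (a + (b - a)) = max (real b) (real a)" for a b :: nat
    by (cases "a \<le> b") simp_all
  let ?D = "fst s 22 0 0" and ?d = "fst s 6 i j"
  have "real (nval (pivot_exp xi xj) s) =
     real ((?d - (?d - (?D - (x j - x i)))) + ((x i - x j) - (?d - (?d - (?D - (x j - x i))))))"
    using assms by (simp add: pivot_exp_def Let_def)
  also have "\<dots> = max (max 0 (X i - X j)) (min (real ?d) (max 0 (real ?D - max 0 (X j - X i))))"
    unfolding mx mn by (simp only: sub assms(1))
  \<comment> \<open>Truncating the upper end of the interval at 0 makes no difference under the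
    outer maximum with a nonnegative lower end.\<close>
  also have "\<dots> = pivot (real ?D) X (\<lambda>i j. real (fst s 6 i j)) i j"
    by (simp add: pivot_def max_def min_def)
  finally show ?thesis .
qed

definition X_exp :: "bool \<Rightarrow> nat \<Rightarrow> nexp" where
  "X_exp b u = (if b then NCell 6 (NVar u) (NVar 31) else NSub (NVar 22) (NCell 6 (NVar 31) (NVar u)))"

definition candidate :: "bool \<Rightarrow> com" where
  "candidate b =
     Seq (RSet 24 (RNat (NConst 0)))
       (For 32 0 (For 33 0
         (Seq (NAssign 7 (NVar 32) (NVar 33) (pivot_exp (X_exp b 32) (X_exp b 33)))
              (RSet 24 (RAdd (RVar 24)
                (RSub (RScale (NCell 7 (NVar 32) (NVar 33)) (RCell 0 (NVar 32) (NVar 33)))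
                      (RScale (NCell 6 (NVar 32) (NVar 33)) (RCell 0 (NVar 32) (NVar 33)))))))))"

definition accept :: com where
  "accept =
     Seq (For 32 0 (For 33 0 (NAssign 6 (NVar 32) (NVar 33) (NCell 7 (NVar 32) (NVar 33)))))
         (NAssign 8 (NConst 0) (NVar 31) (NConst 1))"

definition try_pivot :: "bool \<Rightarrow> com" where
  "try_pivot b =
     Cond (NLess (NCell 8 (NConst 0) (NVar 31)) (NConst 1))
       (Seq (candidate b) (Cond (RLess (RNat (NConst 0)) (RVar 24)) Skip accept))
       Skip"

definition pivots :: com where
  "pivots =
     Seq (For 31 0 (NAssign 8 (NConst 0) (NVar 31) (NConst 0)))
       (For 30 0 (For 31 0 (Seq (try_pivot True) (try_pivot False))))"

lemma mods_candidate [simp]: "nmods (candidate b) = {7, 32, 33}" "rmods (candidate b) = {24}"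
  by (auto simp: candidate_def)

lemma mods_accept [simp]: "nmods accept = {6, 8, 32, 33}" "rmods accept = {}"
  by (auto simp: accept_def)

lemma mods_try_pivot [simp]: "nmods (try_pivot b) = {6, 7, 8, 32, 33}" "rmods (try_pivot b) = {24}"
  by (auto simp: try_pivot_def)

lemma mods_pivots [simp]: "nmods pivots = {6, 7, 8, 30, 31, 32, 33}" "rmods pivots = {24}"
  by (auto simp: pivots_def)

definition dval :: "memory \<Rightarrow> nat \<Rightarrow> nat \<Rightarrow> real" where
  "dval s i j = real (fst s 6 i j)"

lemma dval_nput: "a \<noteq> 6 \<Longrightarrow> dval (nput a i j k s) = dval s"
  by (simp add: dval_def fun_eq_iff)

lemma cost_as_sum: "cost n w d = (\<Sum>(i, j)\<in>{..<n} \<times> {..<n}. d i j * w i j)"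
  by (simp add: cost_def sum.cartesian_product)

lemma runs_candidate:
  assumes n: "fst s 0 0 0 = n" "n \<le> B" and v: "fst s 31 0 0 = v" "v < n"
    and c: "cov_pt n P (real (fst s 22 0 0)) (dval s)"
  shows "runs B (candidate b) s (\<lambda>s'.
     (\<forall>i<n. \<forall>j<n. real (fst s' 7 i j) = pivot_at (real (fst s 22 0 0)) b (dval s) v i j) \<and>
     snd s' 24 0 0 = cost n (snd s 0) (pivot_at (real (fst s 22 0 0)) b (dval s) v)
        - cost n (snd s 0) (dval s))"
proof -
  let ?u = "real (fst s 22 0 0)"
  let ?p = "pivot ?u (pos b ?u (dval s) v) (dval s)"
  let ?x = "pivot_exp (X_exp b 32) (X_exp b 33)"
  let ?e = "RAdd (RVar 24)
                (RSub (RScale (NCell 7 (NVar 32) (NVar 33)) (RCell 0 (NVar 32) (NVar 33)))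
                      (RScale (NCell 6 (NVar 32) (NVar 33)) (RCell 0 (NVar 32) (NVar 33))))"
  let ?c = "Seq (NAssign 7 (NVar 32) (NVar 33) ?x)
              (RSet 24 ?e)"
  let ?J = "\<lambda>Z s'. (\<forall>i j. (i, j) \<in> Z \<longrightarrow> real (fst s' 7 i j) = ?p i j) \<and>
     snd s' 24 0 0 = (\<Sum>(i, j)\<in>Z. ?p i j * snd s 0 i j - dval s i j * snd s 0 i j)"
  have loop: "runs B (For 32 0 (For 33 0 ?c)) (rset 24 0 s) (?J ({..<n} \<times> {..<n}))"
  proof (rule runs_For2[where J = ?J and ?n1.0 = n and ?n2.0 = n], goal_cases)
    case (1 Z i j s')
    have fr: "fst s' 31 0 0 = v" "fst s' 22 = fst s 22" "fst s' 6 = fst s 6" "snd s' 0 = snd s 0"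
      using 1(4) v by (simp_all add: frame_def)
    define x where "x k = nval (X_exp b 32) (nset 32 k s')" for k
    \<comment> \<open>Truncated subtraction computes \<open>u - d v k\<close> exactly because
      \<open>d v k \<le> u\<close> for vertices; for other \<open>k\<close> nothing is claimed, so
      that the equation holds for all \<open>k\<close>.\<close>
    have x: "real (x k) = (if k < n then pos b ?u (dval s) v k else real (x k))" for k
    proof (cases "k < n")
      case True
      then have "fst s 6 v k \<le> fst s 22 0 0"
        using cov_ptD(3)[OF c v(2) True] by (simp add: dval_def)
      then show ?thesis
        using True fr by (simp add: x_def X_exp_def pos_def dval_def of_nat_diff)
    qed simp
    have val: "real (nval ?x s') = ?p i j"
    proof -
      have "real (nval ?x s') =
          pivot (real (fst s' 22 0 0)) (\<lambda>k. real (x k)) (\<lambda>i j. real (fst s' 6 i j)) i j"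
        by (rule nval_pivot_exp[where x = x]) (use 1(5,6) in \<open>simp_all add: x_def X_exp_def\<close>)
      also have "\<dots> = ?p i j"
        unfolding fr using x[of i] x[of j] 1(1,2) by (simp add: pivot_def dval_def)
      finally show ?thesis .
    qed
    let ?s2 = "nput 7 i j (nval ?x s') s'"
    have fin: "finite Z" using 1(7) by simp
    have J: "\<And>i j. (i, j) \<in> Z \<Longrightarrow> real (fst s' 7 i j) = ?p i j"
      "snd s' 24 0 0 = (\<Sum>(i, j)\<in>Z. ?p i j * snd s 0 i j - dval s i j * snd s 0 i j)"
      using 1(8) by blast+
    have J2: "?J (insert (i, j) Z) (rset 24 (snd s' 24 0 0 + (?p i j * snd s 0 i j - dval s i j * snd s 0 i j)) ?s2)"
      using J(1) val fin 1(3) by (simp add: J(2))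
    have rv: "rval ?e ?s2
        = snd s' 24 0 0 + (?p i j * snd s 0 i j - dval s i j * snd s 0 i j)"
      using 1(5,6) fr val by (simp add: dval_def)
    have "runs B (RSet 24 ?e) ?s2 (?J (insert (i, j) Z))"
      by (rule runs_RAssign, unfold rv nval.simps, rule J2)
    then show ?case
      by (intro runs_then[OF runs_NAssign]) (simp only: nval.simps 1(5,6))
  qed (use n in simp_all)
  show ?thesis
    unfolding candidate_def
  proof (rule runs_then, rule runs_RAssign)
    have "rval (RNat (NConst 0)) s = 0" by simp
    then show "runs B (For 32 0 (For 33 0 ?c)) (rput 24 (nval (NConst 0) s) (nval (NConst 0) s) (rval (RNat (NConst 0)) s) s)
      (\<lambda>s'. (\<forall>i<n. \<forall>j<n. real (fst s' 7 i j) = ?p i j) \<and>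
       snd s' 24 0 0 = cost n (snd s 0) ?p - cost n (snd s 0) (dval s))"
      using runs_conseq[OF loop] unfolding cost_as_sum
      by (simp add: sum_subtractf case_prod_unfold)
  qed
qed

lemma runs_accept:
  assumes n: "fst s 0 0 0 = n" "n \<le> B" and v: "fst s 31 0 0 = v"
  shows "runs B accept s (\<lambda>s'. (\<forall>i<n. \<forall>j<n. fst s' 6 i j = fst s 7 i j) \<and>
     (\<forall>u. fst s' 8 0 u = (if u = v then 1 else fst s 8 0 u)))"
proof -
  let ?c = "NAssign 6 (NVar 32) (NVar 33) (NCell 7 (NVar 32) (NVar 33))"
  let ?J = "\<lambda>Z s'. \<forall>i j. (i, j) \<in> Z \<longrightarrow> fst s' 6 i j = fst s 7 i j"
  have loop: "runs B (For 32 0 (For 33 0 ?c)) s (?J ({..<n} \<times> {..<n}))"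
  proof (rule runs_For2[where J = ?J and ?n1.0 = n and ?n2.0 = n], goal_cases)
    case (1 Z i j s')
    have fr: "fst s' 7 = fst s 7" using 1(4) by (simp add: frame_def)
    show ?case
      by (rule runs_NAssign) (use 1(5,6,8) fr in simp)
  qed (use n in simp_all)
  show ?thesis
    unfolding accept_def
  proof (rule runs_Seq[OF loop])
    fix s' assume f: "frame (For 32 0 (For 33 0 ?c)) s s'" and J: "?J ({..<n} \<times> {..<n}) s'"
    have "fst s' 31 0 0 = v" "fst s' 8 = fst s 8" using f v by (simp_all add: frame_def)
    then show "runs B (NAssign 8 (NConst 0) (NVar 31) (NConst 1)) s' (\<lambda>s'. (\<forall>i<n. \<forall>j<n. fst s' 6 i j = fst s 7 i j) \<and>
     (\<forall>u. fst s' 8 0 u = (if u = v then 1 else fst s 8 0 u)))"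
      using J by (intro runs_NAssign) simp
  qed
qed

section \<open>Sweeps over the pivots\<close>

definition flags :: "nat \<Rightarrow> memory \<Rightarrow> nat set" where
  "flags n s = {v. v < n \<and> 0 < fst s 8 0 v}"

definition good :: "nat \<Rightarrow> (nat \<Rightarrow> nat \<Rightarrow> bool) \<Rightarrow> nat \<Rightarrow> (nat \<Rightarrow> nat \<Rightarrow> real) \<Rightarrow> real \<Rightarrow> memory \<Rightarrow> bool" where
  "good n P u w c s \<longleftrightarrow> fst s 0 0 0 = n \<and> fst s 22 0 0 = u \<and> snd s 0 = w \<and> cov_pt n P (real u) (dval s) \<and>
     cost n w (dval s) \<le> c \<and> (\<forall>v\<in>flags n s. settled n (real u) (dval s) v)"

definition rejected :: "nat \<Rightarrow> nat \<Rightarrow> (nat \<Rightarrow> nat \<Rightarrow> real) \<Rightarrow> memory \<Rightarrow> nat \<Rightarrow> bool \<Rightarrow> bool" where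
  "rejected n u w s v b \<longleftrightarrow>
     v \<in> flags n s \<or> cost n w (dval s) < cost n w (pivot_at (real u) b (dval s) v)"

lemma cov_pt_cong:
  assumes "\<And>i j. i < n \<Longrightarrow> j < n \<Longrightarrow> d i j = d' i j"
  shows "cov_pt n P u d = cov_pt n P u d'"
  unfolding cov_pt_def using assms by (intro conj_cong) (simp_all cong: conj_cong)

lemma settled_cong:
  assumes "\<And>i j. i < n \<Longrightarrow> j < n \<Longrightarrow> d i j = d' i j" "v < n"
  shows "settled n u d v = settled n u d' v"
  unfolding settled_def using assms by simp

lemma cost_cong:
  assumes "\<And>i j. i < n \<Longrightarrow> j < n \<Longrightarrow> d i j = d' i j"
  shows "cost n w d = cost n w d'"
  unfolding cost_def using assms by (intro sum.cong) simp_all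

text \<open>The alternative is what a sweep needs: either one more vertex is flagged, or the
  solution is unchanged and earlier rejections remain valid.\<close>

lemma runs_try_pivot:
  assumes g: "good n P u w c s" and n: "n \<le> B" and v: "fst s 31 0 0 = v" "v < n"
  shows "runs B (try_pivot b) s (\<lambda>s'. good n P u w c s' \<and>
     (card (flags n s') = Suc (card (flags n s)) \<or>
      (\<forall>i<n. \<forall>j<n. dval s' i j = dval s i j) \<and> flags n s' = flags n s \<and> rejected n u w s v b))"
proof -
  let ?Q = "\<lambda>s'. good n P u w c s' \<and>
     (card (flags n s') = Suc (card (flags n s)) \<or>
      (\<forall>i<n. \<forall>j<n. dval s' i j = dval s i j) \<and> flags n s' = flags n s \<and> rejected n u w s v b)"
  have G: "fst s 0 0 0 = n" "fst s 22 0 0 = u" "snd s 0 = w" "cov_pt n P (real u) (dval s)"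
    "cost n w (dval s) \<le> c" "\<And>v. v \<in> flags n s \<Longrightarrow> settled n (real u) (dval s) v"
    using g unfolding good_def by blast+
  show ?thesis
    unfolding try_pivot_def
  proof (rule runs_Cond)
    assume "\<not> bval (NLess (NCell 8 (NConst 0) (NVar 31)) (NConst 1)) s"
    then have "v \<in> flags n s" using v by (simp add: flags_def)
    then show "runs B Skip s ?Q" using g by (intro runs_Skip) (simp add: rejected_def)
  next
    assume "bval (NLess (NCell 8 (NConst 0) (NVar 31)) (NConst 1)) s"
    then have vf: "v \<notin> flags n s" using v by (simp add: flags_def)
    let ?p = "pivot_at (real u) b (dval s) v"
    have cand: "runs B (candidate b) s (\<lambda>s'. (\<forall>i<n. \<forall>j<n. real (fst s' 7 i j) = ?p i j) \<and>
        snd s' 24 0 0 = cost n w ?p - cost n w (dval s))"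
      using runs_candidate[OF G(1) n v, of P b] G(2-4) by simp
    show "runs B (Seq (candidate b) (Cond (RLess (RNat (NConst 0)) (RVar 24)) Skip accept)) s ?Q"
    proof (rule runs_Seq[OF cand])
      fix s1 assume f: "frame (candidate b) s s1" and c1: "(\<forall>i<n. \<forall>j<n. real (fst s1 7 i j) = ?p i j) \<and>
        snd s1 24 0 0 = cost n w ?p - cost n w (dval s)"
      have fr: "fst s1 0 = fst s 0" "fst s1 22 = fst s 22" "snd s1 0 = snd s 0" "fst s1 6 = fst s 6" "fst s1 8 = fst s 8"
        "fst s1 31 0 0 = v"
        using f v by (simp_all add: frame_def)
      have same: "dval s1 = dval s" "flags n s1 = flags n s"
        using fr by (simp_all add: dval_def flags_def fun_eq_iff)
      show "runs B (Cond (RLess (RNat (NConst 0)) (RVar 24)) Skip accept) s1 ?Q"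
      proof (rule runs_Cond)
        assume "bval (RLess (RNat (NConst 0)) (RVar 24)) s1"
        then have "rejected n u w s v b" using c1 by (simp add: rejected_def)
        then show "runs B Skip s1 ?Q"
          using g fr same by (intro runs_Skip) (simp add: good_def)
      next
        assume "\<not> bval (RLess (RNat (NConst 0)) (RVar 24)) s1"
        then have le: "cost n w ?p \<le> cost n w (dval s)" using c1 by simp
        have n1: "fst s1 0 0 0 = n" using fr G(1) by simp
        show "runs B accept s1 ?Q"
        proof (rule runs_conseq[OF runs_accept[OF n1 n fr(6)]])
          fix s2 assume f2: "frame accept s1 s2" and a: "(\<forall>i<n. \<forall>j<n. fst s2 6 i j = fst s1 7 i j) \<and>
            (\<forall>u. fst s2 8 0 u = (if u = v then 1 else fst s1 8 0 u))"
          have fr2: "fst s2 0 0 0 = n" "fst s2 22 0 0 = u" "snd s2 0 = w"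
            using f2 fr G by (simp_all add: frame_def)
          have d2: "dval s2 i j = ?p i j" if "i < n" "j < n" for i j
            using a c1 that by (simp add: dval_def)
          have fl: "flags n s2 = insert v (flags n s)"
            using a fr v by (auto simp: flags_def)
          have "finite (flags n s)" by (simp add: flags_def)
          then have card: "card (flags n s2) = Suc (card (flags n s))" using fl vf by simp
          have "settled n (real u) (dval s2) v'" if "v' \<in> flags n s2" for v'
          proof -
            have v': "v' < n" using that by (simp add: flags_def)
            have "settled n (real u) ?p v'"
            proof (cases "v' = v")
              case True
              then show ?thesis using settled_new[OF G(4) v(2)] by simp
            next
              case False
              then show ?thesis using that fl by (intro settled_kept[OF G(4) v' G(6) v(2)]) simp
            qed
            then show ?thesis using settled_cong[of n "dval s2" ?p v'] d2 v' by simp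
          qed
          moreover have "cov_pt n P (real u) (dval s2)"
            using pos_cov_pt[OF G(4) v(2)] cov_pt_cong[of n "dval s2" ?p] d2 by simp
          moreover have "cost n w (dval s2) \<le> c"
            using le G(5) cost_cong[of n "dval s2" ?p w] d2 by simp
          ultimately show "?Q s2" using fr2 card by (simp add: good_def)
        qed
      qed
    qed
  qed
qed

lemma rejected_cong:
  assumes "\<And>i j. i < n \<Longrightarrow> j < n \<Longrightarrow> dval s' i j = dval s i j" "flags n s' = flags n s" "v < n"
  shows "rejected n u w s' v b = rejected n u w s v b"
proof -
  have p: "pivot_at (real u) b (dval s') v i j = pivot_at (real u) b (dval s) v i j"
    if "i < n" "j < n" for i j
    using assms(1)[OF that] assms(1)[OF that(1) assms(3)] assms(1)[OF that(2) assms(3)]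
      assms(1)[OF assms(3) that(1)] assms(1)[OF assms(3) that(2)]
    by (simp add: pivot_def pos_def)
  have "cost n w (dval s') = cost n w (dval s)"
    "cost n w (pivot_at (real u) b (dval s') v) = cost n w (pivot_at (real u) b (dval s) v)"
    by (rule cost_cong, rule assms(1) p, assumption+)+
  then show ?thesis
    unfolding rejected_def assms(2) by simp
qed

text \<open>As long as a sweep has accepted nothing, the solution is constant and all rejections
  refer to the same \<open>d\<close>. A sweep without success would therefore have rejected both
  pivots at every unflagged vertex, against \<open>good_pivot_exists\<close>.\<close>

lemma runs_sweep:
  assumes g: "good n P u w c s" and n: "n \<le> B" and w: "hemi n w" and k: "k \<le> card (flags n s)" "k < n"
  shows "runs B (For 31 0 (Seq (try_pivot True) (try_pivot False))) s
     (\<lambda>s'. good n P u w c s' \<and> Suc k \<le> card (flags n s'))"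
proof -
  let ?I = "\<lambda>l s'. good n P u w c s' \<and>
     (Suc k \<le> card (flags n s') \<or> k \<le> card (flags n s') \<and> (\<forall>v<l. \<forall>b. rejected n u w s' v b))"
  have n0: "fst s 0 0 0 = n" using g by (simp add: good_def)
  have "runs B (For 31 0 (Seq (try_pivot True) (try_pivot False))) s (?I n)"
  proof (rule runs_For[where I = ?I and n = n], goal_cases)
    case (1 v s1)
    have g1: "good n P u w c s1" and I1: "Suc k \<le> card (flags n s1) \<or> k \<le> card (flags n s1) \<and> (\<forall>v'<v. \<forall>b. rejected n u w s1 v' b)"
      using 1(4) by blast+
    show ?case
    proof (rule runs_Seq[OF runs_try_pivot[OF g1 n 1(3,1)]])
      fix s2 assume f2: "frame (try_pivot True) s1 s2" and p2: "good n P u w c s2 \<and>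
        (card (flags n s2) = Suc (card (flags n s1)) \<or>
        (\<forall>i<n. \<forall>j<n. dval s2 i j = dval s1 i j) \<and> flags n s2 = flags n s1 \<and> rejected n u w s1 v True)"
      have g2: "good n P u w c s2" using p2 by blast
      have v2: "fst s2 31 0 0 = v" using f2 1(3) by (simp add: frame_def)
      have I2: "Suc k \<le> card (flags n s2) \<or>
          k \<le> card (flags n s2) \<and> (\<forall>v'<v. \<forall>b. rejected n u w s2 v' b) \<and> rejected n u w s2 v True"
      proof (cases "card (flags n s2) = Suc (card (flags n s1))")
        case True
        then show ?thesis using I1 by linarith
      next
        case False
        then have "\<forall>i<n. \<forall>j<n. dval s2 i j = dval s1 i j" "flags n s2 = flags n s1" "rejected n u w s1 v True"
          using p2 by blast+
        moreover from this have "rejected n u w s2 v' b = rejected n u w s1 v' b" if "v' \<le> v" for v' b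
          using rejected_cong[of n s2 s1 v'] that 1(1) by simp
        ultimately show ?thesis using I1 by simp
      qed
      show "runs B (try_pivot False) s2 (\<lambda>s''. ?I (Suc v) (nset 31 (Suc v) s''))"
      proof (rule runs_conseq[OF runs_try_pivot[OF g2 n v2 1(1)]])
        fix s3 assume p3: "good n P u w c s3 \<and>
          (card (flags n s3) = Suc (card (flags n s2)) \<or>
          (\<forall>i<n. \<forall>j<n. dval s3 i j = dval s2 i j) \<and> flags n s3 = flags n s2 \<and> rejected n u w s2 v False)"
        have "?I (Suc v) s3"
        proof (cases "card (flags n s3) = Suc (card (flags n s2))")
          case True
          then show ?thesis using I2 p3 by linarith
        next
          case False
          then have *: "\<forall>i<n. \<forall>j<n. dval s3 i j = dval s2 i j" "flags n s3 = flags n s2" "rejected n u w s2 v False"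
            using p3 by blast+
          have rej: "rejected n u w s3 v' b = rejected n u w s2 v' b" if "v' \<le> v" for v' b
            using rejected_cong[of n s3 s2 v'] * that 1(1) by simp
          have "\<forall>b. rejected n u w s3 v b" if "rejected n u w s2 v True"
            using that *(3) rej[of v] by (metis (full_types) order_refl)
          then show ?thesis using I2 p3 * rej by (auto simp: less_Suc_eq)
        qed
        then show "?I (Suc v) (nset 31 (Suc v) s3)"
          by (simp add: good_def flags_def rejected_def dval_nput)
      qed
    qed
  next
    case 4
    then show ?case using g k by (simp add: good_def flags_def dval_nput)
  qed (use n n0 in simp_all)
  then show ?thesis
  proof (rule runs_conseq)
    fix s' assume I: "?I n s'"
    have G: "cov_pt n P (real u) (dval s')" "\<And>v. v < n \<Longrightarrow> v \<in> flags n s' \<Longrightarrow> settled n (real u) (dval s') v"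
      using I unfolding good_def by blast+
    show "good n P u w c s' \<and> Suc k \<le> card (flags n s')"
    proof (rule ccontr)
      assume "\<not> ?thesis"
      then have card: "card (flags n s') = k" and rej: "\<And>v b. v < n \<Longrightarrow> rejected n u w s' v b" using I by auto
      have "\<exists>v<n. v \<notin> flags n s'"
      proof (rule ccontr)
        assume "\<not> ?thesis"
        then have "{..<n} \<subseteq> flags n s'" by blast
        then have "card {..<n} \<le> card (flags n s')" by (intro card_mono) (simp_all add: flags_def)
        then show False using card k by simp
      qed
      from good_pivot_exists[OF G(1) w G(2) this] show False
        using rej unfolding rejected_def by (meson not_le)
    qed
  qed
qed

text \<open>Each of the \<open>n\<close> sweeps adds a flag, so at the end all \<open>n\<close>
  vertices carry one, and \<open>good\<close> makes flagged vertices settled.\<close>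

lemma runs_pivots:
  assumes n: "fst s 0 0 0 = n" "n \<le> B" and u: "fst s 22 0 0 = u" and c: "cov_pt n P (real u) (dval s)"
    and w: "hemi n (snd s 0)"
  shows "runs B pivots s (\<lambda>s'. cov_pt n P (real u) (dval s') \<and> (\<forall>v<n. settled n (real u) (dval s') v) \<and>
     cost n (snd s 0) (dval s') \<le> cost n (snd s 0) (dval s))"
proof -
  let ?c = "cost n (snd s 0) (dval s)"
  let ?z = "NAssign 8 (NConst 0) (NVar 31) (NConst 0)"
  let ?L = "\<lambda>l s'. \<forall>v<l. fst s' 8 0 v = 0"
  have init: "runs B (For 31 0 ?z) s (?L n)"
  proof (rule runs_For[where I = ?L and n = n], goal_cases)
    case (1 k s')
    show ?case by (rule runs_NAssign) (use 1(3,4) in \<open>simp add: less_Suc_eq\<close>)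
  qed (use n in simp_all)
  let ?I = "\<lambda>k s'. good n P u (snd s 0) ?c s' \<and> k \<le> card (flags n s')"
  have loop: "runs B (For 30 0 (For 31 0 (Seq (try_pivot True) (try_pivot False)))) s1 (?I n)"
    if s1: "good n P u (snd s 0) ?c s1" for s1
  proof (rule runs_For[where I = ?I and n = n], goal_cases)
    case (1 k s')
    have g: "good n P u (snd s 0) ?c s'" "k \<le> card (flags n s')" using 1(4) by blast+
    show ?case
      by (rule runs_conseq[OF runs_sweep[OF g(1) n(2) w g(2) 1(1)]])
        (simp add: good_def flags_def dval_nput)
  qed (use s1 n in \<open>simp_all add: good_def flags_def dval_nput\<close>)
  show ?thesis
    unfolding pivots_def
  proof (rule runs_Seq[OF init])
    fix s1 assume f: "frame (For 31 0 ?z) s s1" and z: "?L n s1"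
    have "dval s1 = dval s" "fst s1 0 0 0 = n" "fst s1 22 0 0 = u" "snd s1 0 = snd s 0" "flags n s1 = {}"
      using f n u z by (auto simp: frame_def dval_def flags_def fun_eq_iff)
    then have "good n P u (snd s 0) ?c s1" using c by (simp add: good_def)
    then show "runs B (For 30 0 (For 31 0 (Seq (try_pivot True) (try_pivot False)))) s1
      (\<lambda>s'. cov_pt n P (real u) (dval s') \<and> (\<forall>v<n. settled n (real u) (dval s') v) \<and>
       cost n (snd s 0) (dval s') \<le> ?c)"
    proof (rule runs_conseq[OF loop])
      fix s' assume I: "?I n s'"
      have "flags n s' \<subseteq> {..<n}" by (auto simp: flags_def)
      then have "flags n s' = {..<n}" using I by (intro card_subset_eq) (auto dest: card_mono[rotated])
      then show "cov_pt n P (real u) (dval s') \<and> (\<forall>v<n. settled n (real u) (dval s') v) \<and>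
       cost n (snd s 0) (dval s') \<le> ?c"
        using I by (simp add: good_def)
    qed
  qed
qed

section \<open>The transformation\<close>

definition round_closure :: com where
  "round_closure =
     Seq (NSet 22 (NConst 1))
       (For 10 0 (For 11 0
         (Cond (RLess (RNat (NConst 0)) (RCell 2 (NVar 10) (NVar 11)))
           (NAssign 6 (NVar 10) (NVar 11) (NConst 1))
           (NAssign 6 (NVar 10) (NVar 11) (NConst 0)))))"

definition read_vertex :: com where
  "read_vertex =
     For 10 0 (For 11 0
       (Seq (conv (RScale (NVar 22) (RCell 3 (NConst 0) (IX 10 11))))
            (NAssign 6 (NVar 10) (NVar 11) (NVar 18))))"

definition write_result :: com where
  "write_result =
     For 10 0 (For 11 0 (RAssign 1 (NVar 10) (NVar 11) (RQuot (RNat (NCell 6 (NVar 10) (NVar 11))) (NVar 22))))"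

definition integral_program :: com where
  "integral_program = Seq close (Seq round_closure (Seq pivots write_result))"

definition fractional_program :: com where
  "fractional_program =
     Seq close (Seq tables (Seq make_rows (Seq make_powers (Seq purify (Seq read_vertex (Seq pivots write_result))))))"

lemma runs_round_closure:
  assumes n: "fst s 0 0 0 = n" "n \<le> B" and y: "\<And>i j. i < n \<Longrightarrow> j < n \<Longrightarrow> snd s 2 i j \<in> {0, 1}"
  shows "runs B round_closure s (\<lambda>s'. fst s' 22 0 0 = 1 \<and> (\<forall>i<n. \<forall>j<n. dval s' i j = snd s 2 i j))"
proof -
  let ?c = "Cond (RLess (RNat (NConst 0)) (RCell 2 (NVar 10) (NVar 11)))
           (NAssign 6 (NVar 10) (NVar 11) (NConst 1))
           (NAssign 6 (NVar 10) (NVar 11) (NConst 0))"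
  let ?J = "\<lambda>Z s'. fst s' 22 0 0 = 1 \<and> (\<forall>i j. (i, j) \<in> Z \<longrightarrow> dval s' i j = snd s 2 i j)"
  have "runs B (For 10 0 (For 11 0 ?c)) (nset 22 1 s) (?J ({..<n} \<times> {..<n}))"
  proof (rule runs_For2[where J = ?J and ?n1.0 = n and ?n2.0 = n], goal_cases)
    case (1 Z i j s')
    have fr: "snd s' 2 = snd s 2" using 1(4) by (simp add: frame_def)
    show ?case
      by (rule runs_Cond; rule runs_NAssign) (use y[OF 1(1,2)] 1(5,6,8) fr in \<open>auto simp: dval_def\<close>)
  qed (use n in \<open>simp_all add: dval_def\<close>)
  then have "runs B (For 10 0 (For 11 0 ?c)) (nset 22 1 s)
      (\<lambda>s'. fst s' 22 0 0 = 1 \<and> (\<forall>i<n. \<forall>j<n. dval s' i j = snd s 2 i j))"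
    by (rule runs_conseq) simp
  then show ?thesis
    unfolding round_closure_def by (intro runs_then[OF runs_NAssign]) simp
qed

lemma runs_read_vertex:
  assumes n: "fst s 0 0 0 = n" "n \<le> B" and ix: "\<And>i j. i < n \<Longrightarrow> j < n \<Longrightarrow> fst s 3 i j = ix n i j"
    and r: "conv_ready B s"
    and z: "\<And>i j. i < n \<Longrightarrow> j < n \<Longrightarrow> z i j = real (fst s 22 0 0) * snd s 3 0 (ix n i j)"
      "\<And>i j. i < n \<Longrightarrow> j < n \<Longrightarrow> z i j \<in> \<int> \<and> 0 \<le> z i j \<and> z i j < 2 ^ fst s 17 0 0"
  shows "runs B read_vertex s (\<lambda>s'. \<forall>i<n. \<forall>j<n. dval s' i j = z i j)"
proof -
  let ?x = "RScale (NVar 22) (RCell 3 (NConst 0) (IX 10 11))"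
  let ?J = "\<lambda>Z s'. \<forall>i j. (i, j) \<in> Z \<longrightarrow> dval s' i j = z i j"
  have "runs B read_vertex s (?J ({..<n} \<times> {..<n}))"
    unfolding read_vertex_def
  proof (rule runs_For2[where J = ?J and ?n1.0 = n and ?n2.0 = n], goal_cases)
    case (1 Z i j s')
    have fr: "snd s' 3 = snd s 3" "fst s' 22 = fst s 22" "fst s' 3 = fst s 3" "fst s' 5 = fst s 5" "fst s' 17 = fst s 17"
      using 1(4) by (simp_all add: frame_def)
    show ?case
    proof (rule runs_then, rule runs_conv_factor[where z = "z i j"])
      show "conv_ready B s'" using conv_ready_frame[OF r fr(4,5)] .
      show "rval ?x s' = z i j" using fr 1(1,2,5,6) z(1) ix by (simp add: IX_def)
      show "z i j \<in> \<int>" "\<bar>z i j\<bar> < 2 ^ fst s' 17 0 0" using z(2)[OF 1(1,2)] fr by simp_all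
      fix s2 assume f: "frame (conv ?x) s' s2" and v: "real (fst s2 18 0 0) = max 0 (z i j)"
      have fr2: "fst s2 10 0 0 = i" "fst s2 11 0 0 = j" "fst s2 6 = fst s' 6"
        using f 1(5,6) by (simp_all add: frame_def)
      show "runs B (NAssign 6 (NVar 10) (NVar 11) (NVar 18)) s2 (?J (insert (i, j) Z))"
        by (rule runs_NAssign) (use v fr2 1(8) z(2)[OF 1(1,2)] in \<open>simp add: dval_def\<close>)
    qed
  qed (use n in \<open>simp_all add: dval_nput\<close>)
  then show ?thesis by (rule runs_conseq) simp
qed

lemma runs_write_result:
  assumes n: "fst s 0 0 0 = n" "n \<le> B"
  shows "runs B write_result s (\<lambda>s'. \<forall>i<n. \<forall>j<n. snd s' 1 i j = dval s i j / real (fst s 22 0 0))"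
proof -
  let ?J = "\<lambda>Z s'. \<forall>i j. (i, j) \<in> Z \<longrightarrow> snd s' 1 i j = dval s i j / real (fst s 22 0 0)"
  have "runs B write_result s (?J ({..<n} \<times> {..<n}))"
    unfolding write_result_def
  proof (rule runs_For2[where J = ?J and ?n1.0 = n and ?n2.0 = n], goal_cases)
    case (1 Z i j s')
    have fr: "fst s' 22 = fst s 22" "fst s' 6 = fst s 6"
      using 1(4) by (simp_all add: frame_def)
    show ?case
      by (rule runs_RAssign) (use 1(5,6,8) fr in \<open>simp add: dval_def\<close>)
  qed (use n in simp_all)
  then show ?thesis by (rule runs_conseq) simp
qed

text \<open>All constraints are homogeneous in the entries and the unit together, which allows the
  pivots to run on naturals with unit \<open>D\<close> and the result to be divided by
  \<open>D\<close>.\<close>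

lemma cov_pt_scale:
  assumes "0 < c"
  shows "cov_pt n P (c * u) (\<lambda>i j. c * d i j) \<longleftrightarrow> cov_pt n P u d"
  using assms unfolding cov_pt_def
  by (simp add: distrib_left[symmetric] zero_le_mult_iff)

lemma settled_scale:
  assumes "0 < c"
  shows "settled n (c * u) (\<lambda>i j. c * d i j) v \<longleftrightarrow> settled n u d v"
  using assms unfolding settled_def by (simp add: distrib_left[symmetric])

lemma cost_scale: "cost n w (\<lambda>i j. c * d i j) = c * cost n w d"
  by (simp add: cost_def sum_distrib_left mult.assoc)

text \<open>This is [FAS] for numbered vertices: settledness supplies the pair equations, and the
  convention on comparable pairs follows from the monotonicity in \<open>cov_pt\<close>, as
  \<open>read_back\<close> shows.\<close>

definition fas_pt :: "nat \<Rightarrow> (nat \<Rightarrow> nat \<Rightarrow> bool) \<Rightarrow> (nat \<Rightarrow> nat \<Rightarrow> real) \<Rightarrow> bool" where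
  "fas_pt n P d \<longleftrightarrow> cov_pt n P 1 d \<and> (\<forall>v<n. settled n 1 d v)"

text \<open>All that the programs need to know about the instance. Quantifying over every closure
  \<open>y\<close> separates the properties of the closure, proved from [COV] in
  \<open>closed_input_memory\<close>, from its computation.\<close>

definition closed_input :: "nat \<Rightarrow> memory \<Rightarrow> bool" where
  "closed_input n s \<longleftrightarrow> fst s 0 0 0 = n \<and> hemi n (snd s 0) \<and>
     (\<forall>y. (\<forall>i<n. \<forall>j<n. is_closure n (\<lambda>i j. 0 < fst s 1 i j) (snd s 1) i j (y i j)) \<longrightarrow>
        cov_pt n (\<lambda>i j. 0 < fst s 1 i j) 1 y \<and> cost n (snd s 0) y \<le> cost n (snd s 0) (snd s 1))"

text \<open>The integrality of the rescaled result holds because the pivots keep the solution in a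
  natural array. For unit 1 it turns the bounds 0 and 1 into an integral solution.\<close>

lemma runs_finish:
  assumes n: "fst s 0 0 0 = n" "n \<le> B" and u: "0 < fst s 22 0 0"
    and c: "cov_pt n P (real (fst s 22 0 0)) (dval s)" and w: "hemi n (snd s 0)"
  shows "runs B (Seq pivots write_result) s (\<lambda>s'. fas_pt n P (snd s' 1) \<and>
     real (fst s 22 0 0) * cost n (snd s 0) (snd s' 1) \<le> cost n (snd s 0) (dval s) \<and>
     (\<forall>i<n. \<forall>j<n. real (fst s 22 0 0) * snd s' 1 i j \<in> \<int>))"
proof -
  define u where "u = real (fst s 22 0 0)"
  have u0: "0 < u" using u by (simp add: u_def)
  show ?thesis
  proof (rule runs_Seq[OF runs_pivots[OF n refl c w]])
    fix s1 assume f: "frame pivots s s1" and p: "cov_pt n P (real (fst s 22 0 0)) (dval s1) \<and>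
      (\<forall>v<n. settled n (real (fst s 22 0 0)) (dval s1) v) \<and> cost n (snd s 0) (dval s1) \<le> cost n (snd s 0) (dval s)"
    have fr: "fst s1 0 0 0 = n" "fst s1 22 = fst s 22" using f n by (simp_all add: frame_def)
    show "runs B write_result s1 (\<lambda>s'. fas_pt n P (snd s' 1) \<and>
     real (fst s 22 0 0) * cost n (snd s 0) (snd s' 1) \<le> cost n (snd s 0) (dval s) \<and>
     (\<forall>i<n. \<forall>j<n. real (fst s 22 0 0) * snd s' 1 i j \<in> \<int>))"
    proof (rule runs_conseq[OF runs_write_result[OF fr(1) n(2)]])
      fix s2 assume "\<forall>i<n. \<forall>j<n. snd s2 1 i j = dval s1 i j / real (fst s1 22 0 0)"
      then have d: "u * snd s2 1 i j = dval s1 i j" if "i < n" "j < n" for i j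
        using that u0 fr by (simp add: u_def)
      let ?d = "\<lambda>i j. u * snd s2 1 i j"
      have "cov_pt n P (u * 1) ?d"
        using p cov_pt_cong[of n ?d "dval s1" P u] d by (simp add: u_def)
      moreover have "settled n (u * 1) ?d v" if "v < n" for v
        using p that settled_cong[of n ?d "dval s1" v u] d by (simp add: u_def)
      ultimately have "fas_pt n P (snd s2 1)"
        unfolding fas_pt_def using cov_pt_scale[OF u0] settled_scale[OF u0] by blast
      moreover have "u * cost n (snd s 0) (snd s2 1) \<le> cost n (snd s 0) (dval s)"
        using p cost_cong[of n ?d "dval s1" "snd s 0"] d by (simp add: cost_scale)
      ultimately show "fas_pt n P (snd s2 1) \<and>
        real (fst s 22 0 0) * cost n (snd s 0) (snd s2 1) \<le> cost n (snd s 0) (dval s) \<and>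
        (\<forall>i<n. \<forall>j<n. real (fst s 22 0 0) * snd s2 1 i j \<in> \<int>)"
        using d unfolding u_def by (simp add: dval_def)
    qed
  qed
qed

text \<open>A sum that dominates every loop limit: \<open>n\<close>, the \<open>n * n + 1\<close>
  coordinates including the dummy, the at most \<open>5 * n ^ 3\<close> rows, and the number of
  powers of two.\<close>

definition loop_bound :: "nat \<Rightarrow> nat" where
  "loop_bound n = n + Suc (n * n) + 5 * (n * (n * n)) + 2 * (Suc (n * n) * Suc (n * n))"

lemma runs_integral_program:
  assumes ok: "closed_input n s" and int: "\<And>i j. i < n \<Longrightarrow> j < n \<Longrightarrow> i \<noteq> j \<Longrightarrow> snd s 1 i j \<in> {0, 1}"
  shows "runs (loop_bound n) integral_program s (\<lambda>s'. fas_pt n (\<lambda>i j. 0 < fst s 1 i j) (snd s' 1) \<and>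
     cost n (snd s 0) (snd s' 1) \<le> cost n (snd s 0) (snd s 1) \<and>
     (\<forall>i<n. \<forall>j<n. snd s' 1 i j \<in> {0, 1}))"
proof -
  let ?B = "loop_bound n" and ?P = "\<lambda>i j. 0 < fst s 1 i j"
  have n: "fst s 0 0 0 = n" "n \<le> ?B" and w: "hemi n (snd s 0)"
    using ok by (simp_all add: closed_input_def loop_bound_def)
  show ?thesis
    unfolding integral_program_def
  proof (rule runs_Seq[OF runs_close[OF n]])
    fix s1 assume f1: "frame close s s1" and cl: "\<forall>i<n. \<forall>j<n. is_closure n ?P (snd s 1) i j (snd s1 2 i j)"
    have c1: "cov_pt n ?P 1 (snd s1 2)" and co1: "cost n (snd s 0) (snd s1 2) \<le> cost n (snd s 0) (snd s 1)"
      using ok cl unfolding closed_input_def by blast+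
    have y01: "snd s1 2 i j \<in> {0, 1}" if "i < n" "j < n" for i j
      by (rule closure_01[of n ?P "snd s 1" i j]) (use cl that int in blast)+
    have fr1: "fst s1 0 0 0 = n" "snd s1 0 = snd s 0" using f1 n by (simp_all add: frame_def)
    show "runs ?B (Seq round_closure (Seq pivots write_result)) s1
      (\<lambda>s'. fas_pt n ?P (snd s' 1) \<and> cost n (snd s 0) (snd s' 1) \<le> cost n (snd s 0) (snd s 1) \<and>
       (\<forall>i<n. \<forall>j<n. snd s' 1 i j \<in> {0, 1}))"
    proof (rule runs_Seq[OF runs_round_closure[OF fr1(1) n(2) y01]])
      fix s2 assume f2: "frame round_closure s1 s2"
        and p2: "fst s2 22 0 0 = 1 \<and> (\<forall>i<n. \<forall>j<n. dval s2 i j = snd s1 2 i j)"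
      have fr2: "fst s2 0 0 0 = n" "snd s2 0 = snd s 0"
        using f2 fr1 by (simp_all add: frame_def round_closure_def)
      have c2: "cov_pt n ?P (real (fst s2 22 0 0)) (dval s2)"
        using c1 p2 cov_pt_cong[of n "dval s2" "snd s1 2" ?P 1] by simp
      have co2: "cost n (snd s 0) (dval s2) = cost n (snd s 0) (snd s1 2)"
        using p2 by (intro cost_cong) simp
      show "runs ?B (Seq pivots write_result) s2
        (\<lambda>s'. fas_pt n ?P (snd s' 1) \<and> cost n (snd s 0) (snd s' 1) \<le> cost n (snd s 0) (snd s 1) \<and>
         (\<forall>i<n. \<forall>j<n. snd s' 1 i j \<in> {0, 1}))"
      proof (rule runs_conseq[OF runs_finish[OF fr2(1) n(2) _ c2]])
        show "0 < fst s2 22 0 0" "hemi n (snd s2 0)" using p2 fr2 w by simp_all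
        fix s3 assume p3: "fas_pt n ?P (snd s3 1) \<and>
          real (fst s2 22 0 0) * cost n (snd s2 0) (snd s3 1) \<le> cost n (snd s2 0) (dval s2) \<and>
          (\<forall>i<n. \<forall>j<n. real (fst s2 22 0 0) * snd s3 1 i j \<in> \<int>)"
        have "snd s3 1 i j \<in> {0, 1}" if "i < n" "j < n" for i j
        proof -
          have "snd s3 1 i j \<in> \<int>" "0 \<le> snd s3 1 i j" "snd s3 1 i j \<le> 1"
            using p3 p2 that cov_ptD(2,3)[of n ?P 1 "snd s3 1" i j] by (simp_all add: fas_pt_def)
          then show ?thesis by (auto elim!: Ints_cases)
        qed
        then show "fas_pt n ?P (snd s3 1) \<and> cost n (snd s 0) (snd s3 1) \<le> cost n (snd s 0) (snd s 1) \<and>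
         (\<forall>i<n. \<forall>j<n. snd s3 1 i j \<in> {0, 1})"
          using p3 p2 fr2 co1 co2 by simp
      qed
    qed
  qed
qed

lemma rows_in_memory:
  assumes "rowset s = R" "n * n = N" "R = all_rows n P"
  shows "rows_ok N s" "z N = 0 \<Longrightarrow> feasible s z \<longleftrightarrow> cov_pt n P 1 (\<lambda>i j. z (ix n i j))"
proof -
  have row: "(fst s 4 0 m, fst s 4 2 m, fst s 4 3 m, fst s 4 4 m, rhs s m) \<in> R" if "m < fst s 16 0 0" for m
    using assms(1) that unfolding rowset_def rhs_def by blast
  have ex: "\<exists>m<fst s 16 0 0. fst s 4 0 m = a \<and> fst s 4 2 m = b \<and> fst s 4 3 m = c \<and> fst s 4 4 m = q"
    if "(a, b, c, q, \<beta>) \<in> R" for a b c q \<beta>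
    using that assms(1) unfolding rowset_def by blast
  show "rows_ok N s"
    unfolding rows_ok_def
  proof (intro conjI allI impI)
    fix m assume "m < fst s 16 0 0"
    then have "(fst s 4 0 m, fst s 4 2 m, fst s 4 3 m, fst s 4 4 m, rhs s m) \<in> all_rows n P"
      using row assms(3) by simp
    from all_rows_bounds[OF this]
    show "fst s 4 0 m \<le> N" "fst s 4 2 m \<le> N" "fst s 4 3 m \<le> N" "fst s 4 4 m \<le> N" "rhs s m \<in> \<int>"
      unfolding assms(2) by blast+
  next
    fix t assume "t < N"
    then have "t < n * n" using assms(2) by simp
    from all_rows_box[OF this]
    show "\<exists>m<fst s 16 0 0. fst s 4 0 m = t \<and> fst s 4 2 m = N \<and> fst s 4 3 m = N \<and> fst s 4 4 m = N"
      "\<exists>m<fst s 16 0 0. fst s 4 0 m = N \<and> fst s 4 2 m = N \<and> fst s 4 3 m = N \<and> fst s 4 4 m = t"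
      using ex assms(3) unfolding assms(2) by blast+
  qed
  have "feasible s z \<longleftrightarrow> (\<forall>r\<in>R. sat z r)"
    unfolding assms(1)[symmetric] rowset_def feasible_def rhs_def lin_def by auto
  then show "z N = 0 \<Longrightarrow> feasible s z \<longleftrightarrow> cov_pt n P 1 (\<lambda>i j. z (ix n i j))"
    using all_rows_cov_pt[of z n P] assms(2,3) by simp
qed

lemma sum_ix: "(\<Sum>k<n * n. f k) = (\<Sum>i<n. \<Sum>j<n. f (ix n i j) :: real)"
proof -
  have "bij_betw (\<lambda>(i, j). ix n i j) ({..<n} \<times> {..<n}) {..<n * n}"
  proof (rule bij_betwI')
    show "((case x of (i, j) \<Rightarrow> ix n i j) = (case y of (i, j) \<Rightarrow> ix n i j)) = (x = y)"
      if "x \<in> {..<n} \<times> {..<n}" "y \<in> {..<n} \<times> {..<n}" for x y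
      using that ix_inj[of "snd x" n "snd y" "fst x" "fst y"] by (auto simp: case_prod_unfold prod_eq_iff)
    show "(case x of (i, j) \<Rightarrow> ix n i j) \<in> {..<n * n}" if "x \<in> {..<n} \<times> {..<n}" for x
      using that ix_less by (auto simp: case_prod_unfold)
    show "\<exists>x\<in>{..<n} \<times> {..<n}. y = (case x of (i, j) \<Rightarrow> ix n i j)" if "y \<in> {..<n * n}" for y
      using ix_surj[of y n] that by auto
  qed
  from sum.reindex_bij_betw[OF this, of f] show ?thesis
    by (simp add: sum.cartesian_product case_prod_unfold)
qed

lemma runs_fractional_program:
  assumes ok: "closed_input n s"
  shows "runs (loop_bound n) fractional_program s (\<lambda>s'. fas_pt n (\<lambda>i j. 0 < fst s 1 i j) (snd s' 1) \<and>
     cost n (snd s 0) (snd s' 1) \<le> cost n (snd s 0) (snd s 1))"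
proof -
  define B where "B = loop_bound n"
  let ?P = "\<lambda>i j. 0 < fst s 1 i j" and ?N = "n * n" and ?w = "snd s 0"
  let ?Q = "\<lambda>s'. fas_pt n ?P (snd s' 1) \<and> cost n ?w (snd s' 1) \<le> cost n ?w (snd s 1)"
  have n: "fst s 0 0 0 = n" "n \<le> B" and w: "hemi n ?w"
    using ok by (simp_all add: closed_input_def loop_bound_def B_def)
  have NB: "?N \<le> B" "Suc ?N \<le> B" "5 * (n * (n * n)) \<le> B" "2 * (Suc ?N * Suc ?N) \<le> B"
    by (simp_all add: B_def loop_bound_def)
  show ?thesis
    unfolding fractional_program_def B_def[symmetric]
  proof (rule runs_Seq[OF runs_close[OF n]])
    fix s1 assume f1: "frame close s s1" and cl: "\<forall>i<n. \<forall>j<n. is_closure n ?P (snd s 1) i j (snd s1 2 i j)"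
    have c1: "cov_pt n ?P 1 (snd s1 2)" and co1: "cost n ?w (snd s1 2) \<le> cost n ?w (snd s 1)"
      using ok cl unfolding closed_input_def by blast+
    have fr1: "fst s1 0 0 0 = n" "snd s1 0 = ?w" "fst s1 1 = fst s 1" using f1 n by (simp_all add: frame_def)
    show "runs B (Seq tables (Seq make_rows (Seq make_powers (Seq purify (Seq read_vertex (Seq pivots write_result)))))) s1 ?Q"
    proof (rule runs_Seq[OF runs_tables[OF fr1(1) n(2)]])
      fix s2 assume f2: "frame tables s1 s2" and p2: "fst s2 14 0 0 = ?N \<and> fst s2 15 0 0 = Suc ?N \<and> snd s2 3 0 ?N = 0 \<and>
        (\<forall>i<n. \<forall>j<n. fst s2 3 i j = ix n i j \<and> snd s2 6 0 (ix n i j) = snd s1 0 i j \<and>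
        snd s2 3 0 (ix n i j) = snd s1 2 i j)"
      have fr2: "fst s2 0 0 0 = n" "snd s2 0 = ?w" "fst s2 1 = fst s 1" using f2 fr1 by (simp_all add: frame_def)
      have ix2: "fst s2 3 i j = ix n i j" if "i < n" "j < n" for i j using p2 that by blast
      have w2: "snd s2 6 0 (ix n i j) = ?w i j" if "i < n" "j < n" for i j using p2 that fr1 by simp
      show "runs B (Seq make_rows (Seq make_powers (Seq purify (Seq read_vertex (Seq pivots write_result))))) s2 ?Q"
      proof (rule runs_Seq[OF runs_make_rows[OF fr2(1) n(2) _ ix2]])
        show "fst s2 14 0 0 = ?N" using p2 by blast
        fix s3 assume f3: "frame make_rows s2 s3"
          and "rowset s3 = all_rows n (\<lambda>i j. 0 < fst s2 1 i j) \<and> fst s3 16 0 0 \<le> 5 * (n * (n * n))"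
        then have R3: "rowset s3 = all_rows n ?P" and M3: "fst s3 16 0 0 \<le> B"
          using fr2 NB(3) by simp_all
        have fr3: "fst s3 0 0 0 = n" "snd s3 0 = ?w" "fst s3 14 0 0 = ?N" "fst s3 15 0 0 = Suc ?N" "fst s3 3 = fst s2 3"
          "snd s3 3 = snd s2 3" "snd s3 6 = snd s2 6"
          using f3 fr2 p2 by (simp_all add: frame_def)
        show "runs B (Seq make_powers (Seq purify (Seq read_vertex (Seq pivots write_result)))) s3 ?Q"
        proof (rule runs_Seq[OF runs_make_powers[OF fr3(4) NB(2)]])
          fix s4 assume f4: "frame make_powers s3 s4" and p4: "power_table s4 \<and> fst s4 17 0 0 = 2 * (Suc ?N * Suc ?N)"
          have fr4: "fst s4 0 0 0 = n" "snd s4 0 = ?w" "fst s4 14 0 0 = ?N" "fst s4 15 0 0 = Suc ?N" "fst s4 3 = fst s2 3"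
            "snd s4 3 = snd s2 3" "snd s4 6 = snd s2 6" "fst s4 16 0 0 \<le> B"
            using f4 fr3 M3 by (simp_all add: frame_def)
          have R4: "rowset s4 = all_rows n ?P"
            using f4 R3 by (simp add: frame_def rowset_def)
          have r4: "conv_ready B s4" using p4 NB(4) by (simp add: conv_ready_def)
          note rows = rows_in_memory[OF R4 refl refl]
          have y4: "snd s4 3 0 ?N = 0" using p2 fr4 by simp
          have c4: "cov_pt n ?P 1 (\<lambda>i j. snd s4 3 0 (ix n i j))"
            using c1 p2 fr4 cov_pt_cong[of n "\<lambda>i j. snd s4 3 0 (ix n i j)" "snd s1 2" ?P 1] by simp
          have flat: "(\<Sum>k<?N. y k * snd s4 6 0 k) = cost n ?w (\<lambda>i j. y (ix n i j))" for y
            unfolding sum_ix cost_def by (intro sum.cong) (simp_all add: fr4 w2)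
          have co4: "cost n ?w (\<lambda>i j. snd s4 3 0 (ix n i j)) = cost n ?w (snd s1 2)"
            by (rule cost_cong) (use p2 fr4 in simp)
          have feas4: "feasible s4 (snd s4 3 0)" using rows(2)[of "snd s4 3 0"] y4 c4 by simp
          show "runs B (Seq purify (Seq read_vertex (Seq pivots write_result))) s4 ?Q"
          proof (rule runs_Seq[OF runs_purify[OF rows(1) fr4(3) NB(1) fr4(4) NB(2) fr4(8) r4 _ feas4 y4]])
            show "fst s4 17 0 0 = 2 * (Suc ?N * Suc ?N)" using p4 by blast
            fix s5 assume f5: "frame purify s4 s5" and p5: "feasible s4 (snd s5 3 0) \<and> snd s5 3 0 ?N = 0 \<and>
               (\<Sum>k<?N. snd s5 3 0 k * snd s4 6 0 k) \<le> (\<Sum>k<?N. snd s4 3 0 k * snd s4 6 0 k) \<and>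
               0 < fst s5 22 0 0 \<and> real (fst s5 22 0 0) \<le> fact ?N * 3 ^ ?N \<and>
               (\<forall>k<?N. real (fst s5 22 0 0) * snd s5 3 0 k \<in> \<int>)"
            define D where "D = real (fst s5 22 0 0)"
            define y where "y i j = snd s5 3 0 (ix n i j)" for i j
            have D: "0 < D" "D \<le> fact ?N * 3 ^ ?N" using p5 by (simp_all add: D_def)
            have c5: "cov_pt n ?P 1 y" using rows(2)[of "snd s5 3 0"] p5 unfolding y_def by blast
            have co5: "cost n ?w y \<le> cost n ?w (snd s 1)"
              using p5 co4 co1 unfolding flat y_def by simp
            have fr5: "fst s5 0 0 0 = n" "snd s5 0 = ?w" "fst s5 3 = fst s2 3" "fst s5 5 = fst s4 5" "fst s5 17 = fst s4 17"
              using f5 fr4 by (simp_all add: frame_def)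
            show "runs B (Seq read_vertex (Seq pivots write_result)) s5 ?Q"
            proof (rule runs_Seq[OF runs_read_vertex[where z = "\<lambda>i j. D * y i j", OF fr5(1) n(2)]])
              show "fst s5 3 i j = ix n i j" if "i < n" "j < n" for i j using ix2[OF that] fr5 by simp
              show "conv_ready B s5" using conv_ready_frame[OF r4 fr5(4,5)] .
              show "D * y i j = real (fst s5 22 0 0) * snd s5 3 0 (ix n i j)" for i j
                by (simp add: D_def y_def)
              show "D * y i j \<in> \<int> \<and> 0 \<le> D * y i j \<and> D * y i j < 2 ^ fst s5 17 0 0" if ij: "i < n" "j < n" for i j
              proof -
                have y01: "0 \<le> y i j" "y i j \<le> 1" using cov_ptD(2,3)[OF c5 ij] .
                have "0 < ?N" using ij by simp
                then have "4 * D < 2 ^ fst s5 17 0 0"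
                  using entry_bound_pow[of ?N] D(2) p4 fr5 by simp
                moreover have "D * y i j \<le> D * 1" using y01 D by (intro mult_left_mono) simp_all
                ultimately have "D * y i j < 2 ^ fst s5 17 0 0" using D(1) by linarith
                moreover have "D * y i j \<in> \<int>" using p5 ix_less[OF ij] unfolding D_def y_def by blast
                ultimately show ?thesis using y01 D by simp
              qed
              fix s6 assume f6: "frame read_vertex s5 s6" and p6: "\<forall>i<n. \<forall>j<n. dval s6 i j = D * y i j"
              have fr6: "fst s6 0 0 0 = n" "snd s6 0 = ?w" "fst s6 22 = fst s5 22"
                using f6 fr5 by (simp_all add: frame_def read_vertex_def)
              have "cov_pt n ?P (D * 1) (\<lambda>i j. D * y i j)" using c5 cov_pt_scale[OF D(1)] by blast
              then have c6: "cov_pt n ?P (real (fst s6 22 0 0)) (dval s6)"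
                using p6 fr6 cov_pt_cong[of n "dval s6" "\<lambda>i j. D * y i j" ?P D] by (simp add: D_def)
              have co6: "cost n ?w (dval s6) = D * cost n ?w y"
                using p6 cost_cong[of n "dval s6" "\<lambda>i j. D * y i j" ?w] by (simp add: cost_scale)
              show "runs B (Seq pivots write_result) s6 ?Q"
              proof (rule runs_conseq[OF runs_finish[OF fr6(1) n(2) _ c6]])
                show "0 < fst s6 22 0 0" "hemi n (snd s6 0)" using p5 fr6 w by simp_all
                fix s7 assume p7: "fas_pt n ?P (snd s7 1) \<and>
                  real (fst s6 22 0 0) * cost n (snd s6 0) (snd s7 1) \<le> cost n (snd s6 0) (dval s6) \<and>
                  (\<forall>i<n. \<forall>j<n. real (fst s6 22 0 0) * snd s7 1 i j \<in> \<int>)"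
                then have "D * cost n ?w (snd s7 1) \<le> D * cost n ?w y"
                  using co6 fr6 by (simp add: D_def)
                then show "?Q s7" using p7 co5 D(1) by simp
              qed
            qed
          qed
        qed
      qed
    qed
  qed
qed

lemma time_bound_poly: "\<exists>p :: nat poly. \<forall>n. time c (loop_bound n) = poly p n"
proof -
  obtain q :: "nat poly" where q: "\<And>B. time c B = poly q B" using time_poly by blast
  let ?X = "[:0, 1:] :: nat poly"
  let ?r = "?X + (1 + ?X * ?X) + 5 * (?X * (?X * ?X)) + 2 * ((1 + ?X * ?X) * (1 + ?X * ?X))"
  have "poly ?r n = loop_bound n" for n by (simp add: loop_bound_def)
  then have "time c (loop_bound n) = poly (pcompose q ?r) n" for n
    by (simp add: q poly_pcompose)
  then show ?thesis by blast
qed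

section \<open>From numbered vertices back to the given instance\<close>

context
  fixes V :: "'a set" and P :: "'a rel" and w :: "'a \<times> 'a \<Rightarrow> real" and e :: "nat \<Rightarrow> 'a"
  assumes fin: "finite V" and po: "partial_order_on V P" and hw: "hemimetric_on V w"
    and bij: "bij_betw e {..<card V} V"
begin

lemma e_mem: "i < card V \<Longrightarrow> e i \<in> V"
  using bij by (auto simp: bij_betw_def)

lemma e_inj: "i < card V \<Longrightarrow> j < card V \<Longrightarrow> e i = e j \<longleftrightarrow> i = j"
  using bij by (auto simp: bij_betw_def inj_on_def)

lemma objective_cost:
  "objective V w \<delta> = cost (card V) (\<lambda>i j. w (e i, e j)) (\<lambda>i j. if i = j then 0 else \<delta> (e i, e j))"
proof -
  let ?n = "card V"
  let ?f = "\<lambda>(a, b). if a = b then 0 else \<delta> (a, b) * w (a, b)"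
  have bij2: "bij_betw (map_prod e e) ({..<?n} \<times> {..<?n}) (V \<times> V)"
    using bij by (intro bij_betw_map_prod)
  have "objective V w \<delta> = (\<Sum>p\<in>V \<times> V. ?f p)"
    unfolding objective_def using fin by (intro sum.mono_neutral_cong_left) auto
  also have "\<dots> = (\<Sum>p\<in>{..<?n} \<times> {..<?n}. ?f (map_prod e e p))"
    using sum.reindex_bij_betw[OF bij2, of ?f] by simp
  also have "\<dots> = (\<Sum>(i, j)\<in>{..<?n} \<times> {..<?n}. (if i = j then 0 else \<delta> (e i, e j)) * w (e i, e j))"
    by (intro sum.cong) (auto simp: e_inj)
  finally show ?thesis by (simp add: cost_as_sum)
qed

lemma input_simps:
  "fst (input_memory e V P w \<delta>) 0 0 0 = card V"
  "i < card V \<Longrightarrow> j < card V \<Longrightarrow> 0 < fst (input_memory e V P w \<delta>) (Suc 0) i j \<longleftrightarrow> (e i, e j) \<in> P"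
  "i < card V \<Longrightarrow> j < card V \<Longrightarrow> snd (input_memory e V P w \<delta>) 0 i j = w (e i, e j)"
  "i < card V \<Longrightarrow> j < card V \<Longrightarrow> snd (input_memory e V P w \<delta>) (Suc 0) i j = (if i = j then 0 else \<delta> (e i, e j))"
  by (simp_all add: input_memory_def)

lemma cost_input:
  assumes "\<And>i j. i < card V \<Longrightarrow> j < card V \<Longrightarrow> i \<noteq> j \<Longrightarrow> d i j = \<delta>' (e i, e j)"
    "\<And>i. i < card V \<Longrightarrow> d i i = 0"
  shows "cost (card V) (snd (input_memory e V P w \<delta>) 0) d = objective V w \<delta>'"
  unfolding objective_cost cost_def using assms by (intro sum.cong) (simp_all add: input_simps)

text \<open>The input meets the hypotheses of \<open>closure_cov_pt\<close>: entries on comparable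
  pairs are 0 or 1 by convention, all others are nonnegative by assumption. The closure lies below
  the input entrywise, and nonnegative weights turn this into a comparison of costs.\<close>

lemma closed_input_memory:
  assumes c: "cov_constraints V P \<delta>" and nn: "\<forall>p\<in>inc V P. 0 \<le> \<delta> p"
  shows "closed_input (card V) (input_memory e V P w \<delta>)"
proof -
  let ?s = "input_memory e V P w \<delta>" and ?n = "card V"
  let ?P = "\<lambda>i j. 0 < fst ?s 1 i j" and ?d = "snd ?s 1"
  note iP = input_simps(2)[of _ _ \<delta>] and id = input_simps(4)[of _ _ \<delta>]
  have refl: "refl_on V P" and trans: "trans P"
    using po by (auto simp: partial_order_on_def preorder_on_def)
  have fc: "fixes_comparable V P \<delta>" using c by (simp add: cov_constraints_def)
  have hemi: "hemi ?n (snd ?s 0)"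
    using hw unfolding hemi_def hemimetric_on_def by (simp add: input_simps e_mem)
  have "cov_pt ?n ?P 1 y \<and> cost ?n (snd ?s 0) y \<le> cost ?n (snd ?s 0) ?d"
    if y: "\<forall>i<?n. \<forall>j<?n. is_closure ?n ?P ?d i j (y i j)" for y
  proof -
    have cl: "is_closure ?n ?P ?d i j (y i j)" if "i < ?n" "j < ?n" for i j using y that by blast
    have r: "?P i i" if "i < ?n" for i
      using refl that e_mem[OF that] by (simp add: iP refl_on_def)
    have t: "?P i k" if "i < ?n" "j < ?n" "k < ?n" "?P i j" "?P j k" for i j k
    proof -
      have "(e i, e j) \<in> P" "(e j, e k) \<in> P" using that by (simp_all add: iP)
      then have "(e i, e k) \<in> P" by (rule transD[OF trans])
      then show ?thesis using that by (simp add: iP)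
    qed
    have pos: "0 \<le> ?d i j" if "i < ?n" "j < ?n" "i \<noteq> j" for i j
    proof (cases "(e i, e j) \<in> inc V P")
      case True
      then show ?thesis using nn that by (simp add: id)
    next
      case False
      then have "(e i, e j) \<in> P \<or> (e j, e i) \<in> P" using that e_mem by (simp add: inc_def)
      then have "\<delta> (e i, e j) = 1 \<or> \<delta> (e i, e j) = 0"
        using fc that e_mem e_inj unfolding fixes_comparable_def by metis
      then show ?thesis using that by (auto simp: id)
    qed
    have fix0: "?d j i = 0" if "i < ?n" "j < ?n" "i \<noteq> j" "?P i j" for i j
      using fc that e_mem e_inj unfolding fixes_comparable_def by (simp add: id iP)
    have C2: "1 \<le> ?d x1 y1 + ?d x2 y2"
      if "x1 < ?n" "y1 < ?n" "x2 < ?n" "y2 < ?n" "x1 \<noteq> y1" "x2 \<noteq> y2" "?P x2 y1" "?P x1 y2" for x1 y1 x2 y2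
      using c that unfolding cov_constraints_def by (simp add: id iP e_mem e_inj)
    have C3: "1 \<le> ?d x1 y1 + ?d x2 y2 + ?d x3 y3"
      if "x1 < ?n" "y1 < ?n" "x2 < ?n" "y2 < ?n" "x3 < ?n" "y3 < ?n" "x1 \<noteq> y1" "x2 \<noteq> y2" "x3 \<noteq> y3"
        "?P x2 y1" "?P x3 y2" "?P x1 y3" for x1 y1 x2 y2 x3 y3
    proof -
      have "\<delta> (e x1, e y1) + \<delta> (e x2, e y2) + \<delta> (e x3, e y3) \<ge> 1"
        using c[unfolded cov_constraints_def, THEN conjunct2, THEN conjunct2, rule_format,
            of "e x1" "e y1" "e x2" "e y2" "e x3" "e y3"] that
        by (simp add: iP e_mem e_inj)
      then show ?thesis using that by (simp add: id)
    qed
    have cp: "cov_pt ?n ?P 1 y"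
      by (rule closure_cov_pt(1)[where d = ?d]; fact cl r t pos fix0 C2 C3)
    have le: "y i j \<le> ?d i j" if "i < ?n" "j < ?n" "i \<noteq> j" for i j
      by (rule closure_cov_pt(2)[where d = ?d and P = ?P and n = ?n]; fact cl r t pos fix0 C2 C3 that)
    have "cost ?n (snd ?s 0) y \<le> cost ?n (snd ?s 0) ?d"
      unfolding cost_def
    proof (intro sum_mono mult_right_mono)
      fix i j assume "i \<in> {..<?n}" "j \<in> {..<?n}"
      then have ij: "i < ?n" "j < ?n" by simp_all
      show "y i j \<le> ?d i j"
        using le[OF ij] cov_ptD(1)[OF cp ij] ij by (cases "i = j") (simp_all add: id)
      show "0 \<le> snd ?s 0 i j" using hemi ij unfolding hemi_def by blast
    qed
    with cp show ?thesis by blast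
  qed
  then show ?thesis
    using hemi by (simp add: closed_input_def input_simps)
qed

text \<open>The result is pulled back along the inverse of \<open>e\<close>; feasibility and
  objective refer only to pairs in \<open>V\<close>, where this inverse is exact.\<close>

lemma read_back:
  assumes ex: "exec c (input_memory e V P w \<delta>) t s" and t: "t \<le> T"
    and fas: "fas_pt (card V) (\<lambda>i j. 0 < fst (input_memory e V P w \<delta>) 1 i j) (snd s 1)"
    and cost: "cost (card V) (snd (input_memory e V P w \<delta>) 0) (snd s 1) \<le>
       cost (card V) (snd (input_memory e V P w \<delta>) 0) (snd (input_memory e V P w \<delta>) 1)"
  shows "\<exists>\<delta>'. transforms_within c e V P w T \<delta> \<delta>' \<and> fas_frac_feasible V P \<delta>' \<and>
    objective V w \<delta>' \<le> objective V w \<delta> \<and>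
    ((\<forall>i<card V. \<forall>j<card V. snd s 1 i j \<in> {0, 1}) \<longrightarrow> fas_feasible V P \<delta>')"
proof -
  let ?n = "card V" and ?P = "\<lambda>i j. 0 < fst (input_memory e V P w \<delta>) 1 i j"
  let ?d = "snd s 1"
  define g where "g = the_inv_into {..<?n} e"
  define \<delta>' where "\<delta>' = (\<lambda>(a, b). ?d (g a) (g b))"
  have inj: "inj_on e {..<?n}" and img: "e ` {..<?n} = V" using bij by (auto simp: bij_betw_def)
  have ge: "g (e i) = i" if "i < ?n" for i
    unfolding g_def using the_inv_into_f_f[OF inj] that by simp
  have \<delta>'e: "\<delta>' (e i, e j) = ?d i j" if "i < ?n" "j < ?n" for i j
    using that by (simp add: \<delta>'_def ge)
  have allV: "(\<forall>a\<in>V. Q a) \<longleftrightarrow> (\<forall>i<?n. Q (e i))" for Q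
  proof -
    have "(\<forall>a\<in>e ` {..<?n}. Q a) \<longleftrightarrow> (\<forall>i<?n. Q (e i))" by auto
    then show ?thesis by (simp only: img)
  qed
  have c: "cov_pt ?n ?P 1 ?d" and st: "\<And>v. v < ?n \<Longrightarrow> settled ?n 1 ?d v"
    using fas by (simp_all add: fas_pt_def)
  have sum1: "?d i j + ?d j i = 1" if "i < ?n" "j < ?n" "i \<noteq> j" for i j
    using st[OF that(2)] that unfolding settled_def by blast
  \<comment> \<open>Monotonicity with the third vertex equal to \<open>i\<close> compares
    \<open>d j i\<close> with the diagonal entry \<open>d i i = 0\<close>. This is why the pivots
    need no special treatment of comparable pairs.\<close>
  have fix': "?d j i = 0" if "i < ?n" "j < ?n" "(e i, e j) \<in> P" for i j
  proof -
    have "?P i j" using that by (simp add: input_simps)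
    then have "?d j i \<le> ?d i i" using cov_ptD(6)[OF c that(1,2,1)] by blast
    then show ?thesis using cov_ptD(1)[OF c that(1,2)] cov_ptD(2)[OF c that(2,1)] by simp
  qed
  have comp: "?d i j = 1 \<and> ?d j i = 0" if "i < ?n" "j < ?n" "i \<noteq> j" "(e i, e j) \<in> P" for i j
    using fix'[OF that(1,2,4)] sum1[OF that(1-3)] by simp
  have fc: "fixes_comparable V P \<delta>'"
    unfolding fixes_comparable_def allV using comp by (auto simp: \<delta>'e e_inj)
  have pair: "\<forall>i\<in>V. \<forall>j\<in>V. i \<noteq> j \<longrightarrow> \<delta>' (i, j) + \<delta>' (j, i) = 1"
    unfolding allV using sum1 by (auto simp: \<delta>'e e_inj)
  have tri: "\<forall>i\<in>V. \<forall>j\<in>V. \<forall>k\<in>V. i \<noteq> j \<longrightarrow> j \<noteq> k \<longrightarrow> i \<noteq> k \<longrightarrow> \<delta>' (i, j) + \<delta>' (j, k) + \<delta>' (k, i) \<ge> 1"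
    unfolding allV using cov_ptD(5)[OF c] by (auto simp: \<delta>'e e_inj)
  have fasc: "fas_constraints V P \<delta>'" using fc pair tri by (simp add: fas_constraints_def)
  have frac: "fas_frac_feasible V P \<delta>'"
    unfolding fas_frac_feasible_def allV using fasc cov_ptD(2,3)[OF c] by (simp add: \<delta>'e)
  have int: "fas_feasible V P \<delta>'" if "\<forall>i<?n. \<forall>j<?n. ?d i j \<in> {0, 1}"
    unfolding fas_feasible_def allV using fasc that by (simp add: \<delta>'e)
  have hold: "holds_solution e V s \<delta>'" by (simp add: holds_solution_def \<delta>'e)
  have "objective V w \<delta>' = cost ?n (snd (input_memory e V P w \<delta>) 0) ?d"
    by (rule cost_input[symmetric]) (use \<delta>'e cov_ptD(1)[OF c] in simp_all)
  moreover have "objective V w \<delta> = cost ?n (snd (input_memory e V P w \<delta>) 0) (snd (input_memory e V P w \<delta>) 1)"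
    by (rule cost_input[symmetric]) (simp_all add: input_simps)
  ultimately have "objective V w \<delta>' \<le> objective V w \<delta>" using cost by simp
  then show ?thesis
    using ex t hold frac int unfolding transforms_within_def by blast
qed

end

theorem theorem1:
  shows
    "(\<exists>(c :: com) (p :: nat poly).
        \<forall>(V :: 'a set) (P :: 'a rel) (w :: 'a \<times> 'a \<Rightarrow> real) (e :: nat \<Rightarrow> 'a) (\<delta> :: 'a \<times> 'a \<Rightarrow> real).
          finite V \<longrightarrow> partial_order_on V P \<longrightarrow> hemimetric_on V w \<longrightarrow>
          bij_betw e {..<card V} V \<longrightarrow> cov_feasible V P \<delta> \<longrightarrow>
          (\<exists>\<delta>' :: 'a \<times> 'a \<Rightarrow> real.
             transforms_within c e V P w (poly p (card V)) \<delta> \<delta>' \<and>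
             fas_feasible V P \<delta>' \<and> objective V w \<delta>' \<le> objective V w \<delta>)) \<and>
     (\<exists>(c :: com) (p :: nat poly).
        \<forall>(V :: 'a set) (P :: 'a rel) (w :: 'a \<times> 'a \<Rightarrow> real) (e :: nat \<Rightarrow> 'a) (\<delta> :: 'a \<times> 'a \<Rightarrow> real).
          finite V \<longrightarrow> partial_order_on V P \<longrightarrow> hemimetric_on V w \<longrightarrow>
          bij_betw e {..<card V} V \<longrightarrow> cov_frac_feasible V P \<delta> \<longrightarrow>
          (\<exists>\<delta>' :: 'a \<times> 'a \<Rightarrow> real.
             transforms_within c e V P w (poly p (card V)) \<delta> \<delta>' \<and>
             fas_frac_feasible V P \<delta>' \<and> objective V w \<delta>' \<le> objective V w \<delta>))"
proof (rule conjI, goal_cases)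
  case 1
  obtain p :: "nat poly" where p: "\<And>n. time integral_program (loop_bound n) = poly p n"
    using time_bound_poly by blast
  show ?case
  proof (rule exI[of _ integral_program], rule exI[of _ p], intro allI impI)
    fix V :: "'a set" and P :: "'a rel" and w :: "'a \<times> 'a \<Rightarrow> real" and e :: "nat \<Rightarrow> 'a" and \<delta> :: "'a \<times> 'a \<Rightarrow> real"
    assume a: "finite V" "partial_order_on V P" "hemimetric_on V w" "bij_betw e {..<card V} V" and c: "cov_feasible V P \<delta>"
    let ?s = "input_memory e V P w \<delta>"
    have cc: "cov_constraints V P \<delta>" and inc01: "\<And>q. q \<in> inc V P \<Longrightarrow> \<delta> q \<in> {0, 1}"
      using c by (auto simp: cov_feasible_def)
    have nn: "\<forall>q\<in>inc V P. 0 \<le> \<delta> q" using inc01 by fastforce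
    have int: "snd ?s 1 i j \<in> {0, 1}" if ij: "i < card V" "j < card V" "i \<noteq> j" for i j
    proof (cases "(e i, e j) \<in> inc V P")
      case True
      then show ?thesis using inc01 ij by (simp add: input_simps(4)[OF a])
    next
      case False
      have m: "e i \<in> V" "e j \<in> V" "e i \<noteq> e j" using e_mem[OF a] e_inj[OF a] ij by auto
      have "fixes_comparable V P \<delta>" using cc by (simp add: cov_constraints_def)
      moreover have "(e i, e j) \<in> P \<or> (e j, e i) \<in> P" using False m by (simp add: inc_def)
      ultimately have "\<delta> (e i, e j) = 1 \<or> \<delta> (e i, e j) = 0" using m unfolding fixes_comparable_def by blast
      then show ?thesis using ij by (auto simp: input_simps(4)[OF a])
    qed
    from runs_integral_program[OF closed_input_memory[OF a cc nn] int]
    obtain t s where "exec integral_program ?s t s" "t \<le> poly p (card V)"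
      "fas_pt (card V) (\<lambda>i j. 0 < fst ?s 1 i j) (snd s 1)"
      "cost (card V) (snd ?s 0) (snd s 1) \<le> cost (card V) (snd ?s 0) (snd ?s 1)"
      and "\<forall>i<card V. \<forall>j<card V. snd s 1 i j \<in> {0, 1}"
      unfolding runs_def p by blast
    then show "\<exists>\<delta>'. transforms_within integral_program e V P w (poly p (card V)) \<delta> \<delta>' \<and>
        fas_feasible V P \<delta>' \<and> objective V w \<delta>' \<le> objective V w \<delta>"
      using read_back[OF a] by blast
  qed
next
  case 2
  obtain p :: "nat poly" where p: "\<And>n. time fractional_program (loop_bound n) = poly p n"
    using time_bound_poly by blast
  show ?case
  proof (rule exI[of _ fractional_program], rule exI[of _ p], intro allI impI)
    fix V :: "'a set" and P :: "'a rel" and w :: "'a \<times> 'a \<Rightarrow> real" and e :: "nat \<Rightarrow> 'a" and \<delta> :: "'a \<times> 'a \<Rightarrow> real"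
    assume a: "finite V" "partial_order_on V P" "hemimetric_on V w" "bij_betw e {..<card V} V" and c: "cov_frac_feasible V P \<delta>"
    let ?s = "input_memory e V P w \<delta>"
    have cc: "cov_constraints V P \<delta>" and nn: "\<forall>q\<in>inc V P. 0 \<le> \<delta> q"
      using c by (auto simp: cov_frac_feasible_def)
    from runs_fractional_program[OF closed_input_memory[OF a cc nn]]
    obtain t s where "exec fractional_program ?s t s" "t \<le> poly p (card V)"
      "fas_pt (card V) (\<lambda>i j. 0 < fst ?s 1 i j) (snd s 1)"
      "cost (card V) (snd ?s 0) (snd s 1) \<le> cost (card V) (snd ?s 0) (snd ?s 1)"
      unfolding runs_def p by blast
    then show "\<exists>\<delta>'. transforms_within fractional_program e V P w (poly p (card V)) \<delta> \<delta>' \<and>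
        fas_frac_feasible V P \<delta>' \<and> objective V w \<delta>' \<le> objective V w \<delta>"
      using read_back[OF a] by blast
  qed
qed

end
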